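(* The equivalence of types $\chi:\sum(A:\mathcal U)\sum(B:\mathcal U)(A\to B)\ \simeq\ \sum(X:\mathcal U)(X\to\mathcal U)$, $\chi(A,B,f):=(B,\ b\mapsto\mathrm{fib}_f b)$, extends to a (naive) isomorphism of the wild categories $\mathsf{Map}$ and $\mathsf{Fam}$.
   Context: The setting is homotopy type theory with a univalent universe $\mathcal U$. $\mathrm{fib}_f b:=\sum(a:A)\,f\,a=b$. It is known (from univalence) that $\chi$ is an equivalence, with inverse $(X,\phi)\mapsto(\sum(x:X)\phi\,x,\ X,\ \mathrm{pr}_1)$. A wild category consists of a type of objects, a type family of arrows, identities, and a composition with identifications for associativity and left/right neutrality (arrow types need not be sets; no higher coherences). A wild functor consists of a function on objects, functions on arrow types, and identifications witnessing preservation of identities and composition. A naive isomorphism of wild categories is a wild functor that is an equivalence on objects and on arrow types. $\mathsf{Map}$: objects are triples $(A:\mathcal U,B:\mathcal U,f:A\to B)$. For $f:A\to B$, $g:X\to Y$, an arrow in $\mathsf{Map}(f,g)$ is a triple $(u:A\to X,\ v:B\to Y,\ \alpha:g\circ u=v\circ f)$. The identity is $(\mathrm{id},\mathrm{id},\mathrm{refl})$; $(u,v,\alpha)$ followed by $(m,n,\beta)\in\mathsf{Map}(g,h)$ is $(m\circ u,n\circ v,\mathrm{ap}_{(-)\circ u}\beta\cdot\mathrm{ap}_{n\circ(-)}\alpha)$. $\mathsf{Fam}$: objects are pairs $(A:\mathcal U,B:A\to\mathcal U)$; $\mathsf{Fam}((A,B);(X,Y)):=\sum(m:A\to X)\prod(a:A)(B(a)\to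 Y(m\,a))$; the identity is $(\mathrm{id},\lambda a.\mathrm{id})$ and $(m,\mu)$ followed by $(n,\nu)$ is $(n\circ m,\lambda a.\nu(m\,a)\circ\mu\,a)$. *)

theory Defs
  imports Main
begin

text \<open>
  HOL types are sets, so homotopy type theory is represented here as a formal system: raw terms,
  the mutually inductive judgements "context", "typing" and "judgemental equality" of intensional
  Martin-Loef type theory with dependent functions, dependent pairs, identity types, a hierarchy
  of universes, function extensionality and univalence.  A statement of homotopy type theory is
  rendered as derivability in this system.
\<close>

section \<open>Raw terms\<close>

text \<open>
  Variables are de Bruijn indices.  \<open>Pi A B\<close>, \<open>Sig A B\<close> bind one variable in \<open>B\<close>, and \<open>Lam b\<close> binds
  one in \<open>b\<close>; no other constructor binds.  \<open>J C d p\<close> is based path induction with motive \<open>C\<close> (a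
  function), \<open>FunExt i j\<close> and \<open>UA i\<close> are the constants witnessing the two axioms.
\<close>

datatype tm =
    Var nat
  | Univ nat
  | Pi tm tm
  | Lam tm
  | App tm tm
  | Sig tm tm
  | MkPair tm tm
  | Fst tm
  | Snd tm
  | Eq tm tm tm
  | Refl
  | J tm tm tm
  | FunExt nat nat
  | UA nat

primrec ren :: "(nat \<Rightarrow> nat) \<Rightarrow> tm \<Rightarrow> tm" where
  "ren r (Var k) = Var (r k)"
| "ren r (Univ i) = Univ i"
| "ren r (Pi A B) = Pi (ren r A) (ren (case_nat 0 (\<lambda>k. Suc (r k))) B)"
| "ren r (Lam b) = Lam (ren (case_nat 0 (\<lambda>k. Suc (r k))) b)"
| "ren r (App f a) = App (ren r f) (ren r a)"
| "ren r (Sig A B) = Sig (ren r A) (ren (case_nat 0 (\<lambda>k. Suc (r k))) B)"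
| "ren r (MkPair a b) = MkPair (ren r a) (ren r b)"
| "ren r (Fst p) = Fst (ren r p)"
| "ren r (Snd p) = Snd (ren r p)"
| "ren r (Eq A a b) = Eq (ren r A) (ren r a) (ren r b)"
| "ren r Refl = Refl"
| "ren r (J C d p) = J (ren r C) (ren r d) (ren r p)"
| "ren r (FunExt i j) = FunExt i j"
| "ren r (UA i) = UA i"

abbreviation shift :: "tm \<Rightarrow> tm" where
  "shift \<equiv> ren Suc"

primrec subst :: "(nat \<Rightarrow> tm) \<Rightarrow> tm \<Rightarrow> tm" where
  "subst s (Var k) = s k"
| "subst s (Univ i) = Univ i"
| "subst s (Pi A B) = Pi (subst s A) (subst (case_nat (Var 0) (\<lambda>k. shift (s k))) B)"
| "subst s (Lam b) = Lam (subst (case_nat (Var 0) (\<lambda>k. shift (s k))) b)"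
| "subst s (App f a) = App (subst s f) (subst s a)"
| "subst s (Sig A B) = Sig (subst s A) (subst (case_nat (Var 0) (\<lambda>k. shift (s k))) B)"
| "subst s (MkPair a b) = MkPair (subst s a) (subst s b)"
| "subst s (Fst p) = Fst (subst s p)"
| "subst s (Snd p) = Snd (subst s p)"
| "subst s (Eq A a b) = Eq (subst s A) (subst s a) (subst s b)"
| "subst s Refl = Refl"
| "subst s (J C d p) = J (subst s C) (subst s d) (subst s p)"
| "subst s (FunExt i j) = FunExt i j"
| "subst s (UA i) = UA i"

abbreviation inst :: "tm \<Rightarrow> tm \<Rightarrow> tm" where
  "inst B a \<equiv> subst (case_nat a Var) B"


section \<open>Named notation for terms\<close>

text \<open>
  To write concrete terms with named variables, an expression is a function from the binding depth
  at which it is placed to a raw term.  A variable bound at depth \<open>n\<close> and used at depth \<open>m > n\<close> is the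
  index \<open>m - Suc n\<close>, so expressions may be placed under further binders without explicit shifting.
  The closed raw term denoted by an expression is its value at depth \<open>0\<close>.
\<close>

type_synonym expr = "nat \<Rightarrow> tm"

definition closed_tm :: "expr \<Rightarrow> tm" ("\<lbrakk>_\<rbrakk>") where
  "\<lbrakk>e\<rbrakk> = e 0"

text \<open>Only meant for closed raw terms, which need no shifting.\<close>

definition const_expr :: "tm \<Rightarrow> expr" where
  "const_expr t = (\<lambda>n. t)"

definition univ :: "nat \<Rightarrow> expr" ("\<U>") where
  "\<U> i = (\<lambda>n. Univ i)"

definition pi :: "expr \<Rightarrow> (expr \<Rightarrow> expr) \<Rightarrow> expr" where
  "pi A B = (\<lambda>n. Pi (A n) (B (\<lambda>m. Var (m - Suc n)) (Suc n)))"

definition sig :: "expr \<Rightarrow> (expr \<Rightarrow> expr) \<Rightarrow> expr" where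
  "sig A B = (\<lambda>n. Sig (A n) (B (\<lambda>m. Var (m - Suc n)) (Suc n)))"

definition lam :: "(expr \<Rightarrow> expr) \<Rightarrow> expr" (binder "\<^bold>\<lambda>" 10) where
  "lam b = (\<lambda>n. Lam (b (\<lambda>m. Var (m - Suc n)) (Suc n)))"

definition app :: "expr \<Rightarrow> expr \<Rightarrow> expr" (infixl "\<cdot>" 90) where
  "f \<cdot> a = (\<lambda>n. App (f n) (a n))"

definition pair :: "expr \<Rightarrow> expr \<Rightarrow> expr" ("\<langle>_,/ _\<rangle>") where
  "\<langle>a, b\<rangle> = (\<lambda>n. MkPair (a n) (b n))"

definition pr1 :: "expr \<Rightarrow> expr" where
  "pr1 p = (\<lambda>n. Fst (p n))"

definition pr2 :: "expr \<Rightarrow> expr" where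
  "pr2 p = (\<lambda>n. Snd (p n))"

definition eq :: "expr \<Rightarrow> expr \<Rightarrow> expr \<Rightarrow> expr" where
  "eq A a b = (\<lambda>n. Eq (A n) (a n) (b n))"

definition refl :: expr where
  "refl = (\<lambda>n. Refl)"

definition path_ind :: "expr \<Rightarrow> expr \<Rightarrow> expr \<Rightarrow> expr" where
  "path_ind C d p = (\<lambda>n. J (C n) (d n) (p n))"

syntax
  "_pi" :: "idt \<Rightarrow> expr \<Rightarrow> expr \<Rightarrow> expr" ("(3\<Pi>'(_ : _')./ _)" [0, 0, 10] 10)
  "_sig" :: "idt \<Rightarrow> expr \<Rightarrow> expr \<Rightarrow> expr" ("(3\<Sigma>'(_ : _')./ _)" [0, 0, 10] 10)
translations
  "\<Pi>(x : A). B" \<rightleftharpoons> "CONST pi A (\<lambda>x. B)"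
  "\<Sigma>(x : A). B" \<rightleftharpoons> "CONST sig A (\<lambda>x. B)"

abbreviation arrow :: "expr \<Rightarrow> expr \<Rightarrow> expr" (infixr "\<rightarrow>" 60) where
  "A \<rightarrow> B \<equiv> pi A (\<lambda>_. B)"

abbreviation times :: "expr \<Rightarrow> expr \<Rightarrow> expr" (infixr "\<otimes>" 65) where
  "A \<otimes> B \<equiv> sig A (\<lambda>_. B)"


section \<open>Basic notions of homotopy type theory\<close>

definition identity :: expr where
  "identity = (\<^bold>\<lambda>x. x)"

definition compose :: "expr \<Rightarrow> expr \<Rightarrow> expr" (infixr "\<odot>" 85) where
  "g \<odot> f = (\<^bold>\<lambda>x. g \<cdot> (f \<cdot> x))"

text \<open>\<open>concat A x p q\<close> is the concatenation of \<open>p : x = y\<close> and \<open>q : y = z\<close> in \<open>A\<close>.\<close>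

definition concat :: "expr \<Rightarrow> expr \<Rightarrow> expr \<Rightarrow> expr \<Rightarrow> expr" where
  "concat A x p q = path_ind (\<^bold>\<lambda>z. \<^bold>\<lambda>_. eq A x z) p q"

text \<open>\<open>ap B h x p : h x = h y\<close> in \<open>B\<close>, for \<open>p : x = y\<close> and \<open>h\<close> with values in \<open>B\<close>.\<close>

definition ap :: "expr \<Rightarrow> expr \<Rightarrow> expr \<Rightarrow> expr \<Rightarrow> expr" where
  "ap B h x p = path_ind (\<^bold>\<lambda>y. \<^bold>\<lambda>_. eq B (h \<cdot> x) (h \<cdot> y)) refl p"

text \<open>The fibre over \<open>b\<close> of a function \<open>f\<close> from \<open>A\<close> to \<open>B\<close>.\<close>

definition fib :: "expr \<Rightarrow> expr \<Rightarrow> expr \<Rightarrow> expr \<Rightarrow> expr" where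
  "fib A B f b = (\<Sigma>(a : A). eq B (f \<cdot> a) b)"

text \<open>Equivalences are bi-invertible maps: a section together with a retraction.\<close>

definition is_equiv :: "expr \<Rightarrow> expr \<Rightarrow> expr \<Rightarrow> expr" where
  "is_equiv A B f =
     (\<Sigma>(g : B \<rightarrow> A). \<Pi>(b : B). eq B (f \<cdot> (g \<cdot> b)) b) \<otimes>
     (\<Sigma>(h : B \<rightarrow> A). \<Pi>(a : A). eq A (h \<cdot> (f \<cdot> a)) a)"

definition equiv :: "expr \<Rightarrow> expr \<Rightarrow> expr" where
  "equiv A B = (\<Sigma>(f : A \<rightarrow> B). is_equiv A B f)"

definition id_equiv :: expr where
  "id_equiv = \<langle>identity, \<langle>\<langle>identity, \<^bold>\<lambda>_. refl\<rangle>, \<langle>identity, \<^bold>\<lambda>_. refl\<rangle>\<rangle>\<rangle>"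

text \<open>The canonical maps from \<open>f = g\<close> to pointwise equality and from \<open>A = B\<close> to \<open>equiv A B\<close>.\<close>

definition happly :: "expr \<Rightarrow> expr \<Rightarrow> expr" where
  "happly B f = (\<^bold>\<lambda>p. \<^bold>\<lambda>x. path_ind (\<^bold>\<lambda>g. \<^bold>\<lambda>_. eq (B \<cdot> x) (f \<cdot> x) (g \<cdot> x)) refl p)"

definition id_to_equiv :: "expr \<Rightarrow> expr" where
  "id_to_equiv A = (\<^bold>\<lambda>p. path_ind (\<^bold>\<lambda>B. \<^bold>\<lambda>_. equiv A B) id_equiv p)"

definition funext_type :: "nat \<Rightarrow> nat \<Rightarrow> expr" where
  "funext_type i j =
     (\<Pi>(A : \<U> i). \<Pi>(B : A \<rightarrow> \<U> j). \<Pi>(f : \<Pi>(x : A). B \<cdot> x). \<Pi>(g : \<Pi>(x : A). B \<cdot> x).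
        is_equiv (eq (\<Pi>(x : A). B \<cdot> x) f g) (\<Pi>(x : A). eq (B \<cdot> x) (f \<cdot> x) (g \<cdot> x)) (happly B f))"

definition univalence_type :: "nat \<Rightarrow> expr" where
  "univalence_type i =
     (\<Pi>(A : \<U> i). \<Pi>(B : \<U> i). is_equiv (eq (\<U> i) A B) (equiv A B) (id_to_equiv A))"


section \<open>Judgements\<close>

text \<open>
  A context lists the types of the variables, innermost first.  Universes are a la Russell; being a
  type means being an element of some universe.  Universes are not cumulative; a function or pair
  type lives in the maximum of the levels of its components.  Functions and pairs have judgemental
  beta and eta, identity types only beta.
\<close>

inductive wf_ctx :: "tm list \<Rightarrow> bool" ("_ ctx" [50] 50)
  and has_type :: "tm list \<Rightarrow> tm \<Rightarrow> tm \<Rightarrow> bool" ("_ \<turnstile> _ : _" [50, 50, 50] 50)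
  and def_eq :: "tm list \<Rightarrow> tm \<Rightarrow> tm \<Rightarrow> tm \<Rightarrow> bool" ("_ \<turnstile> _ \<equiv> _ : _" [50, 50, 50, 50] 50)
where
  ctx_empty: "[] ctx"
| ctx_extend: "\<Gamma> \<turnstile> A : Univ i \<Longrightarrow> (A # \<Gamma>) ctx"

| ty_var: "\<Gamma> ctx \<Longrightarrow> k < length \<Gamma> \<Longrightarrow> \<Gamma> \<turnstile> Var k : ren (\<lambda>j. j + Suc k) (\<Gamma> ! k)"
| ty_conv: "\<Gamma> \<turnstile> t : A \<Longrightarrow> \<Gamma> \<turnstile> A \<equiv> B : Univ i \<Longrightarrow> \<Gamma> \<turnstile> t : B"
| ty_univ: "\<Gamma> ctx \<Longrightarrow> \<Gamma> \<turnstile> Univ i : Univ (Suc i)"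
| ty_pi: "\<Gamma> \<turnstile> A : Univ i \<Longrightarrow> A # \<Gamma> \<turnstile> B : Univ j \<Longrightarrow> \<Gamma> \<turnstile> Pi A B : Univ (max i j)"
| ty_lam: "\<Gamma> \<turnstile> A : Univ i \<Longrightarrow> A # \<Gamma> \<turnstile> b : B \<Longrightarrow> \<Gamma> \<turnstile> Lam b : Pi A B"
| ty_app: "\<Gamma> \<turnstile> f : Pi A B \<Longrightarrow> \<Gamma> \<turnstile> a : A \<Longrightarrow> \<Gamma> \<turnstile> App f a : inst B a"
| ty_sig: "\<Gamma> \<turnstile> A : Univ i \<Longrightarrow> A # \<Gamma> \<turnstile> B : Univ j \<Longrightarrow> \<Gamma> \<turnstile> Sig A B : Univ (max i j)"
| ty_pair: "\<Gamma> \<turnstile> A : Univ i \<Longrightarrow> A # \<Gamma> \<turnstile> B : Univ j \<Longrightarrow> \<Gamma> \<turnstile> a : A \<Longrightarrow> \<Gamma> \<turnstile> b : inst B a \<Longrightarrow>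
    \<Gamma> \<turnstile> MkPair a b : Sig A B"
| ty_fst: "\<Gamma> \<turnstile> p : Sig A B \<Longrightarrow> \<Gamma> \<turnstile> Fst p : A"
| ty_snd: "\<Gamma> \<turnstile> p : Sig A B \<Longrightarrow> \<Gamma> \<turnstile> Snd p : inst B (Fst p)"
| ty_eq: "\<Gamma> \<turnstile> A : Univ i \<Longrightarrow> \<Gamma> \<turnstile> a : A \<Longrightarrow> \<Gamma> \<turnstile> b : A \<Longrightarrow> \<Gamma> \<turnstile> Eq A a b : Univ i"
| ty_refl: "\<Gamma> \<turnstile> a : A \<Longrightarrow> \<Gamma> \<turnstile> Refl : Eq A a a"
| ty_J: "\<Gamma> \<turnstile> a : A \<Longrightarrow> \<Gamma> \<turnstile> b : A \<Longrightarrow>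
    \<Gamma> \<turnstile> C : Pi A (Pi (Eq (shift A) (shift a) (Var 0)) (Univ i)) \<Longrightarrow>
    \<Gamma> \<turnstile> d : App (App C a) Refl \<Longrightarrow> \<Gamma> \<turnstile> p : Eq A a b \<Longrightarrow> \<Gamma> \<turnstile> J C d p : App (App C b) p"
| ty_funext: "\<Gamma> ctx \<Longrightarrow> \<Gamma> \<turnstile> FunExt i j : \<lbrakk>funext_type i j\<rbrakk>"
| ty_ua: "\<Gamma> ctx \<Longrightarrow> \<Gamma> \<turnstile> UA i : \<lbrakk>univalence_type i\<rbrakk>"

| eq_refl: "\<Gamma> \<turnstile> t : A \<Longrightarrow> \<Gamma> \<turnstile> t \<equiv> t : A"
| eq_sym: "\<Gamma> \<turnstile> t \<equiv> u : A \<Longrightarrow> \<Gamma> \<turnstile> u \<equiv> t : A"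
| eq_trans: "\<Gamma> \<turnstile> t \<equiv> u : A \<Longrightarrow> \<Gamma> \<turnstile> u \<equiv> v : A \<Longrightarrow> \<Gamma> \<turnstile> t \<equiv> v : A"
| eq_conv: "\<Gamma> \<turnstile> t \<equiv> u : A \<Longrightarrow> \<Gamma> \<turnstile> A \<equiv> B : Univ i \<Longrightarrow> \<Gamma> \<turnstile> t \<equiv> u : B"

| beta_fun: "\<Gamma> \<turnstile> A : Univ i \<Longrightarrow> A # \<Gamma> \<turnstile> b : B \<Longrightarrow> \<Gamma> \<turnstile> a : A \<Longrightarrow>
    \<Gamma> \<turnstile> App (Lam b) a \<equiv> inst b a : inst B a"
| eta_fun: "\<Gamma> \<turnstile> f : Pi A B \<Longrightarrow> \<Gamma> \<turnstile> f \<equiv> Lam (App (shift f) (Var 0)) : Pi A B"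
| beta_fst: "\<Gamma> \<turnstile> A : Univ i \<Longrightarrow> A # \<Gamma> \<turnstile> B : Univ j \<Longrightarrow> \<Gamma> \<turnstile> a : A \<Longrightarrow> \<Gamma> \<turnstile> b : inst B a \<Longrightarrow>
    \<Gamma> \<turnstile> Fst (MkPair a b) \<equiv> a : A"
| beta_snd: "\<Gamma> \<turnstile> A : Univ i \<Longrightarrow> A # \<Gamma> \<turnstile> B : Univ j \<Longrightarrow> \<Gamma> \<turnstile> a : A \<Longrightarrow> \<Gamma> \<turnstile> b : inst B a \<Longrightarrow>
    \<Gamma> \<turnstile> Snd (MkPair a b) \<equiv> b : inst B a"
| eta_pair: "\<Gamma> \<turnstile> p : Sig A B \<Longrightarrow> \<Gamma> \<turnstile> p \<equiv> MkPair (Fst p) (Snd p) : Sig A B"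
| beta_J: "\<Gamma> \<turnstile> a : A \<Longrightarrow>
    \<Gamma> \<turnstile> C : Pi A (Pi (Eq (shift A) (shift a) (Var 0)) (Univ i)) \<Longrightarrow>
    \<Gamma> \<turnstile> d : App (App C a) Refl \<Longrightarrow> \<Gamma> \<turnstile> J C d Refl \<equiv> d : App (App C a) Refl"

| cong_pi: "\<Gamma> \<turnstile> A : Univ i \<Longrightarrow> \<Gamma> \<turnstile> A \<equiv> A' : Univ i \<Longrightarrow> A # \<Gamma> \<turnstile> B \<equiv> B' : Univ j \<Longrightarrow>
    \<Gamma> \<turnstile> Pi A B \<equiv> Pi A' B' : Univ (max i j)"
| cong_lam: "\<Gamma> \<turnstile> A : Univ i \<Longrightarrow> A # \<Gamma> \<turnstile> b \<equiv> b' : B \<Longrightarrow> \<Gamma> \<turnstile> Lam b \<equiv> Lam b' : Pi A B"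
| cong_app: "\<Gamma> \<turnstile> f \<equiv> f' : Pi A B \<Longrightarrow> \<Gamma> \<turnstile> a \<equiv> a' : A \<Longrightarrow> \<Gamma> \<turnstile> App f a \<equiv> App f' a' : inst B a"
| cong_sig: "\<Gamma> \<turnstile> A : Univ i \<Longrightarrow> \<Gamma> \<turnstile> A \<equiv> A' : Univ i \<Longrightarrow> A # \<Gamma> \<turnstile> B \<equiv> B' : Univ j \<Longrightarrow>
    \<Gamma> \<turnstile> Sig A B \<equiv> Sig A' B' : Univ (max i j)"
| cong_pair: "\<Gamma> \<turnstile> A : Univ i \<Longrightarrow> A # \<Gamma> \<turnstile> B : Univ j \<Longrightarrow> \<Gamma> \<turnstile> a \<equiv> a' : A \<Longrightarrow>
    \<Gamma> \<turnstile> b \<equiv> b' : inst B a \<Longrightarrow> \<Gamma> \<turnstile> MkPair a b \<equiv> MkPair a' b' : Sig A B"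
| cong_fst: "\<Gamma> \<turnstile> p \<equiv> p' : Sig A B \<Longrightarrow> \<Gamma> \<turnstile> Fst p \<equiv> Fst p' : A"
| cong_snd: "\<Gamma> \<turnstile> p \<equiv> p' : Sig A B \<Longrightarrow> \<Gamma> \<turnstile> Snd p \<equiv> Snd p' : inst B (Fst p)"
| cong_eq: "\<Gamma> \<turnstile> A \<equiv> A' : Univ i \<Longrightarrow> \<Gamma> \<turnstile> a \<equiv> a' : A \<Longrightarrow> \<Gamma> \<turnstile> b \<equiv> b' : A \<Longrightarrow>
    \<Gamma> \<turnstile> Eq A a b \<equiv> Eq A' a' b' : Univ i"
| cong_J: "\<Gamma> \<turnstile> a : A \<Longrightarrow> \<Gamma> \<turnstile> b : A \<Longrightarrow>
    \<Gamma> \<turnstile> C \<equiv> C' : Pi A (Pi (Eq (shift A) (shift a) (Var 0)) (Univ i)) \<Longrightarrow>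
    \<Gamma> \<turnstile> d \<equiv> d' : App (App C a) Refl \<Longrightarrow> \<Gamma> \<turnstile> p \<equiv> p' : Eq A a b \<Longrightarrow>
    \<Gamma> \<turnstile> J C d p \<equiv> J C' d' p' : App (App C b) p"


section \<open>Wild categories, wild functors, naive isomorphisms\<close>

text \<open>
  \<open>cmp\<close> takes three objects and composes in diagrammatic order: \<open>cmp \<cdot> x \<cdot> y \<cdot> z \<cdot> f \<cdot> g\<close> is \<open>f\<close>
  followed by \<open>g\<close>.
\<close>

definition wildcat_laws :: "expr \<Rightarrow> expr \<Rightarrow> expr \<Rightarrow> expr \<Rightarrow> expr" where
  "wildcat_laws Ob Hom ide cmp =
     (\<Pi>(w : Ob). \<Pi>(x : Ob). \<Pi>(y : Ob). \<Pi>(z : Ob).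
      \<Pi>(f : Hom \<cdot> w \<cdot> x). \<Pi>(g : Hom \<cdot> x \<cdot> y). \<Pi>(h : Hom \<cdot> y \<cdot> z).
        eq (Hom \<cdot> w \<cdot> z)
           (cmp \<cdot> w \<cdot> y \<cdot> z \<cdot> (cmp \<cdot> w \<cdot> x \<cdot> y \<cdot> f \<cdot> g) \<cdot> h)
           (cmp \<cdot> w \<cdot> x \<cdot> z \<cdot> f \<cdot> (cmp \<cdot> x \<cdot> y \<cdot> z \<cdot> g \<cdot> h))) \<otimes>
     (\<Pi>(x : Ob). \<Pi>(y : Ob). \<Pi>(f : Hom \<cdot> x \<cdot> y).
        eq (Hom \<cdot> x \<cdot> y) (cmp \<cdot> x \<cdot> x \<cdot> y \<cdot> (ide \<cdot> x) \<cdot> f) f) \<otimes>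
     (\<Pi>(x : Ob). \<Pi>(y : Ob). \<Pi>(f : Hom \<cdot> x \<cdot> y).
        eq (Hom \<cdot> x \<cdot> y) (cmp \<cdot> x \<cdot> y \<cdot> y \<cdot> f \<cdot> (ide \<cdot> y)) f)"

definition wildcat :: "nat \<Rightarrow> nat \<Rightarrow> expr" where
  "wildcat i j =
     (\<Sigma>(Ob : \<U> i).
      \<Sigma>(Hom : Ob \<rightarrow> Ob \<rightarrow> \<U> j).
      \<Sigma>(ide : \<Pi>(x : Ob). Hom \<cdot> x \<cdot> x).
      \<Sigma>(cmp : \<Pi>(x : Ob). \<Pi>(y : Ob). \<Pi>(z : Ob). Hom \<cdot> x \<cdot> y \<rightarrow> Hom \<cdot> y \<cdot> z \<rightarrow> Hom \<cdot> x \<cdot> z).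
        wildcat_laws Ob Hom ide cmp)"

definition obj :: "expr \<Rightarrow> expr" where
  "obj C = pr1 C"

definition hom :: "expr \<Rightarrow> expr \<Rightarrow> expr \<Rightarrow> expr" where
  "hom C x y = pr1 (pr2 C) \<cdot> x \<cdot> y"

definition ident :: "expr \<Rightarrow> expr \<Rightarrow> expr" where
  "ident C x = pr1 (pr2 (pr2 C)) \<cdot> x"

definition cmp :: "expr \<Rightarrow> expr \<Rightarrow> expr \<Rightarrow> expr \<Rightarrow> expr \<Rightarrow> expr \<Rightarrow> expr" where
  "cmp C x y z f g = pr1 (pr2 (pr2 (pr2 C))) \<cdot> x \<cdot> y \<cdot> z \<cdot> f \<cdot> g"

definition wildfunctor :: "expr \<Rightarrow> expr \<Rightarrow> expr" where
  "wildfunctor C D =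
     (\<Sigma>(F : obj C \<rightarrow> obj D).
      \<Sigma>(M : \<Pi>(x : obj C). \<Pi>(y : obj C). hom C x y \<rightarrow> hom D (F \<cdot> x) (F \<cdot> y)).
        (\<Pi>(x : obj C).
           eq (hom D (F \<cdot> x) (F \<cdot> x)) (M \<cdot> x \<cdot> x \<cdot> ident C x) (ident D (F \<cdot> x))) \<otimes>
        (\<Pi>(x : obj C). \<Pi>(y : obj C). \<Pi>(z : obj C). \<Pi>(f : hom C x y). \<Pi>(g : hom C y z).
           eq (hom D (F \<cdot> x) (F \<cdot> z))
              (M \<cdot> x \<cdot> z \<cdot> cmp C x y z f g)
              (cmp D (F \<cdot> x) (F \<cdot> y) (F \<cdot> z) (M \<cdot> x \<cdot> y \<cdot> f) (M \<cdot> y \<cdot> z \<cdot> g))))"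

definition on_objects :: "expr \<Rightarrow> expr" where
  "on_objects F = pr1 F"

definition on_arrows :: "expr \<Rightarrow> expr \<Rightarrow> expr \<Rightarrow> expr" where
  "on_arrows F x y = pr1 (pr2 F) \<cdot> x \<cdot> y"

definition naive_iso :: "expr \<Rightarrow> expr \<Rightarrow> expr" where
  "naive_iso C D =
     (\<Sigma>(F : wildfunctor C D).
        is_equiv (obj C) (obj D) (on_objects F) \<otimes>
        (\<Pi>(x : obj C). \<Pi>(y : obj C).
           is_equiv (hom C x y) (hom D (on_objects F \<cdot> x) (on_objects F \<cdot> y)) (on_arrows F x y)))"


section \<open>The wild categories Map and Fam\<close>

text \<open>
  Objects are built from the types in \<open>\<U> l\<close>, which plays the role of the univalent universe.  The
  witnesses of the wild category laws are left as a parameter.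
\<close>

definition Map_ob :: "nat \<Rightarrow> expr" where
  "Map_ob l = (\<Sigma>(A : \<U> l). \<Sigma>(B : \<U> l). A \<rightarrow> B)"

definition dom :: "expr \<Rightarrow> expr" where
  "dom f = pr1 f"

definition cod :: "expr \<Rightarrow> expr" where
  "cod f = pr1 (pr2 f)"

definition fn :: "expr \<Rightarrow> expr" where
  "fn f = pr2 (pr2 f)"

definition Map_hom :: expr where
  "Map_hom = (\<^bold>\<lambda>f. \<^bold>\<lambda>g.
     \<Sigma>(u : dom f \<rightarrow> dom g). \<Sigma>(v : cod f \<rightarrow> cod g). eq (dom f \<rightarrow> cod g) (fn g \<odot> u) (v \<odot> fn f))"

definition Map_id :: expr where
  "Map_id = (\<^bold>\<lambda>f. \<langle>identity, \<langle>identity, refl\<rangle>\<rangle>)"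

definition Map_cmp :: expr where
  "Map_cmp = (\<^bold>\<lambda>f. \<^bold>\<lambda>g. \<^bold>\<lambda>h. \<^bold>\<lambda>s. \<^bold>\<lambda>t.
     (let u = pr1 s; v = pr1 (pr2 s); \<alpha> = pr2 (pr2 s);
          m = pr1 t; n = pr1 (pr2 t); \<beta> = pr2 (pr2 t)
      in \<langle>m \<odot> u, \<langle>n \<odot> v,
           concat (dom f \<rightarrow> cod h) ((fn h \<odot> m) \<odot> u)
             (ap (dom f \<rightarrow> cod h) (\<^bold>\<lambda>k. k \<odot> u) (fn h \<odot> m) \<beta>)
             (ap (dom f \<rightarrow> cod h) (\<^bold>\<lambda>k. n \<odot> k) (fn g \<odot> u) \<alpha>)\<rangle>\<rangle>))"

definition Map_laws :: "nat \<Rightarrow> expr" where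
  "Map_laws l = wildcat_laws (Map_ob l) Map_hom Map_id Map_cmp"

definition Map_cat :: "nat \<Rightarrow> expr \<Rightarrow> expr" where
  "Map_cat l laws = \<langle>Map_ob l, \<langle>Map_hom, \<langle>Map_id, \<langle>Map_cmp, laws\<rangle>\<rangle>\<rangle>\<rangle>"

definition Fam_ob :: "nat \<Rightarrow> expr" where
  "Fam_ob l = (\<Sigma>(A : \<U> l). A \<rightarrow> \<U> l)"

definition Fam_hom :: expr where
  "Fam_hom = (\<^bold>\<lambda>P. \<^bold>\<lambda>Q. \<Sigma>(m : pr1 P \<rightarrow> pr1 Q). \<Pi>(a : pr1 P). pr2 P \<cdot> a \<rightarrow> pr2 Q \<cdot> (m \<cdot> a))"

definition Fam_id :: expr where
  "Fam_id = (\<^bold>\<lambda>P. \<langle>identity, \<^bold>\<lambda>a. identity\<rangle>)"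

definition Fam_cmp :: expr where
  "Fam_cmp = (\<^bold>\<lambda>P. \<^bold>\<lambda>Q. \<^bold>\<lambda>R. \<^bold>\<lambda>s. \<^bold>\<lambda>t.
     (let m = pr1 s; \<mu> = pr2 s; n = pr1 t; \<nu> = pr2 t
      in \<langle>n \<odot> m, \<^bold>\<lambda>a. (\<nu> \<cdot> (m \<cdot> a)) \<odot> (\<mu> \<cdot> a)\<rangle>))"

definition Fam_laws :: "nat \<Rightarrow> expr" where
  "Fam_laws l = wildcat_laws (Fam_ob l) Fam_hom Fam_id Fam_cmp"

definition Fam_cat :: "nat \<Rightarrow> expr \<Rightarrow> expr" where
  "Fam_cat l laws = \<langle>Fam_ob l, \<langle>Fam_hom, \<langle>Fam_id, \<langle>Fam_cmp, laws\<rangle>\<rangle>\<rangle>\<rangle>"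

definition \<chi> :: expr where
  "\<chi> = (\<^bold>\<lambda>f. \<langle>cod f, \<^bold>\<lambda>b. fib (dom f) (cod f) (fn f) b\<rangle>)"

end

theory Submission
  imports Defs
begin

text \<open>
  The functor sends a map \<open>f\<close> to its family of fibres, and a square \<open>(u, v, \<alpha>)\<close> from \<open>f\<close> to \<open>g\<close> to
  \<open>v\<close> together with the maps \<open>fib f b \<rightarrow> fib g (v b)\<close> that take \<open>(a, p)\<close> to \<open>u a\<close> with the path
  \<open>g (u a) = v (f a) = v b\<close> composed from \<open>\<alpha>\<close> at \<open>a\<close> and \<open>p\<close>.  On objects this is the equivalence
  \<open>\<chi>\<close>: its inverse takes a family to the projection from its total space, the fibres of that
  projection are equivalent to the members of the family, the domain of a map is equivalent to the
  total space of its fibres, and univalence turns both equivalences into identifications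
  (\<open>chi_equiv\<close>).  On arrows it is an equivalence because a family of maps out of the fibres of \<open>f\<close> is
  determined by its values at the points \<open>(a, refl)\<close>, that is, by a function \<open>u\<close> and a homotopy from
  \<open>g \<circ> u\<close> to \<open>v \<circ> f\<close>, and by function extensionality such a homotopy is the same as an
  identification \<open>\<alpha>\<close> (\<open>arrow_equiv\<close>).  That identities and composites are preserved
  (\<open>id_law\<close>, \<open>comp_law\<close>), and the laws of \<open>Map\<close>, need only path induction, applied pointwise and
  followed by function extensionality in the case of the functor laws; the laws of \<open>Fam\<close> hold
  judgementally.

  All this has to be derived in a formal calculus, and the derivations are far too large to be
  written down.  They are found by computation instead.  The function \<open>nf\<close> computes, in a context, a
  beta normal form of a raw term together with its type, contracting eta redexes on the way;
  \<open>nf_sound\<close> says that whatever it returns is a derivable typing and a derivable judgemental equality.  A proof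
  term is then certified by rewriting an application of \<open>nf\<close> to its value.  A type that is known to be
  inhabited enters later computations as the type of a variable (\<open>provableI\<close>), so that proof terms of
  earlier results are never unfolded.

  The computations take place at universe level \<open>0\<close>.  Adding a constant to all levels preserves
  derivability (\<open>raise_derivable\<close>), which gives every level.  The witnesses of the category laws are
  arbitrary terms at the raised level, about which nothing can be computed.  Hence the isomorphism is
  assembled once, in a context of variables that stand for the data of two wild categories, their laws,
  a functor between them and the proofs of its properties (\<open>generic_iso\<close>); the actual terms are
  substituted for these variables only after raising (\<open>sub_ok_iso\<close>).
\<close>

section \<open>Renaming and substitution\<close>

abbreviation up_ren :: "(nat \<Rightarrow> nat) \<Rightarrow> nat \<Rightarrow> nat" where
  "up_ren r \<equiv> case_nat 0 (\<lambda>k. Suc (r k))"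

abbreviation up_sub :: "(nat \<Rightarrow> tm) \<Rightarrow> nat \<Rightarrow> tm" where
  "up_sub s \<equiv> case_nat (Var 0) (\<lambda>k. shift (s k))"

lemma up_ren_comp: "(\<lambda>k. up_ren r (up_ren s k)) = up_ren (\<lambda>k. r (s k))"
  by (auto split: nat.splits)

lemma ren_ren: "ren r (ren s t) = ren (\<lambda>k. r (s k)) t"
  by (induction t arbitrary: r s) (simp_all add: up_ren_comp)

lemma up_sub_ren_comp: "(\<lambda>k. up_sub s (up_ren r k)) = up_sub (\<lambda>k. s (r k))"
  by (auto split: nat.splits)

lemma subst_ren: "subst s (ren r t) = subst (\<lambda>k. s (r k)) t"
  by (induction t arbitrary: r s) (simp_all add: up_sub_ren_comp)

lemma up_ren_sub_comp: "(\<lambda>k. ren (up_ren r) (up_sub s k)) = up_sub (\<lambda>k. ren r (s k))"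
  by (auto simp: ren_ren split: nat.splits)

lemma ren_subst: "ren r (subst s t) = subst (\<lambda>k. ren r (s k)) t"
  by (induction t arbitrary: r s) (simp_all add: up_ren_sub_comp)

lemma up_sub_comp: "(\<lambda>k. subst (up_sub s) (up_sub r k)) = up_sub (\<lambda>k. subst s (r k))"
  by (auto simp: subst_ren ren_subst split: nat.splits)

lemma subst_subst: "subst s (subst r t) = subst (\<lambda>k. subst s (r k)) t"
  by (induction t arbitrary: r s) (simp_all add: up_sub_comp)

lemma up_sub_Var: "case_nat (Var 0) (\<lambda>k. Var (Suc k)) = Var"
  by (auto split: nat.splits)

lemma subst_Var: "subst Var t = t"
  by (induction t) (simp_all add: up_sub_Var)

lemma up_sub_Var_ren: "case_nat (Var 0) (\<lambda>k. Var (Suc (r k))) = (\<lambda>k. Var (up_ren r k))"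
  by (auto split: nat.splits)

lemma ren_eq_subst: "ren r t = subst (\<lambda>k. Var (r k)) t"
  by (induction t arbitrary: r) (simp_all add: up_sub_Var_ren)

lemma ren_id: "ren (\<lambda>k. k) t = t"
  by (simp add: ren_eq_subst subst_Var)

lemma ren_inst: "ren r (inst B a) = inst (ren (up_ren r) B) (ren r a)"
  by (simp add: ren_subst subst_ren) (rule arg_cong[of _ _ "\<lambda>s. subst s B"], auto split: nat.splits)

lemma subst_inst: "subst s (inst B a) = inst (subst (up_sub s) B) (subst s a)"
  by (simp add: subst_subst)
    (rule arg_cong[of _ _ "\<lambda>s. subst s B"], auto simp: subst_ren subst_Var split: nat.splits)

lemma inst_shift: "inst (shift t) a = t"
  by (simp add: subst_ren subst_Var)

lemma ren_shift: "ren (up_ren r) (shift t) = shift (ren r t)"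
  by (simp add: ren_ren)

lemma subst_shift: "subst (up_sub s) (shift t) = shift (subst s t)"
  by (simp add: ren_subst subst_ren)

primrec closed_at :: "nat \<Rightarrow> tm \<Rightarrow> bool" where
  "closed_at n (Var k) = (k < n)"
| "closed_at n (Univ i) = True"
| "closed_at n (Pi A B) = (closed_at n A \<and> closed_at (Suc n) B)"
| "closed_at n (Lam b) = closed_at (Suc n) b"
| "closed_at n (App f a) = (closed_at n f \<and> closed_at n a)"
| "closed_at n (Sig A B) = (closed_at n A \<and> closed_at (Suc n) B)"
| "closed_at n (MkPair a b) = (closed_at n a \<and> closed_at n b)"
| "closed_at n (Fst p) = closed_at n p"
| "closed_at n (Snd p) = closed_at n p"
| "closed_at n (Eq A a b) = (closed_at n A \<and> closed_at n a \<and> closed_at n b)"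
| "closed_at n Refl = True"
| "closed_at n (J C d p) = (closed_at n C \<and> closed_at n d \<and> closed_at n p)"
| "closed_at n (FunExt i j) = True"
| "closed_at n (UA i) = True"

lemma subst_cong_closed_at:
  "closed_at n t \<Longrightarrow> \<forall>k < n. s k = s' k \<Longrightarrow> subst s t = subst s' t"
proof (induction t arbitrary: n s s')
  case (Pi A B)
  have "\<forall>k < Suc n. up_sub s k = up_sub s' k"
    using Pi.prems by (simp split: nat.splits)
  with Pi.IH(1)[of n s s'] Pi.IH(2)[of "Suc n" "up_sub s" "up_sub s'"] Pi.prems
  show ?case by simp
next
  case (Sig A B)
  have "\<forall>k < Suc n. up_sub s k = up_sub s' k"
    using Sig.prems by (simp split: nat.splits)
  with Sig.IH(1)[of n s s'] Sig.IH(2)[of "Suc n" "up_sub s" "up_sub s'"] Sig.prems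
  show ?case by simp
next
  case (Lam b)
  have "\<forall>k < Suc n. up_sub s k = up_sub s' k"
    using Lam.prems by (simp split: nat.splits)
  with Lam.IH[of "Suc n" "up_sub s" "up_sub s'"] Lam.prems show ?case by simp
qed (simp_all only: closed_at.simps subst.simps, metis+)

lemma subst_closed: "closed_at 0 t \<Longrightarrow> subst s t = t"
  using subst_cong_closed_at[of 0 t s Var] by (simp add: subst_Var)

lemma ren_closed: "closed_at 0 t \<Longrightarrow> ren r t = t"
  by (simp add: ren_eq_subst subst_closed)

text \<open>
  Expressions are functions of the depth.  These equations evaluate an expression at a depth without
  ever exposing the abstraction over the depth, so that rewriting stays first order.
\<close>

lemma expr_at:
  "\<U> i n = Univ i"
  "pi A F n = Pi (A n) (F (\<lambda>m. Var (m - Suc n)) (Suc n))"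
  "sig A F n = Sig (A n) (F (\<lambda>m. Var (m - Suc n)) (Suc n))"
  "lam t n = Lam (t (\<lambda>m. Var (m - Suc n)) (Suc n))"
  "(f \<cdot> a) n = App (f n) (a n)"
  "\<langle>a, b\<rangle> n = MkPair (a n) (b n)"
  "pr1 p n = Fst (p n)"
  "pr2 p n = Snd (p n)"
  "eq A a b n = Eq (A n) (a n) (b n)"
  "Defs.refl n = Refl"
  "path_ind C d p n = J (C n) (d n) (p n)"
  "const_expr u n = u"
  by (simp_all only: univ_def pi_def sig_def lam_def app_def pair_def pr1_def
  pr2_def eq_def refl_def path_ind_def const_expr_def)

lemmas ht_defs = identity_def compose_def concat_def ap_def fib_def
  is_equiv_def equiv_def id_equiv_def happly_def id_to_equiv_def

lemmas closed_at_eval = closed_tm_def ht_defs expr_at diff_Suc_Suc diff_zero closed_at.simps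
  simp_thms zero_less_Suc Suc_less_eq

lemma closed_funext_type: "closed_at 0 \<lbrakk>funext_type i j\<rbrakk>"
  by (simp only: funext_type_def closed_at_eval)

lemma closed_univalence_type: "closed_at 0 \<lbrakk>univalence_type i\<rbrakk>"
  by (simp only: univalence_type_def closed_at_eval)

section \<open>Renaming and substitution preserve derivability\<close>

definition ctx_type :: "tm list \<Rightarrow> nat \<Rightarrow> tm" where
  "ctx_type \<Gamma> k = ren (\<lambda>j. j + Suc k) (\<Gamma> ! k)"

lemma ctx_type_0: "ctx_type (A # \<Gamma>) 0 = shift A"
  by (simp add: ctx_type_def)

lemma ctx_type_Suc: "ctx_type (A # \<Gamma>) (Suc k) = shift (ctx_type \<Gamma> k)"
  by (simp add: ctx_type_def ren_ren)

definition ren_ok :: "tm list \<Rightarrow> (nat \<Rightarrow> nat) \<Rightarrow> tm list \<Rightarrow> bool" where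
  "ren_ok \<Gamma> r \<Delta> \<longleftrightarrow> \<Delta> ctx \<and>
    (\<forall>k < length \<Gamma>. r k < length \<Delta> \<and> ctx_type \<Delta> (r k) = ren r (ctx_type \<Gamma> k))"

lemma ty_var': "\<Gamma> ctx \<Longrightarrow> k < length \<Gamma> \<Longrightarrow> \<Gamma> \<turnstile> Var k : ctx_type \<Gamma> k"
  unfolding ctx_type_def by (rule ty_var)

lemma ren_ok_up:
  assumes "ren_ok \<Gamma> r \<Delta>" "\<Delta> \<turnstile> ren r A : Univ i"
  shows "ren_ok (A # \<Gamma>) (up_ren r) (ren r A # \<Delta>)"
  unfolding ren_ok_def
proof (intro conjI allI impI)
  show "(ren r A # \<Delta>) ctx" using assms(2) by (rule ctx_extend)
  fix k
  assume "k < length (A # \<Gamma>)"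
  then show "up_ren r k < length (ren r A # \<Delta>)"
    and "ctx_type (ren r A # \<Delta>) (up_ren r k) = ren (up_ren r) (ctx_type (A # \<Gamma>) k)"
    using assms(1) by (cases k; simp add: ren_ok_def ctx_type_0 ctx_type_Suc ren_shift)+
qed

text \<open>
  Renamings and substitutions are handled by one induction over derivations.  The relation \<open>ok\<close> is
  closed under binders and gives variables their types; for renamings this is known outright,
  whereas for substitutions it relies on weakening, which is the result for renamings.
\<close>

lemma derivable_along:
  assumes ok_ctx: "\<And>\<Gamma> s \<Delta>. ok \<Gamma> s \<Delta> \<Longrightarrow> \<Delta> ctx"
    and ok_var: "\<And>\<Gamma> s \<Delta> k. ok \<Gamma> s \<Delta> \<Longrightarrow> k < length \<Gamma> \<Longrightarrow> \<Delta> \<turnstile> s k : subst s (ctx_type \<Gamma> k)"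
    and ok_up: "\<And>\<Gamma> s \<Delta> A i. ok \<Gamma> s \<Delta> \<Longrightarrow> \<Delta> \<turnstile> subst s A : Univ i \<Longrightarrow> ok (A # \<Gamma>) (up_sub s) (subst s A # \<Delta>)"
  shows "\<Gamma> ctx \<Longrightarrow> True"
    "\<Gamma> \<turnstile> t : A \<Longrightarrow> ok \<Gamma> s \<Delta> \<Longrightarrow> \<Delta> \<turnstile> subst s t : subst s A"
    "\<Gamma> \<turnstile> t \<equiv> u : A \<Longrightarrow> ok \<Gamma> s \<Delta> \<Longrightarrow> \<Delta> \<turnstile> subst s t \<equiv> subst s u : subst s A"
proof (induction arbitrary: and s \<Delta> and s \<Delta> rule: wf_ctx_has_type_def_eq.inducts)
  case (ty_var \<Gamma> k)
  then show ?case using ok_var by (simp add: ctx_type_def)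
next
  case (ty_J \<Gamma> a A b C i d p)
  from wf_ctx_has_type_def_eq.ty_J[OF ty_J.IH(1,2)[OF ty_J.prems] _ _ ty_J.IH(5)[OF ty_J.prems, simplified],
      of "subst s C" i "subst s d"] ty_J.IH(3,4)[OF ty_J.prems]
  show ?case by (simp add: subst_shift)
next
  case (beta_J \<Gamma> a A C i d)
  from wf_ctx_has_type_def_eq.beta_J[OF beta_J.IH(1)[OF beta_J.prems], of "subst s C" i "subst s d"]
    beta_J.IH(2,3)[OF beta_J.prems]
  show ?case by (simp add: subst_shift)
next
  case (cong_J \<Gamma> a A b C C' i d d' p p')
  from wf_ctx_has_type_def_eq.cong_J[OF cong_J.IH(1,2)[OF cong_J.prems] _ _ cong_J.IH(5)[OF cong_J.prems, simplified],
      of "subst s C" "subst s C'" i "subst s d" "subst s d'"] cong_J.IH(3,4)[OF cong_J.prems]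
  show ?case by (simp add: subst_shift)
next
  case (ty_funext \<Gamma> i j)
  then show ?case
    by (simp only: subst.simps subst_closed[OF closed_funext_type] ok_ctx wf_ctx_has_type_def_eq.ty_funext)
next
  case (ty_ua \<Gamma> i)
  then show ?case
    by (simp only: subst.simps subst_closed[OF closed_univalence_type] ok_ctx wf_ctx_has_type_def_eq.ty_ua)
next
  case (eta_fun \<Gamma> f A B)
  then have "\<Delta> \<turnstile> subst s f : Pi (subst s A) (subst (up_sub s) B)" by simp
  from wf_ctx_has_type_def_eq.eta_fun[OF this] show ?case by (simp add: subst_shift)
next
  case (ty_univ \<Gamma> i)
  then show ?case by (simp add: ok_ctx wf_ctx_has_type_def_eq.ty_univ)
next
  case (ty_conv \<Gamma> t A B i)
  show ?case
    using wf_ctx_has_type_def_eq.ty_conv[OF ty_conv.IH(1)[OF ty_conv.prems] ty_conv.IH(2)[OF ty_conv.prems, simplified]] .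
next
  case (eq_conv \<Gamma> t u A B i)
  show ?case
    using wf_ctx_has_type_def_eq.eq_conv[OF eq_conv.IH(1)[OF eq_conv.prems] eq_conv.IH(2)[OF eq_conv.prems, simplified]] .
next
  case (eq_refl \<Gamma> t A)
  show ?case using wf_ctx_has_type_def_eq.eq_refl[OF eq_refl.IH[OF eq_refl.prems]] .
next
  case (eq_sym \<Gamma> t u A)
  show ?case using wf_ctx_has_type_def_eq.eq_sym[OF eq_sym.IH[OF eq_sym.prems]] .
next
  case (eq_trans \<Gamma> t u A v)
  show ?case
    using wf_ctx_has_type_def_eq.eq_trans[OF eq_trans.IH(1)[OF eq_trans.prems] eq_trans.IH(2)[OF eq_trans.prems]] .
next
  case (ty_pi \<Gamma> A i B j)
  note IH = ty_pi.IH and ok = ty_pi.prems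
  note up = ok_up[OF ok IH(1)[OF ok, simplified]]
  show ?case
    using wf_ctx_has_type_def_eq.ty_pi[OF IH(1)[OF ok, simplified subst.simps subst_inst] IH(2)[OF up, simplified subst.simps subst_inst]]
    by (simp only: subst.simps subst_inst)
next
  case (ty_sig \<Gamma> A i B j)
  note IH = ty_sig.IH and ok = ty_sig.prems
  note up = ok_up[OF ok IH(1)[OF ok, simplified]]
  show ?case
    using wf_ctx_has_type_def_eq.ty_sig[OF IH(1)[OF ok, simplified subst.simps subst_inst] IH(2)[OF up, simplified subst.simps subst_inst]]
    by (simp only: subst.simps subst_inst)
next
  case (ty_lam \<Gamma> A i b B)
  note IH = ty_lam.IH and ok = ty_lam.prems
  note up = ok_up[OF ok IH(1)[OF ok, simplified]]
  show ?case
    using wf_ctx_has_type_def_eq.ty_lam[OF IH(1)[OF ok, simplified subst.simps subst_inst] IH(2)[OF up, simplified subst.simps subst_inst]]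
    by (simp only: subst.simps subst_inst)
next
  case (ty_pair \<Gamma> A i B j a b)
  note IH = ty_pair.IH and ok = ty_pair.prems
  note up = ok_up[OF ok IH(1)[OF ok, simplified]]
  show ?case
    using wf_ctx_has_type_def_eq.ty_pair[OF IH(1)[OF ok, simplified subst.simps subst_inst] IH(2)[OF up, simplified subst.simps subst_inst] IH(3)[OF ok, simplified subst.simps subst_inst] IH(4)[OF ok, simplified subst.simps subst_inst]]
    by (simp only: subst.simps subst_inst)
next
  case (beta_fun \<Gamma> A i b B a)
  note IH = beta_fun.IH and ok = beta_fun.prems
  note up = ok_up[OF ok IH(1)[OF ok, simplified]]
  show ?case
    using wf_ctx_has_type_def_eq.beta_fun[OF IH(1)[OF ok, simplified subst.simps subst_inst] IH(2)[OF up, simplified subst.simps subst_inst] IH(3)[OF ok, simplified subst.simps subst_inst]]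
    by (simp only: subst.simps subst_inst)
next
  case (beta_fst \<Gamma> A i B j a b)
  note IH = beta_fst.IH and ok = beta_fst.prems
  note up = ok_up[OF ok IH(1)[OF ok, simplified]]
  show ?case
    using wf_ctx_has_type_def_eq.beta_fst[OF IH(1)[OF ok, simplified subst.simps subst_inst] IH(2)[OF up, simplified subst.simps subst_inst] IH(3)[OF ok, simplified subst.simps subst_inst] IH(4)[OF ok, simplified subst.simps subst_inst]]
    by (simp only: subst.simps subst_inst)
next
  case (beta_snd \<Gamma> A i B j a b)
  note IH = beta_snd.IH and ok = beta_snd.prems
  note up = ok_up[OF ok IH(1)[OF ok, simplified]]
  show ?case
    using wf_ctx_has_type_def_eq.beta_snd[OF IH(1)[OF ok, simplified subst.simps subst_inst] IH(2)[OF up, simplified subst.simps subst_inst] IH(3)[OF ok, simplified subst.simps subst_inst] IH(4)[OF ok, simplified subst.simps subst_inst]]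
    by (simp only: subst.simps subst_inst)
next
  case (cong_pi \<Gamma> A i A' B B' j)
  note IH = cong_pi.IH and ok = cong_pi.prems
  note up = ok_up[OF ok IH(1)[OF ok, simplified]]
  show ?case
    using wf_ctx_has_type_def_eq.cong_pi[OF IH(1)[OF ok, simplified subst.simps subst_inst] IH(2)[OF ok, simplified subst.simps subst_inst] IH(3)[OF up, simplified subst.simps subst_inst]]
    by (simp only: subst.simps subst_inst)
next
  case (cong_sig \<Gamma> A i A' B B' j)
  note IH = cong_sig.IH and ok = cong_sig.prems
  note up = ok_up[OF ok IH(1)[OF ok, simplified]]
  show ?case
    using wf_ctx_has_type_def_eq.cong_sig[OF IH(1)[OF ok, simplified subst.simps subst_inst] IH(2)[OF ok, simplified subst.simps subst_inst] IH(3)[OF up, simplified subst.simps subst_inst]]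
    by (simp only: subst.simps subst_inst)
next
  case (cong_lam \<Gamma> A i b b' B)
  note IH = cong_lam.IH and ok = cong_lam.prems
  note up = ok_up[OF ok IH(1)[OF ok, simplified]]
  show ?case
    using wf_ctx_has_type_def_eq.cong_lam[OF IH(1)[OF ok, simplified subst.simps subst_inst] IH(2)[OF up, simplified subst.simps subst_inst]]
    by (simp only: subst.simps subst_inst)
next
  case (cong_pair \<Gamma> A i B j a a' b b')
  note IH = cong_pair.IH and ok = cong_pair.prems
  note up = ok_up[OF ok IH(1)[OF ok, simplified]]
  show ?case
    using wf_ctx_has_type_def_eq.cong_pair[OF IH(1)[OF ok, simplified subst.simps subst_inst] IH(2)[OF up, simplified subst.simps subst_inst] IH(3)[OF ok, simplified subst.simps subst_inst] IH(4)[OF ok, simplified subst.simps subst_inst]]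
    by (simp only: subst.simps subst_inst)
qed (simp_all only: subst.simps subst_inst TrueI,
    (rule ty_app ty_fst ty_snd ty_eq ty_refl eta_pair cong_app cong_fst cong_snd cong_eq; blast)+)

lemma ren_derivable:
  shows "\<Gamma> \<turnstile> t : A \<Longrightarrow> ren_ok \<Gamma> r \<Delta> \<Longrightarrow> \<Delta> \<turnstile> ren r t : ren r A"
    and "\<Gamma> \<turnstile> t \<equiv> u : A \<Longrightarrow> ren_ok \<Gamma> r \<Delta> \<Longrightarrow> \<Delta> \<turnstile> ren r t \<equiv> ren r u : ren r A"
proof -
  let ?ok = "\<lambda>\<Gamma> s \<Delta>. \<exists>r. s = (\<lambda>k. Var (r k)) \<and> ren_ok \<Gamma> r \<Delta>"
  have ctx: "?ok \<Gamma> s \<Delta> \<Longrightarrow> \<Delta> ctx" for \<Gamma> s \<Delta> by (auto simp: ren_ok_def)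
  have var: "?ok \<Gamma> s \<Delta> \<Longrightarrow> k < length \<Gamma> \<Longrightarrow> \<Delta> \<turnstile> s k : subst s (ctx_type \<Gamma> k)" for \<Gamma> s \<Delta> k
    using ty_var'[of \<Delta>] by (auto simp: ren_ok_def ren_eq_subst[symmetric]) metis
  have up: "?ok (A # \<Gamma>) (up_sub s) (subst s A # \<Delta>)"
    if "?ok \<Gamma> s \<Delta>" "\<Delta> \<turnstile> subst s A : Univ i" for \<Gamma> s \<Delta> A i
    using that ren_ok_up unfolding ren_eq_subst by (auto simp: up_sub_Var_ren)
  note along = derivable_along(2,3)[of ?ok, OF ctx var up]
  show "\<Gamma> \<turnstile> t : A \<Longrightarrow> ren_ok \<Gamma> r \<Delta> \<Longrightarrow> \<Delta> \<turnstile> ren r t : ren r A"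
    and "\<Gamma> \<turnstile> t \<equiv> u : A \<Longrightarrow> ren_ok \<Gamma> r \<Delta> \<Longrightarrow> \<Delta> \<turnstile> ren r t \<equiv> ren r u : ren r A"
    unfolding ren_eq_subst by (rule along; blast)+
qed

definition sub_ok :: "tm list \<Rightarrow> (nat \<Rightarrow> tm) \<Rightarrow> tm list \<Rightarrow> bool" where
  "sub_ok \<Gamma> s \<Delta> \<longleftrightarrow> \<Delta> ctx \<and> (\<forall>k < length \<Gamma>. \<Delta> \<turnstile> s k : subst s (ctx_type \<Gamma> k))"

lemma shift_derivable:
  assumes "\<Delta> \<turnstile> A : Univ i"
  shows "\<Delta> \<turnstile> t : B \<Longrightarrow> A # \<Delta> \<turnstile> shift t : shift B"
    and "\<Delta> \<turnstile> t \<equiv> u : B \<Longrightarrow> A # \<Delta> \<turnstile> shift t \<equiv> shift u : shift B"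
proof -
  have "ren_ok \<Delta> Suc (A # \<Delta>)"
    using assms by (auto simp: ren_ok_def ctx_type_Suc intro: ctx_extend)
  then show "\<Delta> \<turnstile> t : B \<Longrightarrow> A # \<Delta> \<turnstile> shift t : shift B"
    and "\<Delta> \<turnstile> t \<equiv> u : B \<Longrightarrow> A # \<Delta> \<turnstile> shift t \<equiv> shift u : shift B"
    using ren_derivable by blast+
qed

lemma sub_ok_up:
  assumes "sub_ok \<Gamma> s \<Delta>" "\<Delta> \<turnstile> subst s A : Univ i"
  shows "sub_ok (A # \<Gamma>) (up_sub s) (subst s A # \<Delta>)"
  unfolding sub_ok_def
proof (intro conjI allI impI)
  show ctx: "(subst s A # \<Delta>) ctx"
    using assms by (auto intro: ctx_extend)
  fix k
  assume "k < length (A # \<Gamma>)"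
  then show "subst s A # \<Delta> \<turnstile> up_sub s k : subst (up_sub s) (ctx_type (A # \<Gamma>) k)"
    using assms shift_derivable(1)[OF assms(2)] ty_var'[OF ctx, of 0]
    by (cases k) (auto simp: ctx_type_0 ctx_type_Suc subst_shift sub_ok_def)
qed

lemma sub_okD:
  "sub_ok \<Gamma> s \<Delta> \<Longrightarrow> \<Delta> ctx"
  "sub_ok \<Gamma> s \<Delta> \<Longrightarrow> k < length \<Gamma> \<Longrightarrow> \<Delta> \<turnstile> s k : subst s (ctx_type \<Gamma> k)"
  by (simp_all add: sub_ok_def)

lemma subst_derivable:
  shows "\<Gamma> \<turnstile> t : A \<Longrightarrow> sub_ok \<Gamma> s \<Delta> \<Longrightarrow> \<Delta> \<turnstile> subst s t : subst s A"
    and "\<Gamma> \<turnstile> t \<equiv> u : A \<Longrightarrow> sub_ok \<Gamma> s \<Delta> \<Longrightarrow> \<Delta> \<turnstile> subst s t \<equiv> subst s u : subst s A"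
  by (rule derivable_along(2,3)[where ok = sub_ok]; blast intro: sub_ok_up dest: sub_okD)+

section \<open>Presuppositions\<close>

lemma ctx_tailD: "(A # \<Gamma>) ctx \<Longrightarrow> \<exists>i. \<Gamma> \<turnstile> A : Univ i"
  by (erule wf_ctx.cases) auto

lemma ctx_of_derivable:
  "\<Gamma> ctx \<Longrightarrow> True"
  "\<Gamma> \<turnstile> t : A \<Longrightarrow> \<Gamma> ctx"
  "\<Gamma> \<turnstile> t \<equiv> u : A \<Longrightarrow> \<Gamma> ctx"
  by (induction rule: wf_ctx_has_type_def_eq.inducts) auto

lemma sub_ok_inst:
  assumes "\<Gamma> \<turnstile> a : A"
  shows "sub_ok (A # \<Gamma>) (case_nat a Var) \<Gamma>"
  unfolding sub_ok_def
proof (intro conjI allI impI)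
  show ctx: "\<Gamma> ctx" using assms ctx_of_derivable by blast
  fix k
  assume "k < length (A # \<Gamma>)"
  then show "\<Gamma> \<turnstile> case_nat a Var k : subst (case_nat a Var) (ctx_type (A # \<Gamma>) k)"
    using assms ty_var'[OF ctx] by (cases k) (auto simp: ctx_type_0 ctx_type_Suc inst_shift)
qed

lemma inst_derivable:
  assumes "\<Gamma> \<turnstile> a : A"
  shows "A # \<Gamma> \<turnstile> b : B \<Longrightarrow> \<Gamma> \<turnstile> inst b a : inst B a"
    and "A # \<Gamma> \<turnstile> b \<equiv> b' : B \<Longrightarrow> \<Gamma> \<turnstile> inst b a \<equiv> inst b' a : inst B a"
  using subst_derivable sub_ok_inst[OF assms] by blast+

text \<open>
  Normalising the domain of a binder changes the type of a variable in the context.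
\<close>

lemma conv_head_ctx:
  assumes "\<Gamma> \<turnstile> A' \<equiv> A : Univ i" "\<Gamma> \<turnstile> A' : Univ i"
  shows "A # \<Gamma> \<turnstile> b : B \<Longrightarrow> A' # \<Gamma> \<turnstile> b : B"
    and "A # \<Gamma> \<turnstile> b \<equiv> b' : B \<Longrightarrow> A' # \<Gamma> \<turnstile> b \<equiv> b' : B"
proof -
  have ctx: "(A' # \<Gamma>) ctx" using assms(2) by (rule ctx_extend)
  have "A' # \<Gamma> \<turnstile> Var 0 : shift A'"
    using ty_var'[OF ctx, of 0] by (simp add: ctx_type_0)
  moreover have "A' # \<Gamma> \<turnstile> shift A' \<equiv> shift A : Univ i"
    using shift_derivable(2)[OF assms(2,1)] by simp
  ultimately have v: "A' # \<Gamma> \<turnstile> Var 0 : shift A" by (rule ty_conv)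
  have "sub_ok (A # \<Gamma>) Var (A' # \<Gamma>)"
    unfolding sub_ok_def
  proof (intro conjI allI impI ctx)
    fix k assume "k < length (A # \<Gamma>)"
    then show "A' # \<Gamma> \<turnstile> Var k : subst Var (ctx_type (A # \<Gamma>) k)"
      using v ty_var'[OF ctx, of k] by (cases k) (auto simp: subst_Var ctx_type_0 ctx_type_Suc)
  qed
  from subst_derivable[OF _ this]
  show "A # \<Gamma> \<turnstile> b : B \<Longrightarrow> A' # \<Gamma> \<turnstile> b : B"
    and "A # \<Gamma> \<turnstile> b \<equiv> b' : B \<Longrightarrow> A' # \<Gamma> \<turnstile> b \<equiv> b' : B"
    by (simp_all add: subst_Var)
qed

text \<open>
  A type former is typed by its formation rule, possibly followed by conversions of the universe it
  is placed in, so its components are found by induction on the derivation.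
\<close>

lemma Pi_formation_inv:
  "\<Gamma> ctx \<Longrightarrow> True"
  "\<Gamma> \<turnstile> t : T \<Longrightarrow> t = Pi A B \<Longrightarrow> \<exists>i j. \<Gamma> \<turnstile> A : Univ i \<and> A # \<Gamma> \<turnstile> B : Univ j"
  "\<Gamma> \<turnstile> t \<equiv> u : T \<Longrightarrow> True"
  by (induction rule: wf_ctx_has_type_def_eq.inducts) auto

lemma Sig_formation_inv:
  "\<Gamma> ctx \<Longrightarrow> True"
  "\<Gamma> \<turnstile> t : T \<Longrightarrow> t = Sig A B \<Longrightarrow> \<exists>i j. \<Gamma> \<turnstile> A : Univ i \<and> A # \<Gamma> \<turnstile> B : Univ j"
  "\<Gamma> \<turnstile> t \<equiv> u : T \<Longrightarrow> True"
  by (induction rule: wf_ctx_has_type_def_eq.inducts) auto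

lemma Eq_formation_inv:
  "\<Gamma> ctx \<Longrightarrow> True"
  "\<Gamma> \<turnstile> t : T \<Longrightarrow> t = Eq A a b \<Longrightarrow> (\<exists>i. \<Gamma> \<turnstile> A : Univ i) \<and> \<Gamma> \<turnstile> a : A \<and> \<Gamma> \<turnstile> b : A"
  "\<Gamma> \<turnstile> t \<equiv> u : T \<Longrightarrow> True"
  by (induction rule: wf_ctx_has_type_def_eq.inducts) auto

text \<open>
  A type family respects judgemental equality: apply the family, seen as a function into a universe,
  to equal arguments.
\<close>

lemma inst_type_cong:
  assumes "\<Gamma> \<turnstile> A : Univ i" "A # \<Gamma> \<turnstile> B : Univ j" "\<Gamma> \<turnstile> a \<equiv> a' : A" "\<Gamma> \<turnstile> a : A" "\<Gamma> \<turnstile> a' : A"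
  shows "\<Gamma> \<turnstile> inst B a \<equiv> inst B a' : Univ j"
proof -
  have lam: "\<Gamma> \<turnstile> Lam B : Pi A (Univ j)"
    using assms by (auto intro: ty_lam)
  have *: "\<Gamma> \<turnstile> App (Lam B) x \<equiv> inst B x : Univ j" if "\<Gamma> \<turnstile> x : A" for x
    using beta_fun[OF assms(1,2) that] by simp
  have "\<Gamma> \<turnstile> App (Lam B) a \<equiv> App (Lam B) a' : Univ j"
    using cong_app[OF eq_refl[OF lam] assms(3)] by simp
  then show ?thesis
    using *[OF assms(4)] *[OF assms(5)] by (meson eq_sym eq_trans)
qed

lemma ctx_type_derivable:
  "\<Gamma> ctx \<Longrightarrow> k < length \<Gamma> \<Longrightarrow> \<exists>i. \<Gamma> \<turnstile> ctx_type \<Gamma> k : Univ i"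
proof (induction \<Gamma> arbitrary: k)
  case (Cons A \<Gamma>)
  from ctx_tailD[OF Cons.prems(1)] obtain i where A: "\<Gamma> \<turnstile> A : Univ i" by blast
  show ?case
  proof (cases k)
    case 0
    then show ?thesis using shift_derivable(1)[OF A A] by (auto simp: ctx_type_0)
  next
    case (Suc m)
    then obtain j where "\<Gamma> \<turnstile> ctx_type \<Gamma> m : Univ j"
      using Cons A ctx_of_derivable by fastforce
    then show ?thesis using shift_derivable(1)[OF A] Suc by (fastforce simp: ctx_type_Suc)
  qed
qed simp

lemma J_type_eq:
  assumes C: "\<Gamma> \<turnstile> C \<equiv> C' : Pi A (Pi (Eq (shift A) (shift a) (Var 0)) (Univ i))"
    and b: "\<Gamma> \<turnstile> b : A" and p: "\<Gamma> \<turnstile> p \<equiv> p' : Eq A a b"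
  shows "\<Gamma> \<turnstile> App (App C b) p \<equiv> App (App C' b) p' : Univ i"
proof -
  have "\<Gamma> \<turnstile> App C b \<equiv> App C' b : Pi (Eq A a b) (Univ i)"
    using cong_app[OF C eq_refl[OF b]] by (simp add: inst_shift)
  from cong_app[OF this p] show ?thesis by simp
qed

lemma J_type:
  assumes C: "\<Gamma> \<turnstile> C : Pi A (Pi (Eq (shift A) (shift a) (Var 0)) (Univ i))"
    and b: "\<Gamma> \<turnstile> b : A" and p: "\<Gamma> \<turnstile> p : Eq A a b"
  shows "\<Gamma> \<turnstile> App (App C b) p : Univ i"
proof -
  have "\<Gamma> \<turnstile> App C b : Pi (Eq A a b) (Univ i)"
    using ty_app[OF C b] by (simp add: inst_shift)
  from ty_app[OF this p] show ?thesis by simp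
qed

section \<open>A typed normaliser\<close>

text \<open>
  Shifting, instantiation and strengthening are repeated here by structural recursion on unary
  indices, with a cutoff \<open>c\<close> in place of functions on variables.  Rewriting with these equations
  meets constructors only and never has to evaluate under an abstraction.
\<close>

fun lift_var :: "nat \<Rightarrow> nat \<Rightarrow> nat \<Rightarrow> nat" where
  "lift_var 0 d k = d + k"
| "lift_var (Suc c) d 0 = 0"
| "lift_var (Suc c) d (Suc k) = Suc (lift_var c d k)"

primrec lift_at :: "nat \<Rightarrow> nat \<Rightarrow> tm \<Rightarrow> tm" where
  "lift_at d c (Var k) = Var (lift_var c d k)"
| "lift_at d c (Univ i) = Univ i"
| "lift_at d c (Pi A B) = Pi (lift_at d c A) (lift_at d (Suc c) B)"
| "lift_at d c (Lam b) = Lam (lift_at d (Suc c) b)"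
| "lift_at d c (App f a) = App (lift_at d c f) (lift_at d c a)"
| "lift_at d c (Sig A B) = Sig (lift_at d c A) (lift_at d (Suc c) B)"
| "lift_at d c (MkPair a b) = MkPair (lift_at d c a) (lift_at d c b)"
| "lift_at d c (Fst p) = Fst (lift_at d c p)"
| "lift_at d c (Snd p) = Snd (lift_at d c p)"
| "lift_at d c (Eq A a b) = Eq (lift_at d c A) (lift_at d c a) (lift_at d c b)"
| "lift_at d c Refl = Refl"
| "lift_at d c (J C e p) = J (lift_at d c C) (lift_at d c e) (lift_at d c p)"
| "lift_at d c (FunExt i j) = FunExt i j"
| "lift_at d c (UA i) = UA i"

fun lift :: "nat \<Rightarrow> tm \<Rightarrow> tm" where
  "lift 0 t = t"
| "lift (Suc d) t = lift_at (Suc d) 0 t"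

text \<open>
  The inverse of a shift by one; undefined when the variable that would disappear occurs.
\<close>

fun lower_var :: "nat \<Rightarrow> nat \<Rightarrow> nat option" where
  "lower_var 0 0 = None"
| "lower_var 0 (Suc k) = Some k"
| "lower_var (Suc c) 0 = Some 0"
| "lower_var (Suc c) (Suc k) = map_option Suc (lower_var c k)"

fun lower2 :: "(tm \<Rightarrow> tm \<Rightarrow> tm) \<Rightarrow> tm option \<Rightarrow> tm option \<Rightarrow> tm option" where
  "lower2 f None y = None"
| "lower2 f (Some x) None = None"
| "lower2 f (Some x) (Some y) = Some (f x y)"

fun lower3 :: "(tm \<Rightarrow> tm \<Rightarrow> tm \<Rightarrow> tm) \<Rightarrow> tm option \<Rightarrow> tm option \<Rightarrow> tm option \<Rightarrow> tm option" where
  "lower3 f None y z = None"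
| "lower3 f (Some x) y z = lower2 (f x) y z"

primrec lower :: "nat \<Rightarrow> tm \<Rightarrow> tm option" where
  "lower c (Var k) = map_option Var (lower_var c k)"
| "lower c (Univ i) = Some (Univ i)"
| "lower c (Pi A B) = lower2 Pi (lower c A) (lower (Suc c) B)"
| "lower c (Lam b) = map_option Lam (lower (Suc c) b)"
| "lower c (App f a) = lower2 App (lower c f) (lower c a)"
| "lower c (Sig A B) = lower2 Sig (lower c A) (lower (Suc c) B)"
| "lower c (MkPair a b) = lower2 MkPair (lower c a) (lower c b)"
| "lower c (Fst p) = map_option Fst (lower c p)"
| "lower c (Snd p) = map_option Snd (lower c p)"
| "lower c (Eq A a b) = lower3 Eq (lower c A) (lower c a) (lower c b)"
| "lower c Refl = Some Refl"
| "lower c (J C e p) = lower3 J (lower c C) (lower c e) (lower c p)"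
| "lower c (FunExt i j) = Some (FunExt i j)"
| "lower c (UA i) = Some (UA i)"

type_synonym result = "(tm \<times> tm) option"
type_synonym entry = "nat \<times> tm \<times> tm"
type_synonym evaluator = "tm list \<Rightarrow> nat \<Rightarrow> entry list \<Rightarrow> nat \<Rightarrow> tm option \<Rightarrow> tm \<Rightarrow> result"
type_synonym 'a in_ctx = "evaluator \<Rightarrow> tm list \<Rightarrow> nat \<Rightarrow> 'a"
type_synonym 'a in_env = "(entry list \<Rightarrow> nat \<Rightarrow> 'a) in_ctx"

text \<open>
  The argument \<open>m\<close> is the type against which a term is checked, or absent if the type is to be
  inferred.  A computed type has to coincide with the expected one syntactically; since types are
  kept in normal form, this is how conversion is decided.
\<close>

definition expect :: "tm option \<Rightarrow> tm \<Rightarrow> tm \<Rightarrow> result" where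
  "expect m v T = (case m of None \<Rightarrow> Some (v, T) | Some T' \<Rightarrow> if T' = T then Some (v, T) else None)"

lemma expect_eval: "expect None v T = Some (v, T)" "expect (Some T) v T = Some (v, T)"
  by (simp_all add: expect_def)

definition expect_res :: "tm option \<Rightarrow> result \<Rightarrow> result" where
  "expect_res m x = (case x of Some (v, T) \<Rightarrow> expect m v T | None \<Rightarrow> None)"

lemma expect_res_eval: "expect_res m (Some (v, T)) = expect m v T"
  by (simp add: expect_res_def)

fun ctx_lookup :: "tm list \<Rightarrow> nat \<Rightarrow> tm option" where
  "ctx_lookup [] j = None"
| "ctx_lookup (A # \<Gamma>) 0 = Some A"
| "ctx_lookup (A # \<Gamma>) (Suc j) = ctx_lookup \<Gamma> j"

fun expect_var :: "nat \<Rightarrow> tm option \<Rightarrow> tm option \<Rightarrow> result" where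
  "expect_var j m None = None"
| "expect_var j m (Some A) = expect m (Var j) (lift (Suc j) A)"

text \<open>
  A term is evaluated in a context \<open>\<Gamma>\<close> of length \<open>n\<close>, under an environment \<open>es\<close> for its innermost
  variables; the others refer to the outermost \<open>d\<close> entries of the context.  An environment entry
  carries the depth at which its value was computed, and is shifted to the current depth when it
  is looked up.
\<close>

fun eval_var :: "tm list \<Rightarrow> nat \<Rightarrow> entry list \<Rightarrow> nat \<Rightarrow> tm option \<Rightarrow> nat \<Rightarrow> result" where
  "eval_var \<Gamma> n [] d m k = expect_var ((n - d) + k) m (ctx_lookup \<Gamma> ((n - d) + k))"
| "eval_var \<Gamma> n ((e, v, T) # es) d m 0 = expect m (lift (n - e) v) (lift (n - e) T)"
| "eval_var \<Gamma> n (x # es) d m (Suc k) = eval_var \<Gamma> n es d m k"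

definition type_of_res :: "result \<Rightarrow> tm option" where
  "type_of_res x = (case x of Some (T, Univ i) \<Rightarrow> Some T | _ \<Rightarrow> None)"

lemma type_of_res_eval: "type_of_res (Some (T, Univ i)) = Some T"
  by (simp add: type_of_res_def)

fun inst_var :: "nat \<Rightarrow> tm \<Rightarrow> nat option \<Rightarrow> tm" where
  "inst_var c a None = lift c a"
| "inst_var c a (Some j) = Var j"

primrec inst_at :: "nat \<Rightarrow> tm \<Rightarrow> tm \<Rightarrow> tm" where
  "inst_at c u (Var k) = inst_var c u (lower_var c k)"
| "inst_at c u (Univ i) = Univ i"
| "inst_at c u (Pi A B) = Pi (inst_at c u A) (inst_at (Suc c) u B)"
| "inst_at c u (Lam b) = Lam (inst_at (Suc c) u b)"
| "inst_at c u (App f a) = App (inst_at c u f) (inst_at c u a)"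
| "inst_at c u (Sig A B) = Sig (inst_at c u A) (inst_at (Suc c) u B)"
| "inst_at c u (MkPair a b) = MkPair (inst_at c u a) (inst_at c u b)"
| "inst_at c u (Fst p) = Fst (inst_at c u p)"
| "inst_at c u (Snd p) = Snd (inst_at c u p)"
| "inst_at c u (Eq A a b) = Eq (inst_at c u A) (inst_at c u a) (inst_at c u b)"
| "inst_at c u Refl = Refl"
| "inst_at c u (J C e p) = J (inst_at c u C) (inst_at c u e) (inst_at c u p)"
| "inst_at c u (FunExt i j) = FunExt i j"
| "inst_at c u (UA i) = UA i"

text \<open>
  Terms to which the shape condition on values (\<open>value_shape\<close> below) does not apply.
\<close>

fun plain :: "tm \<Rightarrow> bool" where
  "plain (Lam b) = False"
| "plain (MkPair a b) = False"
| "plain Refl = False"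
| "plain t = True"

text \<open>
  Putting a rigid term in the place of a variable creates no redex, neither by computation nor by
  surjective pairing.
\<close>

fun rigid :: "tm \<Rightarrow> bool" where
  "rigid (Lam b) = False"
| "rigid (MkPair a b) = False"
| "rigid (Fst p) = False"
| "rigid (Snd p) = False"
| "rigid Refl = False"
| "rigid t = True"

fun pair_free :: "tm \<Rightarrow> bool" where
  "pair_free (Pi A B) = (pair_free A \<and> pair_free B)"
| "pair_free (Lam b) = pair_free b"
| "pair_free (App f a) = (pair_free f \<and> pair_free a)"
| "pair_free (Sig A B) = (pair_free A \<and> pair_free B)"
| "pair_free (MkPair a b) = False"
| "pair_free (Fst p) = pair_free p"
| "pair_free (Snd p) = pair_free p"
| "pair_free (Eq A a b) = (pair_free A \<and> pair_free a \<and> pair_free b)"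
| "pair_free (J C e p) = (pair_free C \<and> pair_free e \<and> pair_free p)"
| "pair_free t = True"

text \<open>
  Instantiation of a normal type can be done by plain substitution if no redex can arise; otherwise
  the type is evaluated again.  The distinction matters for speed only: both results are
  convertible to the instance.
\<close>

definition direct :: "tm \<Rightarrow> tm \<Rightarrow> bool" where
  "direct a B \<longleftrightarrow> rigid a \<or> plain a \<and> pair_free B"

fun inst_type1 :: "bool \<Rightarrow> (tm \<Rightarrow> tm \<Rightarrow> tm \<Rightarrow> tm option) in_ctx" where
  "inst_type1 True r \<Gamma> n a A B = Some (inst_at 0 a B)"
| "inst_type1 False r \<Gamma> n a A B = type_of_res (r \<Gamma> n [(n, a, A)] n None B)"

definition inst_type :: "(tm \<Rightarrow> tm \<Rightarrow> tm \<Rightarrow> tm option) in_ctx" where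
  "inst_type r \<Gamma> n a A B = inst_type1 (direct a B) r \<Gamma> n a A B"

fun inst2_type1 :: "bool \<Rightarrow> (tm \<Rightarrow> tm \<Rightarrow> tm \<Rightarrow> tm \<Rightarrow> tm \<Rightarrow> tm option) in_ctx" where
  "inst2_type1 True r \<Gamma> n b A p P c = Some (inst_at 0 p (inst_at (Suc 0) b c))"
| "inst2_type1 False r \<Gamma> n b A p P c = type_of_res (r \<Gamma> n [(n, p, P), (n, b, A)] n None c)"

definition inst2_type :: "(tm \<Rightarrow> tm \<Rightarrow> tm \<Rightarrow> tm \<Rightarrow> tm \<Rightarrow> tm option) in_ctx" where
  "inst2_type r \<Gamma> n b A p P c = inst2_type1 (direct b c \<and> direct p c) r \<Gamma> n b A p P c"

subsection \<open>Formation of function and pair types\<close>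

text \<open>
  The evaluator is split into many small functions, each of which inspects one intermediate result
  and has an equation for the successful outcome.  Rewriting therefore computes the argument first
  and never unfolds a case distinction whose scrutinee is not yet known.
\<close>

definition former2 :: "(tm \<Rightarrow> tm \<Rightarrow> tm) \<Rightarrow> tm option \<Rightarrow> tm \<Rightarrow> nat \<Rightarrow> result \<Rightarrow> result" where
  "former2 F m A i x = (case x of Some (B, Univ j) \<Rightarrow> expect m (F A B) (Univ (max i j)) | _ \<Rightarrow> None)"

lemma former2_eval: "former2 F m A i (Some (B, Univ j)) = expect m (F A B) (Univ (max i j))"
  by (simp add: former2_def)

definition former1 :: "(tm \<Rightarrow> tm \<Rightarrow> tm) \<Rightarrow> (entry list \<Rightarrow> nat \<Rightarrow> tm option \<Rightarrow> tm \<Rightarrow> result \<Rightarrow> result) in_ctx" where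
  "former1 F r \<Gamma> n es d m B x = (case x of Some (A, Univ i) \<Rightarrow>
     former2 F m A i (r (A # \<Gamma>) (Suc n) ((Suc n, Var 0, lift (Suc 0) A) # es) d None B) | _ \<Rightarrow> None)"

lemma former1_eval: "former1 F r \<Gamma> n es d m B (Some (A, Univ i)) =
     former2 F m A i (r (A # \<Gamma>) (Suc n) ((Suc n, Var 0, lift (Suc 0) A) # es) d None B)"
  by (simp add: former1_def)

subsection \<open>Abstraction\<close>

fun is_Var0 :: "tm \<Rightarrow> bool" where
  "is_Var0 (Var 0) = True"
| "is_Var0 t = False"

fun lower_if :: "bool \<Rightarrow> tm \<Rightarrow> tm option" where
  "lower_if True f = lower 0 f"
| "lower_if False f = None"

fun eta_contractum :: "tm \<Rightarrow> tm option" where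
  "eta_contractum (App f a) = lower_if (is_Var0 a) f"
| "eta_contractum t = None"

fun pick_fn :: "bool \<Rightarrow> tm \<Rightarrow> tm option \<Rightarrow> tm option" where
  "pick_fn True f x = lower 0 f"
| "pick_fn False f x = x"

text \<open>
  A guess for the domain of an abstraction whose type is not given: for a composite
  \<open>\<lambda>x. g (f x)\<close> it is the domain of \<open>f\<close>.
\<close>

fun innermost_fn :: "tm \<Rightarrow> tm option" where
  "innermost_fn (App f a) = pick_fn (is_Var0 a) f (innermost_fn a)"
| "innermost_fn t = None"

definition at_type :: "tm \<Rightarrow> result \<Rightarrow> result" where
  "at_type T x = (case x of Some (v, T') \<Rightarrow> if T' = T then Some (v, T) else None | None \<Rightarrow> None)"

lemma at_type_eval: "at_type T (Some (v, T)) = Some (v, T)"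
  by (simp add: at_type_def)

fun eta_lam :: "(tm \<Rightarrow> tm \<Rightarrow> tm option \<Rightarrow> result) in_ctx" where
  "eta_lam r \<Gamma> n b T None = Some (Lam b, T)"
| "eta_lam r \<Gamma> n b T (Some f) = at_type T (r \<Gamma> n [] n None f)"

definition lam2 :: "(tm \<Rightarrow> result \<Rightarrow> result) in_ctx" where
  "lam2 r \<Gamma> n A x = (case x of Some (b, B) \<Rightarrow> eta_lam r \<Gamma> n b (Pi A B) (eta_contractum b) | None \<Rightarrow> None)"

lemma lam2_eval: "lam2 r \<Gamma> n A (Some (b, B)) = eta_lam r \<Gamma> n b (Pi A B) (eta_contractum b)"
  by (simp add: lam2_def)

definition lam1 :: "(tm option \<Rightarrow> tm \<Rightarrow> tm \<Rightarrow> result) in_env" where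
  "lam1 r \<Gamma> n es d m b A =
     lam2 r \<Gamma> n A (r (A # \<Gamma>) (Suc n) ((Suc n, Var 0, lift (Suc 0) A) # es) d m b)"

definition lam_guess2 :: "(tm \<Rightarrow> result \<Rightarrow> result) in_env" where
  "lam_guess2 r \<Gamma> n es d b x = (case x of Some (f, Pi A B) \<Rightarrow> lam1 r \<Gamma> n es d None b A | _ \<Rightarrow> None)"

lemma lam_guess2_eval: "lam_guess2 r \<Gamma> n es d b (Some (f, Pi A B)) = lam1 r \<Gamma> n es d None b A"
  by (simp add: lam_guess2_def)

fun lam_guess1 :: "(tm \<Rightarrow> tm option \<Rightarrow> result) in_env" where
  "lam_guess1 r \<Gamma> n es d b None = None"
| "lam_guess1 r \<Gamma> n es d b (Some f) = lam_guess2 r \<Gamma> n es d b (r \<Gamma> n es d None f)"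

definition lam0 :: "(tm option \<Rightarrow> tm \<Rightarrow> result) in_env" where
  "lam0 r \<Gamma> n es d m b = (case m of
     None \<Rightarrow> lam_guess1 r \<Gamma> n es d b (innermost_fn b)
   | Some (Pi A B) \<Rightarrow> lam1 r \<Gamma> n es d (Some B) b A
   | _ \<Rightarrow> None)"

lemma lam0_eval:
  "lam0 r \<Gamma> n es d None b = lam_guess1 r \<Gamma> n es d b (innermost_fn b)"
  "lam0 r \<Gamma> n es d (Some (Pi A B)) b = lam1 r \<Gamma> n es d (Some B) b A"
  by (simp_all add: lam0_def)

subsection \<open>Application\<close>

text \<open>
  A beta redex is not contracted by substitution.  The body is evaluated again, at the type that the
  application has, in an environment that binds the argument.  Every intermediate term is thus
  typed afresh.
\<close>

fun app_val :: "(tm \<Rightarrow> tm \<Rightarrow> tm \<Rightarrow> tm option \<Rightarrow> tm \<Rightarrow> result) in_ctx" where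
  "app_val r \<Gamma> n a A T m (Lam b) = expect_res m (r \<Gamma> n [(n, a, A)] n (Some T) b)"
| "app_val r \<Gamma> n a A T m f = expect m (App f a) T"

definition app3 :: "(tm \<Rightarrow> tm \<Rightarrow> tm \<Rightarrow> tm option \<Rightarrow> tm option \<Rightarrow> result) in_ctx" where
  "app3 r \<Gamma> n f a A m x = (case x of Some T \<Rightarrow> app_val r \<Gamma> n a A T m f | None \<Rightarrow> None)"

lemma app3_eval: "app3 r \<Gamma> n f a A m (Some T) = app_val r \<Gamma> n a A T m f"
  by (simp add: app3_def)

definition app2 :: "(tm \<Rightarrow> tm \<Rightarrow> tm option \<Rightarrow> result \<Rightarrow> result) in_ctx" where
  "app2 r \<Gamma> n f B m x = (case x of Some (a, A) \<Rightarrow> app3 r \<Gamma> n f a A m (inst_type r \<Gamma> n a A B) | None \<Rightarrow> None)"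

lemma app2_eval: "app2 r \<Gamma> n f B m (Some (a, A)) = app3 r \<Gamma> n f a A m (inst_type r \<Gamma> n a A B)"
  by (simp add: app2_def)

definition app1 :: "(tm option \<Rightarrow> tm \<Rightarrow> result \<Rightarrow> result) in_env" where
  "app1 r \<Gamma> n es d m a x = (case x of Some (f, Pi A B) \<Rightarrow> app2 r \<Gamma> n f B m (r \<Gamma> n es d (Some A) a) | _ \<Rightarrow> None)"

lemma app1_eval: "app1 r \<Gamma> n es d m a (Some (f, Pi A B)) = app2 r \<Gamma> n f B m (r \<Gamma> n es d (Some A) a)"
  by (simp add: app1_def)

fun lam_head :: "tm \<Rightarrow> bool" where
  "lam_head (Lam b) = True"
| "lam_head (App f a) = lam_head f"
| "lam_head t = False"

definition redex2 :: "(tm \<Rightarrow> tm \<Rightarrow> tm \<Rightarrow> result \<Rightarrow> result) in_ctx" where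
  "redex2 r \<Gamma> n a A T x = (case x of Some (f, F) \<Rightarrow> app_val r \<Gamma> n a A T (Some T) f | None \<Rightarrow> None)"

lemma redex2_eval: "redex2 r \<Gamma> n a A T (Some (f, F)) = app_val r \<Gamma> n a A T (Some T) f"
  by (simp add: redex2_def)

text \<open>
  If the head of the function is an abstraction, its domain is taken from the inferred type of the argument, and
  the expected type of the application serves as a constant codomain.
\<close>

definition redex1 :: "(tm option \<Rightarrow> tm \<Rightarrow> result \<Rightarrow> result) in_env" where
  "redex1 r \<Gamma> n es d m f x = (case m of None \<Rightarrow> None | Some T \<Rightarrow> (case x of None \<Rightarrow> None | Some (a, A) \<Rightarrow>
     redex2 r \<Gamma> n a A T (r \<Gamma> n es d (Some (Pi A (lift (Suc 0) T))) f)))"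

lemma redex1_eval: "redex1 r \<Gamma> n es d (Some T) f (Some (a, A)) =
     redex2 r \<Gamma> n a A T (r \<Gamma> n es d (Some (Pi A (lift (Suc 0) T))) f)"
  by (simp add: redex1_def)

definition redex_infer2 :: "(tm \<Rightarrow> result \<Rightarrow> result) in_ctx" where
  "redex_infer2 r \<Gamma> n a x = (case x of Some (f, Pi A B) \<Rightarrow> app3 r \<Gamma> n f a A None (inst_type r \<Gamma> n a A B) | _ \<Rightarrow> None)"

lemma redex_infer2_eval: "redex_infer2 r \<Gamma> n a (Some (f, Pi A B)) = app3 r \<Gamma> n f a A None (inst_type r \<Gamma> n a A B)"
  by (simp add: redex_infer2_def)

definition redex_infer1 :: "(tm \<Rightarrow> result \<Rightarrow> result) in_env" where
  "redex_infer1 r \<Gamma> n es d f x = (case x of None \<Rightarrow> None | Some (a, A) \<Rightarrow>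
     (case f of Lam b \<Rightarrow> redex_infer2 r \<Gamma> n a (lam1 r \<Gamma> n es d None b A) | _ \<Rightarrow> None))"

lemma redex_infer1_eval: "redex_infer1 r \<Gamma> n es d (Lam b) (Some (a, A)) =
     redex_infer2 r \<Gamma> n a (lam1 r \<Gamma> n es d None b A)"
  by (simp add: redex_infer1_def)

fun redex0 :: "(tm option \<Rightarrow> tm \<Rightarrow> result \<Rightarrow> result) in_env" where
  "redex0 r \<Gamma> n es d None f x = redex_infer1 r \<Gamma> n es d f x"
| "redex0 r \<Gamma> n es d (Some T) f x = redex1 r \<Gamma> n es d (Some T) f x"

fun app0 :: "bool \<Rightarrow> (tm option \<Rightarrow> tm \<Rightarrow> tm \<Rightarrow> result) in_env" where
  "app0 False r \<Gamma> n es d m f a = app1 r \<Gamma> n es d m a (r \<Gamma> n es d None f)"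
| "app0 True r \<Gamma> n es d m f a = redex0 r \<Gamma> n es d m f (r \<Gamma> n es d None a)"

subsection \<open>Pairs and projections\<close>

fun Fst_arg :: "tm \<Rightarrow> tm option" where
  "Fst_arg (Fst p) = Some p"
| "Fst_arg t = None"

fun is_Snd_of :: "tm \<Rightarrow> tm \<Rightarrow> bool" where
  "is_Snd_of q (Snd p) = (q = p)"
| "is_Snd_of q t = False"

fun contract_pair_if :: "bool \<Rightarrow> (tm \<Rightarrow> tm \<Rightarrow> tm \<Rightarrow> tm \<Rightarrow> result) in_ctx" where
  "contract_pair_if True r \<Gamma> n a b T p = at_type T (r \<Gamma> n [] n None p)"
| "contract_pair_if False r \<Gamma> n a b T p = Some (MkPair a b, T)"

text \<open>
  Surjective pairing is used from right to left: \<open>(Fst p, Snd p)\<close> becomes \<open>p\<close>.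
\<close>

fun contract_pair :: "(tm \<Rightarrow> tm \<Rightarrow> tm \<Rightarrow> tm option \<Rightarrow> result) in_ctx" where
  "contract_pair r \<Gamma> n a b T None = Some (MkPair a b, T)"
| "contract_pair r \<Gamma> n a b T (Some p) = contract_pair_if (is_Snd_of p b) r \<Gamma> n a b T p"

definition pair4 :: "(tm \<Rightarrow> tm \<Rightarrow> result \<Rightarrow> result) in_ctx" where
  "pair4 r \<Gamma> n a T x = (case x of Some (b, B) \<Rightarrow> contract_pair r \<Gamma> n a b T (Fst_arg a) | None \<Rightarrow> None)"

lemma pair4_eval: "pair4 r \<Gamma> n a T (Some (b, B)) = contract_pair r \<Gamma> n a b T (Fst_arg a)"
  by (simp add: pair4_def)

definition pair3 :: "(tm \<Rightarrow> tm \<Rightarrow> tm \<Rightarrow> tm option \<Rightarrow> result) in_env" where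
  "pair3 r \<Gamma> n es d a b S x = (case x of Some T \<Rightarrow> pair4 r \<Gamma> n a S (r \<Gamma> n es d (Some T) b) | None \<Rightarrow> None)"

lemma pair3_eval: "pair3 r \<Gamma> n es d a b S (Some T) = pair4 r \<Gamma> n a S (r \<Gamma> n es d (Some T) b)"
  by (simp add: pair3_def)

definition pair2 :: "(tm \<Rightarrow> tm \<Rightarrow> result \<Rightarrow> result) in_env" where
  "pair2 r \<Gamma> n es d b B x = (case x of Some (a, A) \<Rightarrow>
     pair3 r \<Gamma> n es d a b (Sig A B) (inst_type r \<Gamma> n a A B) | None \<Rightarrow> None)"

lemma pair2_eval: "pair2 r \<Gamma> n es d b B (Some (a, A)) =
     pair3 r \<Gamma> n es d a b (Sig A B) (inst_type r \<Gamma> n a A B)"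
  by (simp add: pair2_def)

definition pair1 :: "(tm option \<Rightarrow> tm \<Rightarrow> tm \<Rightarrow> result) in_env" where
  "pair1 r \<Gamma> n es d m a b = (case m of Some (Sig A B) \<Rightarrow>
     pair2 r \<Gamma> n es d b B (r \<Gamma> n es d (Some A) a) | _ \<Rightarrow> None)"

lemma pair1_eval: "pair1 r \<Gamma> n es d (Some (Sig A B)) a b =
     pair2 r \<Gamma> n es d b B (r \<Gamma> n es d (Some A) a)"
  by (simp add: pair1_def)

definition is_result :: "tm \<Rightarrow> result \<Rightarrow> bool" where
  "is_result v x = (case x of Some (w, T) \<Rightarrow> v = w | None \<Rightarrow> False)"

lemma is_result_eval: "is_result v (Some (v, T)) = True"
  by (simp add: is_result_def)

fun is_value1 :: "bool \<Rightarrow> (tm \<Rightarrow> tm \<Rightarrow> bool) in_ctx" where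
  "is_value1 True r \<Gamma> n v T = True"
| "is_value1 False r \<Gamma> n v T = is_result v (r \<Gamma> n [] n (Some T) v)"

text \<open>
  The components of a pair and the endpoints of a path are terms inside a computed value or type.
  They enter an environment only after it is known that they are values, which for a term that is
  not plain is checked by evaluating it.
\<close>

definition is_value :: "(tm \<Rightarrow> tm \<Rightarrow> bool) in_ctx" where
  "is_value r \<Gamma> n v T = is_value1 (plain v) r \<Gamma> n v T"

fun revalue :: "bool \<Rightarrow> (tm option \<Rightarrow> tm \<Rightarrow> tm \<Rightarrow> result) in_ctx" where
  "revalue True r \<Gamma> n m v T = expect m v T"
| "revalue False r \<Gamma> n m v T = expect_res m (r \<Gamma> n [] n (Some T) v)"

fun fst_val :: "(tm option \<Rightarrow> tm \<Rightarrow> tm \<Rightarrow> result) in_ctx" where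
  "fst_val r \<Gamma> n m A (MkPair a b) = revalue (plain a) r \<Gamma> n m a A"
| "fst_val r \<Gamma> n m A p = expect m (Fst p) A"

definition fst1 :: "(tm option \<Rightarrow> result \<Rightarrow> result) in_ctx" where
  "fst1 r \<Gamma> n m x = (case x of Some (p, Sig A B) \<Rightarrow> fst_val r \<Gamma> n m A p | _ \<Rightarrow> None)"

lemma fst1_eval: "fst1 r \<Gamma> n m (Some (p, Sig A B)) = fst_val r \<Gamma> n m A p"
  by (simp add: fst1_def)

definition snd_pair :: "bool \<Rightarrow> (tm option \<Rightarrow> tm \<Rightarrow> tm option \<Rightarrow> result) in_ctx" where
  "snd_pair x r \<Gamma> n m b y = (if x then
     (case y of Some T \<Rightarrow> revalue (plain b) r \<Gamma> n m b T | None \<Rightarrow> None) else None)"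

lemma snd_pair_eval: "snd_pair True r \<Gamma> n m b (Some T) = revalue (plain b) r \<Gamma> n m b T"
  by (simp add: snd_pair_def)

definition expect_at :: "tm option \<Rightarrow> tm \<Rightarrow> tm option \<Rightarrow> result" where
  "expect_at m v x = (case x of Some T \<Rightarrow> expect m v T | None \<Rightarrow> None)"

lemma expect_at_eval: "expect_at m v (Some T) = expect m v T"
  by (simp add: expect_at_def)

fun snd_val :: "(tm option \<Rightarrow> tm \<Rightarrow> tm \<Rightarrow> tm \<Rightarrow> result) in_ctx" where
  "snd_val r \<Gamma> n m A B (MkPair a b) =
     snd_pair (is_value r \<Gamma> n a A) r \<Gamma> n m b (inst_type r \<Gamma> n a A B)"
| "snd_val r \<Gamma> n m A B p = expect_at m (Snd p) (inst_type r \<Gamma> n (Fst p) A B)"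

definition snd1 :: "(tm option \<Rightarrow> result \<Rightarrow> result) in_ctx" where
  "snd1 r \<Gamma> n m x = (case x of Some (p, Sig A B) \<Rightarrow> snd_val r \<Gamma> n m A B p | _ \<Rightarrow> None)"

lemma snd1_eval: "snd1 r \<Gamma> n m (Some (p, Sig A B)) = snd_val r \<Gamma> n m A B p"
  by (simp add: snd1_def)

subsection \<open>Identity types\<close>

definition eq2 :: "tm option \<Rightarrow> tm \<Rightarrow> nat \<Rightarrow> result \<Rightarrow> result \<Rightarrow> result" where
  "eq2 m A i x y = (case x of None \<Rightarrow> None | Some (a, _) \<Rightarrow>
     (case y of None \<Rightarrow> None | Some (b, _) \<Rightarrow> expect m (Eq A a b) (Univ i)))"

lemma eq2_eval: "eq2 m A i (Some (a, S)) (Some (b, T)) = expect m (Eq A a b) (Univ i)"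
  by (simp add: eq2_def)

definition eq1 :: "(tm option \<Rightarrow> tm \<Rightarrow> tm \<Rightarrow> result \<Rightarrow> result) in_env" where
  "eq1 r \<Gamma> n es d m a b x = (case x of Some (A, Univ i) \<Rightarrow>
     eq2 m A i (r \<Gamma> n es d (Some A) a) (r \<Gamma> n es d (Some A) b) | _ \<Rightarrow> None)"

lemma eq1_eval: "eq1 r \<Gamma> n es d m a b (Some (A, Univ i)) =
     eq2 m A i (r \<Gamma> n es d (Some A) a) (r \<Gamma> n es d (Some A) b)"
  by (simp add: eq1_def)

definition refl_val :: "tm option \<Rightarrow> result" where
  "refl_val m = (case m of Some (Eq A a b) \<Rightarrow> if a = b then Some (Refl, Eq A a b) else None | _ \<Rightarrow> None)"

lemma refl_val_eval: "refl_val (Some (Eq A a a)) = Some (Refl, Eq A a a)"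
  by (simp add: refl_val_def)

fun J_val :: "(tm option \<Rightarrow> tm \<Rightarrow> tm \<Rightarrow> tm \<Rightarrow> tm \<Rightarrow> tm \<Rightarrow> tm \<Rightarrow> tm \<Rightarrow> result) in_ctx" where
  "J_val r \<Gamma> n m c A b P e Td Refl = expect m e Td"
| "J_val r \<Gamma> n m c A b P e Td p = expect_at m (J (Lam (Lam c)) e p) (inst2_type r \<Gamma> n b A p P c)"

definition J4 :: "(tm option \<Rightarrow> tm \<Rightarrow> tm \<Rightarrow> tm \<Rightarrow> tm \<Rightarrow> tm \<Rightarrow> result \<Rightarrow> result) in_ctx" where
  "J4 r \<Gamma> n m c A b P p x = (case x of Some (e, Td) \<Rightarrow> J_val r \<Gamma> n m c A b P e Td p | None \<Rightarrow> None)"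

lemma J4_eval: "J4 r \<Gamma> n m c A b P p (Some (e, Td)) = J_val r \<Gamma> n m c A b P e Td p"
  by (simp add: J4_def)

definition J3 :: "(tm option \<Rightarrow> tm \<Rightarrow> tm \<Rightarrow> tm \<Rightarrow> tm \<Rightarrow> tm \<Rightarrow> tm \<Rightarrow> tm option \<Rightarrow> result) in_env" where
  "J3 r \<Gamma> n es d m c e A b P p x = (case x of Some Td \<Rightarrow>
     J4 r \<Gamma> n m c A b P p (r \<Gamma> n es d (Some Td) e) | None \<Rightarrow> None)"

lemma J3_eval: "J3 r \<Gamma> n es d m c e A b P p (Some Td) =
     J4 r \<Gamma> n m c A b P p (r \<Gamma> n es d (Some Td) e)"
  by (simp add: J3_def)

definition J2 :: "bool \<Rightarrow> bool \<Rightarrow> (tm option \<Rightarrow> tm \<Rightarrow> tm \<Rightarrow> tm \<Rightarrow> tm \<Rightarrow> tm \<Rightarrow> result \<Rightarrow> result) in_env" where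
  "J2 x y r \<Gamma> n es d m e A a b p z = (if x \<and> y then (case z of Some (c, Univ i) \<Rightarrow>
     J3 r \<Gamma> n es d m c e A b (Eq A a b) p (inst2_type r \<Gamma> n a A Refl (Eq A a a) c) | _ \<Rightarrow> None) else None)"

lemma J2_eval: "J2 True True r \<Gamma> n es d m e A a b p (Some (c, Univ i)) =
     J3 r \<Gamma> n es d m c e A b (Eq A a b) p (inst2_type r \<Gamma> n a A Refl (Eq A a a) c)"
  by (simp add: J2_def)

definition J1 :: "(tm option \<Rightarrow> tm \<Rightarrow> tm \<Rightarrow> result \<Rightarrow> result) in_env" where
  "J1 r \<Gamma> n es d m c e x = (case x of Some (p, Eq A a b) \<Rightarrow>
      J2 (is_value r \<Gamma> n a A) (is_value r \<Gamma> n b A) r \<Gamma> n es d m e A a b p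
        (r (Eq (lift (Suc 0) A) (lift (Suc 0) a) (Var 0) # A # \<Gamma>) (Suc (Suc n))
          ((Suc (Suc n), Var 0, lift (Suc 0) (Eq (lift (Suc 0) A) (lift (Suc 0) a) (Var 0))) #
           (Suc n, Var 0, lift (Suc 0) A) # es) d None c)
    | _ \<Rightarrow> None)"

lemma J1_eval: "J1 r \<Gamma> n es d m c e (Some (p, Eq A a b)) =
      J2 (is_value r \<Gamma> n a A) (is_value r \<Gamma> n b A) r \<Gamma> n es d m e A a b p
        (r (Eq (lift (Suc 0) A) (lift (Suc 0) a) (Var 0) # A # \<Gamma>) (Suc (Suc n))
          ((Suc (Suc n), Var 0, lift (Suc 0) (Eq (lift (Suc 0) A) (lift (Suc 0) a) (Var 0))) #
           (Suc n, Var 0, lift (Suc 0) A) # es) d None c)"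
  by (simp add: J1_def)

text \<open>
  The motive is required to be a double abstraction.  Its body is evaluated in the context extended
  by an endpoint and a path, and then instantiated at the two places where the rule uses it.
\<close>

definition J0 :: "(tm option \<Rightarrow> tm \<Rightarrow> tm \<Rightarrow> tm \<Rightarrow> result) in_env" where
  "J0 r \<Gamma> n es d m C e p = (case C of Lam C1 \<Rightarrow> (case C1 of Lam c \<Rightarrow>
     J1 r \<Gamma> n es d m c e (r \<Gamma> n es d None p) | _ \<Rightarrow> None) | _ \<Rightarrow> None)"

lemma J0_eval: "J0 r \<Gamma> n es d m (Lam (Lam c)) e p = J1 r \<Gamma> n es d m c e (r \<Gamma> n es d None p)"
  by (simp add: J0_def)

subsection \<open>The normaliser\<close>

text \<open>
  The two axioms have no value: they occur only through variables for the types that they inhabit.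
\<close>

primrec step :: "evaluator \<Rightarrow> evaluator" where
  "step r \<Gamma> n es d m (Var k) = eval_var \<Gamma> n es d m k"
| "step r \<Gamma> n es d m (Univ i) = expect m (Univ i) (Univ (Suc i))"
| "step r \<Gamma> n es d m (Pi A B) = former1 Pi r \<Gamma> n es d m B (r \<Gamma> n es d None A)"
| "step r \<Gamma> n es d m (Lam b) = lam0 r \<Gamma> n es d m b"
| "step r \<Gamma> n es d m (App f a) = app0 (lam_head f) r \<Gamma> n es d m f a"
| "step r \<Gamma> n es d m (Sig A B) = former1 Sig r \<Gamma> n es d m B (r \<Gamma> n es d None A)"
| "step r \<Gamma> n es d m (MkPair a b) = pair1 r \<Gamma> n es d m a b"
| "step r \<Gamma> n es d m (Fst p) = fst1 r \<Gamma> n m (r \<Gamma> n es d None p)"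
| "step r \<Gamma> n es d m (Snd p) = snd1 r \<Gamma> n m (r \<Gamma> n es d None p)"
| "step r \<Gamma> n es d m (Eq A a b) = eq1 r \<Gamma> n es d m a b (r \<Gamma> n es d None A)"
| "step r \<Gamma> n es d m Refl = refl_val m"
| "step r \<Gamma> n es d m (J C e p) = J0 r \<Gamma> n es d m C e p"
| "step r \<Gamma> n es d m (FunExt i j) = None"
| "step r \<Gamma> n es d m (UA i) = None"

primrec nf :: "nat \<Rightarrow> evaluator" where
  "nf 0 = (\<lambda>\<Gamma> n es d m t. None)"
| "nf (Suc k) = (\<lambda>\<Gamma> n es d m t. step (nf k) \<Gamma> n es d m t)"

lemma nf_Suc_eval: "nf (Suc k) \<Gamma> n es d m t = step (nf k) \<Gamma> n es d m t"
  by simp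

lemma max_eval: "max 0 (n::nat) = n" "max (Suc m) 0 = Suc m" "max (Suc m) (Suc n) = Suc (max m n)"
  by simp_all

lemmas nf_eval = nf_Suc_eval step.simps J0_eval J1_eval J2_eval J3_eval J4_eval J_val.simps
  is_value_def is_value1.simps revalue.simps plain.simps rigid.simps pair_free.simps direct_def inst_type1.simps inst2_type1.simps inst_var.simps inst_at.simps is_result_eval refl_val_eval eq1_eval eq2_eval snd1_eval snd_val.simps
  snd_pair_eval expect_at_eval fst1_eval fst_val.simps pair1_eval pair2_eval pair3_eval
  pair4_eval contract_pair.simps contract_pair_if.simps is_Snd_of.simps Fst_arg.simps app0.simps
  redex0.simps redex_infer1_eval redex_infer2_eval
  redex1_eval redex2_eval app1_eval app2_eval app3_eval app_val.simps lam_head.simps lam0_eval lam1_def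
  lam2_eval lam_guess1.simps lam_guess2_eval innermost_fn.simps pick_fn.simps eta_lam.simps at_type_eval eta_contractum.simps lower_if.simps is_Var0.simps former1_eval former2_eval inst_type_def inst2_type_def type_of_res_eval
  eval_var.simps expect_var.simps ctx_lookup.simps expect_eval expect_res_eval lower.simps
  lower2.simps lower3.simps lower_var.simps option.map lift.simps lift_at.simps lift_var.simps
  diff_Suc_Suc diff_zero add_0 add_Suc max_eval tm.inject tm.distinct nat.inject nat.distinct
  simp_thms

section \<open>Soundness of the normaliser\<close>

lemma up_ren_lift_var: "up_ren (lift_var c d) = lift_var (Suc c) d"
proof
  fix k show "up_ren (lift_var c d) k = lift_var (Suc c) d k" by (cases k) simp_all
qed

lemma lift_at_eq_ren: "lift_at d c t = ren (lift_var c d) t"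
  by (induction t arbitrary: c) (simp_all only: lift_at.simps ren.simps up_ren_lift_var)

lemma lift_eq_ren: "lift d t = ren (\<lambda>k. d + k) t"
proof (cases d)
  case (Suc e)
  have "lift_var 0 d = (\<lambda>k. d + k)" by auto
  then show ?thesis using Suc by (simp only: lift.simps lift_at_eq_ren)
qed (simp add: ren_id)

lemma lift_1: "lift (Suc 0) t = shift t"
  by (simp add: lift_eq_ren)

lemma lower_var_Some: "lower_var c k = Some j \<Longrightarrow> k = lift_var c 1 j"
  by (induction c k arbitrary: j rule: lower_var.induct) auto

lemma up_sub_inst_var:
  "up_sub (\<lambda>k. inst_var c u (lower_var c k)) = (\<lambda>k. inst_var (Suc c) u (lower_var (Suc c) k))"
proof
  fix k
  show "up_sub (\<lambda>k. inst_var c u (lower_var c k)) k = inst_var (Suc c) u (lower_var (Suc c) k)"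
    by (cases k; cases "lower_var c (k - 1)") (simp_all add: lift_eq_ren ren_ren del: lift.simps)
qed

lemma inst_at_eq_subst: "inst_at c u t = subst (\<lambda>k. inst_var c u (lower_var c k)) t"
  by (induction t arbitrary: c) (simp_all only: inst_at.simps subst.simps up_sub_inst_var)

lemma inst_at_0: "inst_at 0 u t = inst t u"
proof -
  have "(\<lambda>k. inst_var 0 u (lower_var 0 k)) = case_nat u Var"
  proof
    fix k show "inst_var 0 u (lower_var 0 k) = case_nat u Var k" by (cases k) simp_all
  qed
  then show ?thesis by (simp only: inst_at_eq_subst)
qed

lemma inst_at_1: "inst_at (Suc 0) u t = subst (up_sub (case_nat u Var)) t"
proof -
  have "inst_var (Suc 0) u (lower_var (Suc 0) k) = up_sub (case_nat u Var) k" for k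
    by (cases k; cases "k - 1") (simp_all add: lift_1 del: lift.simps)
  then show ?thesis by (simp only: inst_at_eq_subst)
qed

lemma lower2_Some: "lower2 f x y = Some z \<longleftrightarrow> (\<exists>a b. x = Some a \<and> y = Some b \<and> z = f a b)"
  by (cases x; cases y) auto

lemma lower3_Some:
  "lower3 f x y w = Some z \<longleftrightarrow> (\<exists>a b c. x = Some a \<and> y = Some b \<and> w = Some c \<and> z = f a b c)"
  by (cases x) (auto simp: lower2_Some)

lemma lower_Some: "lower c t = Some t' \<Longrightarrow> t = lift_at 1 c t'"
  by (induction t arbitrary: c t') (auto simp: lower2_Some lower3_Some dest: lower_var_Some)

lemma lower_0_Some: "lower 0 t = Some t' \<Longrightarrow> t = shift t'"
  using lower_Some[of 0 t t'] lift_1[of t'] by simp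

lemma eta_contractum_Some:
  "eta_contractum b = Some f \<Longrightarrow> b = App (shift f) (Var 0)"
proof -
  have *: "is_Var0 a \<longleftrightarrow> a = Var 0" for a by (cases a rule: is_Var0.cases) auto
  show "eta_contractum b = Some f \<Longrightarrow> b = App (shift f) (Var 0)"
  proof (cases b)
    case (App g a)
    assume "eta_contractum b = Some f"
    then show ?thesis using App * by (cases "is_Var0 a") (auto dest: lower_0_Some)
  qed simp_all
qed

lemma Fst_arg_Some: "Fst_arg a = Some p \<longleftrightarrow> a = Fst p"
  by (cases a) auto

lemma is_Snd_of_iff: "is_Snd_of p b \<longleftrightarrow> b = Snd p"
  by (cases b) auto

text \<open>
  A value in head position decides a reduction, whose rule asks for typing information that could
  otherwise be obtained only by inverting typing derivations.  The invariant keeps this information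
  available.
\<close>

definition value_shape :: "tm list \<Rightarrow> tm \<Rightarrow> tm \<Rightarrow> bool" where
  "value_shape \<Gamma> v T \<longleftrightarrow>
    (\<forall>b. v = Lam b \<longrightarrow> (\<exists>A B. T = Pi A B \<and> A # \<Gamma> \<turnstile> b : B)) \<and>
    (\<forall>a b. v = MkPair a b \<longrightarrow> (\<exists>A B. T = Sig A B \<and> \<Gamma> \<turnstile> a : A \<and> \<Gamma> \<turnstile> b : inst B a)) \<and>
    (v = Refl \<longrightarrow> (\<exists>A a. T = Eq A a a))"

definition is_type :: "tm list \<Rightarrow> tm \<Rightarrow> bool" where
  "is_type \<Gamma> T \<longleftrightarrow> (\<exists>i. \<Gamma> \<turnstile> T : Univ i)"

definition value_of :: "tm list \<Rightarrow> tm \<Rightarrow> tm \<Rightarrow> bool" where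
  "value_of \<Gamma> v T \<longleftrightarrow> \<Gamma> \<turnstile> v : T \<and> is_type \<Gamma> T \<and> value_shape \<Gamma> v T"

text \<open>The meaning of a successful evaluation of \<open>t\<close>.\<close>

definition evaluates :: "tm list \<Rightarrow> tm \<Rightarrow> tm \<Rightarrow> tm \<Rightarrow> bool" where
  "evaluates \<Gamma> t v T \<longleftrightarrow> \<Gamma> \<turnstile> t : T \<and> \<Gamma> \<turnstile> t \<equiv> v : T \<and> value_of \<Gamma> v T"

lemma evaluatesD:
  assumes "evaluates \<Gamma> t v T"
  shows "\<Gamma> \<turnstile> t : T" "\<Gamma> \<turnstile> t \<equiv> v : T" "\<Gamma> \<turnstile> v : T" "is_type \<Gamma> T" "value_of \<Gamma> v T"
    "value_shape \<Gamma> v T"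
  using assms by (auto simp: evaluates_def value_of_def)

lemma evaluates_neutral:
  assumes "\<Gamma> \<turnstile> t : T" "\<Gamma> \<turnstile> t \<equiv> v : T" "\<Gamma> \<turnstile> v : T" "is_type \<Gamma> T"
    and "\<And>b. v \<noteq> Lam b" "\<And>a b. v \<noteq> MkPair a b" "v \<noteq> Refl"
  shows "evaluates \<Gamma> t v T"
  using assms by (simp add: evaluates_def value_of_def value_shape_def)

lemma evaluates_cong:
  assumes "\<Gamma> \<turnstile> t : T" "\<Gamma> \<turnstile> t \<equiv> u : T" "evaluates \<Gamma> u v T"
  shows "evaluates \<Gamma> t v T"
  using assms eq_trans unfolding evaluates_def by blast

lemma is_type_Univ: "\<Gamma> ctx \<Longrightarrow> is_type \<Gamma> (Univ i)"
  by (auto simp: is_type_def intro: ty_univ)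

lemma value_refl: "value_of \<Gamma> v T \<Longrightarrow> evaluates \<Gamma> v v T"
  using eq_refl by (auto simp: evaluates_def value_of_def)

lemma evaluates_Univ: "\<Gamma> ctx \<Longrightarrow> evaluates \<Gamma> (Univ i) (Univ i) (Univ (Suc i))"
  by (rule evaluates_neutral) (auto intro: ty_univ eq_refl is_type_Univ)

lemma evaluates_Pi:
  assumes A: "evaluates \<Gamma> A A' (Univ i)" and B: "evaluates (A' # \<Gamma>) B B' (Univ j)"
  shows "evaluates \<Gamma> (Pi A B) (Pi A' B') (Univ (max i j))"
proof (rule evaluates_neutral)
  note A' = evaluatesD[OF A] and B' = evaluatesD[OF B]
  have BA: "A # \<Gamma> \<turnstile> B : Univ j" "A # \<Gamma> \<turnstile> B \<equiv> B' : Univ j"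
    using conv_head_ctx[OF A'(2,1)] B'(1,2) by blast+
  show "\<Gamma> \<turnstile> Pi A B : Univ (max i j)" using A' BA ty_pi by blast
  show "\<Gamma> \<turnstile> Pi A B \<equiv> Pi A' B' : Univ (max i j)" using A' BA cong_pi by blast
  show "\<Gamma> \<turnstile> Pi A' B' : Univ (max i j)" using A' B' ty_pi by blast
  show "is_type \<Gamma> (Univ (max i j))" using A'(1) ctx_of_derivable is_type_Univ by blast
qed auto

lemma evaluates_Sig:
  assumes A: "evaluates \<Gamma> A A' (Univ i)" and B: "evaluates (A' # \<Gamma>) B B' (Univ j)"
  shows "evaluates \<Gamma> (Sig A B) (Sig A' B') (Univ (max i j))"
proof (rule evaluates_neutral)
  note A' = evaluatesD[OF A] and B' = evaluatesD[OF B]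
  have BA: "A # \<Gamma> \<turnstile> B : Univ j" "A # \<Gamma> \<turnstile> B \<equiv> B' : Univ j"
    using conv_head_ctx[OF A'(2,1)] B'(1,2) by blast+
  show "\<Gamma> \<turnstile> Sig A B : Univ (max i j)" using A' BA ty_sig by blast
  show "\<Gamma> \<turnstile> Sig A B \<equiv> Sig A' B' : Univ (max i j)" using A' BA cong_sig by blast
  show "\<Gamma> \<turnstile> Sig A' B' : Univ (max i j)" using A' B' ty_sig by blast
  show "is_type \<Gamma> (Univ (max i j))" using A'(1) ctx_of_derivable is_type_Univ by blast
qed auto

lemma is_type_Pi: "\<Gamma> \<turnstile> A : Univ i \<Longrightarrow> is_type (A # \<Gamma>) B \<Longrightarrow> is_type \<Gamma> (Pi A B)"
  by (auto simp: is_type_def intro: ty_pi)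

lemma is_type_PiD: "is_type \<Gamma> (Pi A B) \<Longrightarrow> is_type \<Gamma> A \<and> is_type (A # \<Gamma>) B"
  unfolding is_type_def using Pi_formation_inv(2) by blast

lemma is_type_SigD: "is_type \<Gamma> (Sig A B) \<Longrightarrow> is_type \<Gamma> A \<and> is_type (A # \<Gamma>) B"
  unfolding is_type_def using Sig_formation_inv(2) by blast

lemma is_type_EqD: "is_type \<Gamma> (Eq A a b) \<Longrightarrow> is_type \<Gamma> A \<and> \<Gamma> \<turnstile> a : A \<and> \<Gamma> \<turnstile> b : A"
  unfolding is_type_def using Eq_formation_inv(2) by blast

lemma evaluates_Lam:
  assumes A: "is_type \<Gamma> A" and b: "evaluates (A # \<Gamma>) b b' B"
  shows "evaluates \<Gamma> (Lam b) (Lam b') (Pi A B)"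
proof -
  from A obtain i where A: "\<Gamma> \<turnstile> A : Univ i" by (auto simp: is_type_def)
  note b = evaluatesD[OF b]
  show ?thesis
    using ty_lam[OF A b(1)] cong_lam[OF A b(2)] ty_lam[OF A b(3)] b(3) is_type_Pi[OF A b(4)]
    by (simp add: evaluates_def value_of_def value_shape_def)
qed

lemma evaluates_eta_lam:
  assumes l: "evaluates \<Gamma> t (Lam (App (shift f) (Var 0))) (Pi A B)"
    and f: "evaluates \<Gamma> f v (Pi A B)"
  shows "evaluates \<Gamma> t v (Pi A B)"
proof -
  have "\<Gamma> \<turnstile> f \<equiv> Lam (App (shift f) (Var 0)) : Pi A B"
    using evaluatesD(1)[OF f] by (rule eta_fun)
  from eq_trans[OF evaluatesD(2)[OF l] eq_sym[OF this]] have "\<Gamma> \<turnstile> t \<equiv> f : Pi A B" .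
  then show ?thesis using evaluates_cong[OF evaluatesD(1)[OF l] _ f] by blast
qed

definition conv_type :: "tm list \<Rightarrow> tm \<Rightarrow> tm \<Rightarrow> bool" where
  "conv_type \<Gamma> S T \<longleftrightarrow> (\<exists>i. \<Gamma> \<turnstile> S \<equiv> T : Univ i) \<and> is_type \<Gamma> T"

lemma conv_typeI: "evaluates \<Gamma> S T (Univ i) \<Longrightarrow> conv_type \<Gamma> S T"
  unfolding conv_type_def evaluates_def value_of_def is_type_def by blast

lemma conv_typeD:
  assumes "conv_type \<Gamma> S T"
  shows "is_type \<Gamma> T" "\<Gamma> \<turnstile> t : S \<Longrightarrow> \<Gamma> \<turnstile> t : T" "\<Gamma> \<turnstile> t : T \<Longrightarrow> \<Gamma> \<turnstile> t : S"
    "\<Gamma> \<turnstile> t \<equiv> u : S \<Longrightarrow> \<Gamma> \<turnstile> t \<equiv> u : T" "\<Gamma> \<turnstile> t \<equiv> u : T \<Longrightarrow> \<Gamma> \<turnstile> t \<equiv> u : S"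
  using assms ty_conv eq_conv eq_sym unfolding conv_type_def by blast+

lemma conv_type_refl: "is_type \<Gamma> T \<Longrightarrow> conv_type \<Gamma> T T"
  unfolding conv_type_def is_type_def using eq_refl by blast

lemma conv_type_inst:
  assumes "is_type \<Gamma> A" "is_type (A # \<Gamma>) B" "evaluates \<Gamma> a a' A"
  shows "conv_type \<Gamma> (inst B a) (inst B a')"
proof -
  obtain i j where A: "\<Gamma> \<turnstile> A : Univ i" and B: "A # \<Gamma> \<turnstile> B : Univ j"
    using assms by (auto simp: is_type_def)
  note a = evaluatesD[OF assms(3)]
  have "\<Gamma> \<turnstile> inst B a' : Univ j" using inst_derivable(1)[OF a(3) B] by simp
  then show ?thesis
    using inst_type_cong[OF A B a(2,1,3)] unfolding conv_type_def is_type_def by blast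
qed

lemma app_derivable:
  assumes f: "evaluates \<Gamma> f f' (Pi A B)" and a: "evaluates \<Gamma> a a' A"
    and T: "conv_type \<Gamma> (inst B a') T"
  shows "\<Gamma> \<turnstile> App f a : T" "\<Gamma> \<turnstile> App f a \<equiv> App f' a' : T" "\<Gamma> \<turnstile> App f' a' : T"
proof -
  note f = evaluatesD[OF f] and a' = evaluatesD[OF a]
  have "conv_type \<Gamma> (inst B a) (inst B a')"
    using is_type_PiD[OF f(4)] conv_type_inst a by blast
  note c = conv_typeD[OF this] and d = conv_typeD[OF T]
  show "\<Gamma> \<turnstile> App f a : T" using d(2)[OF c(2)[OF ty_app[OF f(1) a'(1)]]] .
  show "\<Gamma> \<turnstile> App f a \<equiv> App f' a' : T" using d(4)[OF c(4)[OF cong_app[OF f(2) a'(2)]]] .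
  show "\<Gamma> \<turnstile> App f' a' : T" using d(2)[OF ty_app[OF f(3) a'(3)]] .
qed

text \<open>
  The reason why evaluating the body in an extended environment is correct: that result is the value
  of the contractum.
\<close>

lemma evaluates_app_beta:
  assumes f: "evaluates \<Gamma> f (Lam b) (Pi A B)" and a: "evaluates \<Gamma> a a' A"
    and T: "conv_type \<Gamma> (inst B a') T" and r: "evaluates \<Gamma> (inst b a') v T"
  shows "evaluates \<Gamma> (App f a) v T"
proof (rule evaluates_cong[OF app_derivable(1)[OF f a T] _ r])
  obtain i where A: "\<Gamma> \<turnstile> A : Univ i"
    using is_type_PiD[OF evaluatesD(4)[OF f]] by (auto simp: is_type_def)
  have b: "A # \<Gamma> \<turnstile> b : B"
    using evaluatesD(6)[OF f] by (auto simp: value_shape_def)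
  have "\<Gamma> \<turnstile> App (Lam b) a' \<equiv> inst b a' : T"
    using conv_typeD(4)[OF T beta_fun[OF A b evaluatesD(3)[OF a]]] .
  with app_derivable(2)[OF f a T] show "\<Gamma> \<turnstile> App f a \<equiv> inst b a' : T"
    by (rule eq_trans)
qed

lemma pair_derivable:
  assumes S: "is_type \<Gamma> (Sig A B)" and a: "evaluates \<Gamma> a a' A"
    and T: "conv_type \<Gamma> (inst B a') T" and b: "evaluates \<Gamma> b b' T"
  shows "evaluates \<Gamma> (MkPair a b) (MkPair a' b') (Sig A B)"
proof -
  obtain i j where A: "\<Gamma> \<turnstile> A : Univ i" and B: "A # \<Gamma> \<turnstile> B : Univ j"
    using is_type_SigD[OF S] by (auto simp: is_type_def)
  note a' = evaluatesD[OF a] and b' = evaluatesD[OF b]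
  have "conv_type \<Gamma> (inst B a) (inst B a')"
    using is_type_SigD[OF S] conv_type_inst a by blast
  note c = conv_typeD[OF this] and d = conv_typeD[OF T]
  have "\<Gamma> \<turnstile> MkPair a b : Sig A B" using ty_pair[OF A B a'(1) c(3)[OF d(3)[OF b'(1)]]] .
  moreover have "\<Gamma> \<turnstile> MkPair a b \<equiv> MkPair a' b' : Sig A B"
    using cong_pair[OF A B a'(2) c(5)[OF d(5)[OF b'(2)]]] .
  moreover have "\<Gamma> \<turnstile> MkPair a' b' : Sig A B" using ty_pair[OF A B a'(3) d(3)[OF b'(3)]] .
  moreover have "\<Gamma> \<turnstile> b' : inst B a'" using d(3)[OF b'(3)] .
  ultimately show ?thesis
    using S a'(3) by (simp add: evaluates_def value_of_def value_shape_def)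
qed

lemma evaluates_eta_pair:
  assumes l: "evaluates \<Gamma> t (MkPair (Fst p) (Snd p)) (Sig A B)"
    and p: "evaluates \<Gamma> p v (Sig A B)"
  shows "evaluates \<Gamma> t v (Sig A B)"
proof -
  have "\<Gamma> \<turnstile> p \<equiv> MkPair (Fst p) (Snd p) : Sig A B"
    using evaluatesD(1)[OF p] by (rule eta_pair)
  from eq_trans[OF evaluatesD(2)[OF l] eq_sym[OF this]] have "\<Gamma> \<turnstile> t \<equiv> p : Sig A B" .
  then show ?thesis using evaluates_cong[OF evaluatesD(1)[OF l] _ p] by blast
qed

lemma fst_derivable:
  assumes p: "evaluates \<Gamma> p p' (Sig A B)"
  shows "\<Gamma> \<turnstile> Fst p : A" "\<Gamma> \<turnstile> Fst p \<equiv> Fst p' : A" "\<Gamma> \<turnstile> Fst p' : A" "is_type \<Gamma> A"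
  using evaluatesD[OF p] ty_fst cong_fst is_type_SigD by blast+

lemma fst_pair_derivable:
  assumes p: "evaluates \<Gamma> p (MkPair a b) (Sig A B)"
  shows "\<Gamma> \<turnstile> Fst p \<equiv> a : A" "\<Gamma> \<turnstile> Fst (MkPair a b) \<equiv> a : A"
proof -
  obtain i j where AB: "\<Gamma> \<turnstile> A : Univ i" "A # \<Gamma> \<turnstile> B : Univ j"
    using is_type_SigD[OF evaluatesD(4)[OF p]] by (auto simp: is_type_def)
  have ab: "\<Gamma> \<turnstile> a : A" "\<Gamma> \<turnstile> b : inst B a"
    using evaluatesD(6)[OF p] by (simp_all add: value_shape_def)
  show "\<Gamma> \<turnstile> Fst (MkPair a b) \<equiv> a : A"
    using beta_fst[OF AB ab] .
  with fst_derivable(2)[OF p] show "\<Gamma> \<turnstile> Fst p \<equiv> a : A" by (rule eq_trans)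
qed

lemma snd_derivable:
  assumes p: "evaluates \<Gamma> p p' (Sig A B)" and T: "conv_type \<Gamma> (inst B (Fst p')) T"
  shows "\<Gamma> \<turnstile> Snd p : T" "\<Gamma> \<turnstile> Snd p \<equiv> Snd p' : T" "\<Gamma> \<turnstile> Snd p' : T"
proof -
  note p' = evaluatesD[OF p]
  obtain i j where AB: "\<Gamma> \<turnstile> A : Univ i" "A # \<Gamma> \<turnstile> B : Univ j"
    using is_type_SigD[OF p'(4)] by (auto simp: is_type_def)
  have "\<Gamma> \<turnstile> inst B (Fst p) \<equiv> inst B (Fst p') : Univ j"
    using inst_type_cong[OF AB] fst_derivable[OF p] by blast
  then have c: "conv_type \<Gamma> (inst B (Fst p)) (inst B (Fst p'))"
    using inst_derivable(1)[OF fst_derivable(3)[OF p] AB(2)]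
    unfolding conv_type_def is_type_def by (simp, blast)
  note c = conv_typeD[OF c] and d = conv_typeD[OF T]
  show "\<Gamma> \<turnstile> Snd p : T" using d(2)[OF c(2)[OF ty_snd[OF p'(1)]]] .
  show "\<Gamma> \<turnstile> Snd p \<equiv> Snd p' : T" using d(4)[OF c(4)[OF cong_snd[OF p'(2)]]] .
  show "\<Gamma> \<turnstile> Snd p' : T" using d(2)[OF ty_snd[OF p'(3)]] .
qed

lemma snd_pair_derivable:
  assumes p: "evaluates \<Gamma> p (MkPair a b) (Sig A B)" and T: "conv_type \<Gamma> (inst B a) T"
  shows "\<Gamma> \<turnstile> Snd p : T" "\<Gamma> \<turnstile> Snd p \<equiv> b : T"
proof -
  obtain i j where AB: "\<Gamma> \<turnstile> A : Univ i" "A # \<Gamma> \<turnstile> B : Univ j"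
    using is_type_SigD[OF evaluatesD(4)[OF p]] by (auto simp: is_type_def)
  have ab: "\<Gamma> \<turnstile> a : A" "\<Gamma> \<turnstile> b : inst B a"
    using evaluatesD(6)[OF p] by (simp_all add: value_shape_def)
  have "\<Gamma> \<turnstile> inst B (Fst (MkPair a b)) \<equiv> inst B a : Univ j"
    using inst_type_cong[OF AB fst_pair_derivable(2)[OF p] fst_derivable(3)[OF p] ab(1)] .
  moreover have "is_type \<Gamma> (inst B a)"
    using inst_derivable(1)[OF ab(1) AB(2)] unfolding is_type_def by (simp, blast)
  ultimately have c: "conv_type \<Gamma> (inst B (Fst (MkPair a b))) (inst B a)"
    unfolding conv_type_def by blast
  note d = conv_typeD[OF T]
  note s = snd_derivable[OF p c]
  show "\<Gamma> \<turnstile> Snd p : T" using d(2)[OF s(1)] .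
  have "\<Gamma> \<turnstile> Snd (MkPair a b) \<equiv> b : T" using d(4)[OF beta_snd[OF AB ab]] .
  with d(4)[OF s(2)] show "\<Gamma> \<turnstile> Snd p \<equiv> b : T" by (rule eq_trans)
qed

lemma evaluates_Eq:
  assumes A: "evaluates \<Gamma> A A' (Univ i)" and a: "evaluates \<Gamma> a a' A'" and b: "evaluates \<Gamma> b b' A'"
  shows "evaluates \<Gamma> (Eq A a b) (Eq A' a' b') (Univ i)"
proof (rule evaluates_neutral)
  note d = conv_typeD[OF conv_typeI[OF A]]
  note A = evaluatesD[OF A] and a = evaluatesD[OF a] and b = evaluatesD[OF b]
  show "\<Gamma> \<turnstile> Eq A a b : Univ i" using ty_eq[OF A(1) d(3)[OF a(1)] d(3)[OF b(1)]] .
  show "\<Gamma> \<turnstile> Eq A a b \<equiv> Eq A' a' b' : Univ i" using cong_eq[OF A(2) d(5)[OF a(2)] d(5)[OF b(2)]] .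
  show "\<Gamma> \<turnstile> Eq A' a' b' : Univ i" using A a b ty_eq by blast
  show "is_type \<Gamma> (Univ i)" using A by blast
qed auto

lemma evaluates_Refl:
  assumes "is_type \<Gamma> (Eq A a a)"
  shows "evaluates \<Gamma> Refl Refl (Eq A a a)"
  using assms is_type_EqD[OF assms] ty_refl[of \<Gamma> a A] eq_refl[OF ty_refl[of \<Gamma> a A]]
  by (simp add: evaluates_def value_of_def value_shape_def)

lemma inst2_eq: "inst (subst (up_sub (case_nat b Var)) c) p = subst (case_nat p (case_nat b Var)) c"
  by (simp add: subst_subst) (rule arg_cong[of _ _ "\<lambda>s. subst s c"], auto simp: subst_ren subst_Var split: nat.splits)

text \<open>
  The motive of path induction is applied to an endpoint and a path; the types that occur in the rule
  are convertible to instances of its body.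
\<close>

lemma beta2:
  assumes A: "\<Gamma> \<turnstile> A : Univ i" and a: "\<Gamma> \<turnstile> a : A" and b: "\<Gamma> \<turnstile> b : A"
    and c: "Eq (shift A) (shift a) (Var 0) # A # \<Gamma> \<turnstile> c : Univ j"
    and p: "\<Gamma> \<turnstile> p : Eq A a b"
  shows "\<Gamma> \<turnstile> App (App (Lam (Lam c)) b) p \<equiv> subst (case_nat p (case_nat b Var)) c : Univ j"
    and "\<Gamma> \<turnstile> subst (case_nat p (case_nat b Var)) c : Univ j"
proof -
  let ?E = "Eq (shift A) (shift a) (Var 0)"
  have "(A # \<Gamma>) ctx" using A by (rule ctx_extend)
  from ty_var'[OF this, of 0] have v: "A # \<Gamma> \<turnstile> Var 0 : shift A" by (simp add: ctx_type_0)
  have sh: "A # \<Gamma> \<turnstile> shift A : Univ i" "A # \<Gamma> \<turnstile> shift a : shift A"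
    using shift_derivable(1)[OF A A] shift_derivable(1)[OF A a] by simp_all
  then have E: "A # \<Gamma> \<turnstile> ?E : Univ i" using v ty_eq by blast
  have l: "A # \<Gamma> \<turnstile> Lam c : Pi ?E (Univ j)" using ty_lam[OF E c] .
  have E': "\<Gamma> \<turnstile> Eq A a b : Univ i" using ty_eq[OF A a b] .
  have c': "Eq A a b # \<Gamma> \<turnstile> subst (up_sub (case_nat b Var)) c : Univ j"
    using subst_derivable(1)[OF c sub_ok_up[OF sub_ok_inst[OF b]], of i] E'
    by (simp add: inst_shift)
  have 1: "\<Gamma> \<turnstile> App (Lam (Lam c)) b \<equiv> Lam (subst (up_sub (case_nat b Var)) c) : Pi (Eq A a b) (Univ j)"
    using beta_fun[OF A l b] by (simp add: inst_shift)
  have 2: "\<Gamma> \<turnstile> App (Lam (subst (up_sub (case_nat b Var)) c)) p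
      \<equiv> subst (case_nat p (case_nat b Var)) c : Univ j"
    using beta_fun[OF E' c' p] by (simp add: inst2_eq)
  show "\<Gamma> \<turnstile> App (App (Lam (Lam c)) b) p \<equiv> subst (case_nat p (case_nat b Var)) c : Univ j"
    using cong_app[OF 1 eq_refl[OF p]] 2 eq_trans by fastforce
  show "\<Gamma> \<turnstile> subst (case_nat p (case_nat b Var)) c : Univ j"
    using inst_derivable(1)[OF p c'] by (simp add: inst2_eq)
qed

text \<open>
  All uses of path induction in the evaluator rest on this: the motive, the endpoint case and the path
  are replaced by their values, and the expected type of the endpoint case and of the whole term
  are the values of the two instances of the motive.
\<close>

lemma J_derivable:
  assumes p: "evaluates \<Gamma> p p' (Eq A a b)"
    and c: "evaluates (Eq (shift A) (shift a) (Var 0) # A # \<Gamma>) c c' (Univ j)"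
    and Td: "conv_type \<Gamma> (subst (case_nat Refl (case_nat a Var)) c') Td"
    and e: "evaluates \<Gamma> e e' Td"
    and T: "conv_type \<Gamma> (subst (case_nat p' (case_nat b Var)) c') T"
  shows "\<Gamma> \<turnstile> J (Lam (Lam c)) e p : T"
    and "\<Gamma> \<turnstile> J (Lam (Lam c)) e p \<equiv> J (Lam (Lam c')) e' p' : T"
    and "\<Gamma> \<turnstile> J (Lam (Lam c')) e' p' : T"
    and "p' = Refl \<Longrightarrow> \<Gamma> \<turnstile> J (Lam (Lam c)) e p \<equiv> e' : T"
proof -
  let ?E = "Eq (shift A) (shift a) (Var 0)"
  let ?M = "Pi A (Pi ?E (Univ j))"
  note p' = evaluatesD[OF p] and c' = evaluatesD[OF c] and e' = evaluatesD[OF e]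
  obtain i where A: "\<Gamma> \<turnstile> A : Univ i" and a: "\<Gamma> \<turnstile> a : A" and b: "\<Gamma> \<turnstile> b : A"
    using is_type_EqD[OF p'(4)] by (auto simp: is_type_def)
  have "(A # \<Gamma>) ctx" using A by (rule ctx_extend)
  from ty_var'[OF this, of 0] have v: "A # \<Gamma> \<turnstile> Var 0 : shift A" by (simp add: ctx_type_0)
  have "A # \<Gamma> \<turnstile> shift A : Univ i" "A # \<Gamma> \<turnstile> shift a : shift A"
    using shift_derivable(1)[OF A A] shift_derivable(1)[OF A a] by simp_all
  then have E: "A # \<Gamma> \<turnstile> ?E : Univ i" using v ty_eq by blast
  have C: "\<Gamma> \<turnstile> Lam (Lam c) : ?M" and C': "\<Gamma> \<turnstile> Lam (Lam c') : ?M"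
    and CC: "\<Gamma> \<turnstile> Lam (Lam c) \<equiv> Lam (Lam c') : ?M"
    using ty_lam[OF A ty_lam[OF E c'(1)]] ty_lam[OF A ty_lam[OF E c'(3)]]
      cong_lam[OF A cong_lam[OF E c'(2)]] .
  have r: "\<Gamma> \<turnstile> Refl : Eq A a a" using ty_refl[OF a] .
  have 1: "conv_type \<Gamma> (App (App (Lam (Lam c')) a) Refl) (subst (case_nat Refl (case_nat a Var)) c')"
    and 2: "conv_type \<Gamma> (App (App (Lam (Lam c')) b) p') (subst (case_nat p' (case_nat b Var)) c')"
    using beta2[OF A a a c'(3) r] beta2[OF A a b c'(3) p'(3)]
    unfolding conv_type_def is_type_def by blast+
  have 3: "conv_type \<Gamma> (App (App (Lam (Lam c)) a) Refl) (App (App (Lam (Lam c')) a) Refl)"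
    and 4: "conv_type \<Gamma> (App (App (Lam (Lam c)) b) p) (App (App (Lam (Lam c')) b) p')"
    using J_type_eq[OF CC a eq_refl[OF r]] J_type_eq[OF CC b p'(2)] J_type[OF C' a r]
      J_type[OF C' b p'(3)]
    unfolding conv_type_def is_type_def by blast+
  note c1 = conv_typeD[OF 1] and c2 = conv_typeD[OF 2] and c3 = conv_typeD[OF 3]
    and c4 = conv_typeD[OF 4] and cd = conv_typeD[OF Td] and ct = conv_typeD[OF T]
  have d: "\<Gamma> \<turnstile> e : App (App (Lam (Lam c)) a) Refl" "\<Gamma> \<turnstile> e \<equiv> e' : App (App (Lam (Lam c)) a) Refl"
    "\<Gamma> \<turnstile> e' : App (App (Lam (Lam c')) a) Refl"
    using c3(3)[OF c1(3)[OF cd(3)[OF e'(1)]]] c3(5)[OF c1(5)[OF cd(5)[OF e'(2)]]]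
      c1(3)[OF cd(3)[OF e'(3)]] .
  show "\<Gamma> \<turnstile> J (Lam (Lam c)) e p : T"
    using ct(2)[OF c2(2)[OF c4(2)[OF ty_J[OF a b C d(1) p'(1)]]]] .
  show *: "\<Gamma> \<turnstile> J (Lam (Lam c)) e p \<equiv> J (Lam (Lam c')) e' p' : T"
    using ct(4)[OF c2(4)[OF c4(4)[OF cong_J[OF a b CC d(2) p'(2)]]]] .
  show "\<Gamma> \<turnstile> J (Lam (Lam c')) e' p' : T"
    using ct(2)[OF c2(2)[OF ty_J[OF a b C' d(3) p'(3)]]] .
  show "\<Gamma> \<turnstile> J (Lam (Lam c)) e p \<equiv> e' : T" if "p' = Refl"
  proof -
    have "b = a" using p'(6) that by (auto simp: value_shape_def)
    then have "\<Gamma> \<turnstile> J (Lam (Lam c')) e' p' \<equiv> e' : T"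
      using ct(4)[OF c2(4)] beta_J[OF a C' d(3)] that by simp
    with * show ?thesis by (rule eq_trans)
  qed
qed

declare lift.simps(2) [simp del]

text \<open>
  The substitution that an environment stands for.  Soundness is stated for the term under this
  substitution.
\<close>

fun env_sub :: "nat \<Rightarrow> entry list \<Rightarrow> nat \<Rightarrow> nat \<Rightarrow> tm" where
  "env_sub n [] d k = Var ((n - d) + k)"
| "env_sub n ((e, v, T) # es) d 0 = lift (n - e) v"
| "env_sub n (x # es) d (Suc k) = env_sub n es d k"

text \<open>Entries hold values in the part of the context in which they were computed.\<close>

definition env_ok :: "tm list \<Rightarrow> nat \<Rightarrow> entry list \<Rightarrow> nat \<Rightarrow> bool" where
  "env_ok \<Gamma> n es d \<longleftrightarrow> \<Gamma> ctx \<and> length \<Gamma> = n \<and> d \<le> n \<and>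
    (\<forall>(e, v, T) \<in> set es. e \<le> n \<and> value_of (drop (n - e) \<Gamma>) v T)"

lemma env_okD: "env_ok \<Gamma> n es d \<Longrightarrow> \<Gamma> ctx" "env_ok \<Gamma> n es d \<Longrightarrow> length \<Gamma> = n"
  by (auto simp: env_ok_def)

lemma env_sub_Suc:
  "d \<le> n \<Longrightarrow> \<forall>(e, v, T) \<in> set es. e \<le> n \<Longrightarrow> env_sub (Suc n) es d k = shift (env_sub n es d k)"
  by (induction n es d k rule: env_sub.induct) (auto simp: lift_eq_ren ren_ren Suc_diff_le)

lemma env_sub_bind:
  assumes "env_ok \<Gamma> n es d"
  shows "env_sub (Suc n) ((Suc n, Var 0, T) # es) d = up_sub (env_sub n es d)"
proof
  fix k
  show "env_sub (Suc n) ((Suc n, Var 0, T) # es) d k = up_sub (env_sub n es d) k"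
  proof (cases k)
    case (Suc j)
    have "\<forall>(e, v, T) \<in> set es. e \<le> n" "d \<le> n" using assms by (auto simp: env_ok_def)
    then show ?thesis using Suc by (simp add: env_sub_Suc)
  qed simp
qed

lemma value_neutral:
  "\<Gamma> \<turnstile> v : T \<Longrightarrow> is_type \<Gamma> T \<Longrightarrow> (\<And>b. v \<noteq> Lam b) \<Longrightarrow> (\<And>a b. v \<noteq> MkPair a b) \<Longrightarrow> v \<noteq> Refl \<Longrightarrow>
    value_of \<Gamma> v T"
  by (simp add: value_of_def value_shape_def)

lemma env_ok_bind:
  assumes "env_ok \<Gamma> n es d" "is_type \<Gamma> A"
  shows "env_ok (A # \<Gamma>) (Suc n) ((Suc n, Var 0, lift (Suc 0) A) # es) d"
proof -
  obtain i where A: "\<Gamma> \<turnstile> A : Univ i" using assms by (auto simp: is_type_def)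
  have ctx: "(A # \<Gamma>) ctx" using A by (rule ctx_extend)
  have "A # \<Gamma> \<turnstile> Var 0 : shift A" using ty_var'[OF ctx, of 0] by (simp add: ctx_type_0)
  moreover have "is_type (A # \<Gamma>) (shift A)"
    using shift_derivable(1)[OF A A] by (auto simp: is_type_def)
  ultimately have "value_of (A # \<Gamma>) (Var 0) (shift A)" by (simp add: value_neutral)
  then show ?thesis
    using assms ctx by (auto simp: env_ok_def lift_1 Suc_diff_le)
qed

lemma env_ok_beta:
  assumes "env_ok \<Gamma> n es d" "value_of \<Gamma> a A"
  shows "env_ok \<Gamma> n [(n, a, A)] n" "env_sub n [(n, a, A)] n = case_nat a Var"
proof -
  show "env_ok \<Gamma> n [(n, a, A)] n" using assms by (simp add: env_ok_def)
  show "env_sub n [(n, a, A)] n = case_nat a Var"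
  proof
    fix k show "env_sub n [(n, a, A)] n k = case_nat a Var k" by (cases k) simp_all
  qed
qed

lemma env_ok_beta2:
  assumes "env_ok \<Gamma> n es d" "value_of \<Gamma> b A" "value_of \<Gamma> p P"
  shows "env_ok \<Gamma> n [(n, p, P), (n, b, A)] n"
    "env_sub n [(n, p, P), (n, b, A)] n = case_nat p (case_nat b Var)"
proof -
  show "env_ok \<Gamma> n [(n, p, P), (n, b, A)] n" using assms by (simp add: env_ok_def)
  show "env_sub n [(n, p, P), (n, b, A)] n = case_nat p (case_nat b Var)"
  proof
    fix k show "env_sub n [(n, p, P), (n, b, A)] n k = case_nat p (case_nat b Var) k"
      by (cases k; cases "k - 1") simp_all
  qed
qed

lemma env_ok_id:
  assumes "env_ok \<Gamma> n es d"
  shows "env_ok \<Gamma> n [] n" "subst (env_sub n [] n) t = t"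
proof -
  show "env_ok \<Gamma> n [] n" using assms by (simp add: env_ok_def)
  have "env_sub n [] n = Var" by auto
  then show "subst (env_sub n [] n) t = t" by (simp add: subst_Var)
qed

definition expected :: "tm list \<Rightarrow> tm option \<Rightarrow> bool" where
  "expected \<Gamma> m \<longleftrightarrow> (\<forall>T. m = Some T \<longrightarrow> is_type \<Gamma> T)"

text \<open>
  In checking mode the expected type is assumed to be a type, and is returned unchanged.
\<close>

definition sound :: "evaluator \<Rightarrow> bool" where
  "sound r \<longleftrightarrow> (\<forall>\<Gamma> n es d m t v T. r \<Gamma> n es d m t = Some (v, T) \<longrightarrow> env_ok \<Gamma> n es d \<longrightarrow>
    expected \<Gamma> m \<longrightarrow> evaluates \<Gamma> (subst (env_sub n es d) t) v T \<and> (\<forall>T'. m = Some T' \<longrightarrow> T = T'))"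

lemma soundD:
  assumes "sound r" "r \<Gamma> n es d m t = Some (v, T)" "env_ok \<Gamma> n es d" "expected \<Gamma> m"
  shows "evaluates \<Gamma> (subst (env_sub n es d) t) v T" "m = Some T' \<Longrightarrow> T = T'"
  using assms unfolding sound_def by blast+

lemma sound_infer:
  assumes "sound r" "r \<Gamma> n es d None t = Some (v, T)" "env_ok \<Gamma> n es d"
  shows "evaluates \<Gamma> (subst (env_sub n es d) t) v T"
  using soundD(1)[OF assms] by (simp add: expected_def)

lemma sound_check:
  assumes "sound r" "r \<Gamma> n es d (Some S) t = Some (v, T)" "env_ok \<Gamma> n es d" "is_type \<Gamma> S"
  shows "evaluates \<Gamma> (subst (env_sub n es d) t) v S" "T = S"
  using soundD[OF assms(1-3)] assms(4) by (auto simp: expected_def)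

lemma expect_Some:
  "expect m v T = Some (v', T') \<longleftrightarrow> v' = v \<and> T' = T \<and> (\<forall>S. m = Some S \<longrightarrow> T = S)"
  by (cases m) (auto simp: expect_def)

lemma expect_res_Some:
  "expect_res m x = Some (v, T) \<longleftrightarrow> x = Some (v, T) \<and> (\<forall>S. m = Some S \<longrightarrow> T = S)"
  by (cases x) (auto simp: expect_res_def expect_Some)

lemma expect_at_Some:
  "expect_at m v x = Some (v', T) \<longleftrightarrow> v' = v \<and> x = Some T \<and> (\<forall>S. m = Some S \<longrightarrow> T = S)"
  by (cases x) (auto simp: expect_at_def expect_Some)

lemma type_of_res_Some: "type_of_res x = Some T \<longleftrightarrow> (\<exists>i. x = Some (T, Univ i))"
  by (cases x) (auto simp: type_of_res_def split: tm.splits)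

lemma at_type_Some: "at_type T x = Some (v, T') \<longleftrightarrow> x = Some (v, T) \<and> T' = T"
  by (cases x) (auto simp: at_type_def split: if_splits)

lemma inst_type_sound:
  assumes r: "sound r" and e: "env_ok \<Gamma> n es d" and a: "value_of \<Gamma> a A"
    and B: "is_type (A # \<Gamma>) B" and x: "inst_type r \<Gamma> n a A B = Some T"
  shows "conv_type \<Gamma> (inst B a) T"
proof (cases "direct a B")
  case False
  with x obtain i where "r \<Gamma> n [(n, a, A)] n None B = Some (T, Univ i)"
    by (auto simp: inst_type_def type_of_res_Some)
  from sound_infer[OF r this env_ok_beta(1)[OF e a]] show ?thesis
    unfolding env_ok_beta(2)[OF e a] by (rule conv_typeI)
next
  case True
  with x have T: "T = inst B a" by (simp add: inst_type_def inst_at_0)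
  obtain i where "A # \<Gamma> \<turnstile> B : Univ i" using B by (auto simp: is_type_def)
  moreover have "\<Gamma> \<turnstile> a : A" using a by (simp add: value_of_def)
  ultimately have "\<Gamma> \<turnstile> inst B a : Univ i"
    using inst_derivable(1)[of \<Gamma> a A B "Univ i"] by simp
  then show ?thesis unfolding T using conv_type_refl by (auto simp: is_type_def)
qed

lemma inst2_type_sound:
  assumes r: "sound r" and e: "env_ok \<Gamma> n es d" and bp: "value_of \<Gamma> b A" "value_of \<Gamma> p P"
    and c: "is_type \<Gamma> (subst (case_nat p (case_nat b Var)) c)"
    and x: "inst2_type r \<Gamma> n b A p P c = Some T"
  shows "conv_type \<Gamma> (subst (case_nat p (case_nat b Var)) c) T"
proof (cases "direct b c \<and> direct p c")
  case False
  with x obtain i where "r \<Gamma> n [(n, p, P), (n, b, A)] n None c = Some (T, Univ i)"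
    by (auto simp: inst2_type_def type_of_res_Some)
  from sound_infer[OF r this env_ok_beta2(1)[OF e bp]] show ?thesis
    unfolding env_ok_beta2(2)[OF e bp] by (rule conv_typeI)
next
  case True
  with x have "T = subst (case_nat p (case_nat b Var)) c"
    by (simp add: inst2_type_def inst_at_0 inst_at_1 inst2_eq)
  then show ?thesis using c conv_type_refl by blast
qed

lemma value_plain: "\<Gamma> \<turnstile> v : T \<Longrightarrow> is_type \<Gamma> T \<Longrightarrow> plain v \<Longrightarrow> value_of \<Gamma> v T"
  by (cases v) (simp_all add: value_of_def value_shape_def)

lemma revalue_sound:
  assumes r: "sound r" and e: "env_ok \<Gamma> n es d" and v: "\<Gamma> \<turnstile> v : T" and T: "is_type \<Gamma> T"
    and x: "revalue (plain v) r \<Gamma> n m v T = Some (w, S)"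
  shows "evaluates \<Gamma> v w T" "S = T" "\<forall>R. m = Some R \<longrightarrow> S = R"
proof -
  have "evaluates \<Gamma> v w T \<and> S = T \<and> (\<forall>R. m = Some R \<longrightarrow> S = R)"
  proof (cases "plain v")
    case True
    with x value_refl[OF value_plain[OF v T]] show ?thesis by (auto simp: expect_Some)
  next
    case False
    with x have x: "r \<Gamma> n [] n (Some T) v = Some (w, S)" "\<forall>R. m = Some R \<longrightarrow> S = R"
      by (auto simp: expect_res_Some)
    from sound_check[OF r x(1) env_ok_id(1)[OF e] T, unfolded env_ok_id(2)[OF e]] x(2)
    show ?thesis by blast
  qed
  then show "evaluates \<Gamma> v w T" "S = T" "\<forall>R. m = Some R \<longrightarrow> S = R" by blast+
qed

abbreviation delivers :: "tm list \<Rightarrow> nat \<Rightarrow> entry list \<Rightarrow> nat \<Rightarrow> tm option \<Rightarrow> tm \<Rightarrow> result \<Rightarrow> bool" where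
  "delivers \<Gamma> n es d m t x \<equiv> (\<forall>v T. x = Some (v, T) \<longrightarrow>
     evaluates \<Gamma> (subst (env_sub n es d) t) v T \<and> (\<forall>T'. m = Some T' \<longrightarrow> T = T'))"

lemma ctx_lookup_Some: "ctx_lookup \<Gamma> j = Some A \<longleftrightarrow> j < length \<Gamma> \<and> A = \<Gamma> ! j"
  by (induction \<Gamma> j rule: ctx_lookup.induct) auto

lemma ren_ok_drop:
  assumes "\<Gamma> ctx"
  shows "ren_ok (drop m \<Gamma>) (\<lambda>k. m + k) \<Gamma>"
  using assms by (auto simp: ren_ok_def ctx_type_def ren_ren ac_simps)

lemma value_shape_ren:
  assumes v: "value_shape \<Delta> v T" and T: "is_type \<Delta> T" and r: "ren_ok \<Delta> r \<Gamma>"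
  shows "value_shape \<Gamma> (ren r v) (ren r T)"
proof (cases v)
  case (Lam b)
  with v obtain A B where *: "T = Pi A B" "A # \<Delta> \<turnstile> b : B" by (auto simp: value_shape_def)
  obtain i where "\<Delta> \<turnstile> A : Univ i" using is_type_PiD T *(1) unfolding is_type_def by blast
  from ren_ok_up[OF r ren_derivable(1)[OF this r, simplified]] *(2)
  have "ren r A # \<Gamma> \<turnstile> ren (up_ren r) b : ren (up_ren r) B" by (rule ren_derivable(1)[rotated])
  with * Lam show ?thesis by (simp add: value_shape_def)
next
  case (MkPair a b)
  with v obtain A B where *: "T = Sig A B" "\<Delta> \<turnstile> a : A" "\<Delta> \<turnstile> b : inst B a"
    by (auto simp: value_shape_def)
  then have "\<Gamma> \<turnstile> ren r a : ren r A" "\<Gamma> \<turnstile> ren r b : ren r (inst B a)"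
    using ren_derivable(1) r by blast+
  with * MkPair show ?thesis by (simp add: value_shape_def ren_inst)
qed (use v in \<open>auto simp: value_shape_def\<close>)

text \<open>
  Values are stable under weakening, so an environment remains correct under binders.
\<close>

lemma value_of_ren:
  assumes "value_of \<Delta> v T" "ren_ok \<Delta> r \<Gamma>"
  shows "value_of \<Gamma> (ren r v) (ren r T)"
proof -
  have v: "\<Delta> \<turnstile> v : T" "is_type \<Delta> T" "value_shape \<Delta> v T"
    using assms(1) by (simp_all add: value_of_def)
  then obtain i where "\<Delta> \<turnstile> T : Univ i" by (auto simp: is_type_def)
  from ren_derivable(1)[OF this assms(2)] have "is_type \<Gamma> (ren r T)"
    by (auto simp: is_type_def)
  then show ?thesis
    using ren_derivable(1)[OF v(1) assms(2)] value_shape_ren[OF v(3,2) assms(2)]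
    by (simp add: value_of_def)
qed

lemma eval_var_sound:
  assumes e: "env_ok \<Gamma> n es d"
  shows "delivers \<Gamma> n es d m (Var k) (eval_var \<Gamma> n es d m k)"
  using e
proof (induction \<Gamma> n es d m k rule: eval_var.induct)
  case (1 \<Gamma> n d m k)
  show ?case
  proof (intro allI impI)
    fix v T
    assume a: "eval_var \<Gamma> n [] d m k = Some (v, T)"
    let ?j = "(n - d) + k"
    from a obtain A where A: "ctx_lookup \<Gamma> ?j = Some A"
      by (cases "ctx_lookup \<Gamma> ?j") auto
    with a have x: "v = Var ?j" "T = lift (Suc ?j) A" "\<forall>T'. m = Some T' \<longrightarrow> T = T'"
      by (auto simp: expect_Some)
    from A have j: "?j < length \<Gamma>" "A = \<Gamma> ! ?j" by (simp_all add: ctx_lookup_Some)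
    have T: "T = ctx_type \<Gamma> ?j" by (simp add: x(2) ctx_type_def lift_eq_ren j(2) ac_simps)
    have "\<Gamma> ctx" using 1 by (rule env_okD)
    with j ty_var' ctx_type_derivable T have "value_of \<Gamma> (Var ?j) T"
      by (intro value_neutral) (simp_all add: is_type_def)
    with x show "evaluates \<Gamma> (subst (env_sub n [] d) (Var k)) v T \<and> (\<forall>T'. m = Some T' \<longrightarrow> T = T')"
      using value_refl by simp
  qed
next
  case (2 \<Gamma> n e v T es d m)
  have "value_of \<Gamma> (ren (\<lambda>k. (n - e) + k) v) (ren (\<lambda>k. (n - e) + k) T)"
    using 2 by (intro value_of_ren[OF _ ren_ok_drop]) (auto simp: env_ok_def)
  then show ?case using value_refl by (simp add: expect_Some lift_eq_ren)
next
  case (3 \<Gamma> n x es d m k)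
  from 3(2) have "env_ok \<Gamma> n es d" by (auto simp: env_ok_def)
  from 3(1)[OF this] show ?case by (simp only: eval_var.simps subst.simps env_sub.simps)
qed

lemma binder_env:
  assumes "env_ok \<Gamma> n es d" "is_type \<Gamma> A"
  shows "env_ok (A # \<Gamma>) (Suc n) ((Suc n, Var 0, lift (Suc 0) A) # es) d"
    "env_sub (Suc n) ((Suc n, Var 0, lift (Suc 0) A) # es) d = up_sub (env_sub n es d)"
  using env_ok_bind[OF assms] env_sub_bind[OF assms(1)] by blast+

lemma former1_sound:
  assumes r: "sound r" and e: "env_ok \<Gamma> n es d"
    and F: "F = Pi \<or> F = Sig"
  shows "delivers \<Gamma> n es d m (F A B) (former1 F r \<Gamma> n es d m B (r \<Gamma> n es d None A))"
proof (intro allI impI)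
  fix v T
  assume "former1 F r \<Gamma> n es d m B (r \<Gamma> n es d None A) = Some (v, T)"
  then obtain A' B' i j where
    A: "r \<Gamma> n es d None A = Some (A', Univ i)"
    and B: "r (A' # \<Gamma>) (Suc n) ((Suc n, Var 0, lift (Suc 0) A') # es) d None B = Some (B', Univ j)"
    and v: "v = F A' B'" "T = Univ (max i j)" "\<forall>S. m = Some S \<longrightarrow> T = S"
    by (auto simp: former1_def former2_def expect_Some split: option.splits prod.splits tm.splits)
  note A = sound_infer[OF r A e]
  then have "is_type \<Gamma> A'" by (auto simp: is_type_def dest: evaluatesD)
  note env = binder_env[OF e this]
  note B = sound_infer[OF r B env(1), unfolded env(2)]
  show "evaluates \<Gamma> (subst (env_sub n es d) (F A B)) v T \<and> (\<forall>T'. m = Some T' \<longrightarrow> T = T')"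
    using F evaluates_Pi[OF A B] evaluates_Sig[OF A B] v by auto
qed

lemma lam1_sound:
  assumes r: "sound r" and e: "env_ok \<Gamma> n es d" and A: "is_type \<Gamma> A"
    and m: "expected (A # \<Gamma>) m"
    and x: "lam1 r \<Gamma> n es d m b A = Some (v, T)"
  shows "\<exists>B. T = Pi A B \<and> evaluates \<Gamma> (subst (env_sub n es d) (Lam b)) v T \<and>
    (\<forall>B'. m = Some B' \<longrightarrow> B = B') \<and>
    value_shape \<Gamma> (subst (env_sub n es d) (Lam b)) T"
proof -
  from x obtain b' B
    where b: "r (A # \<Gamma>) (Suc n) ((Suc n, Var 0, lift (Suc 0) A) # es) d m b = Some (b', B)"
    and x: "eta_lam r \<Gamma> n b' (Pi A B) (eta_contractum b') = Some (v, T)"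
    by (auto simp: lam1_def lam2_def split: option.splits prod.splits)
  note env = binder_env[OF e A]
  note b = soundD[OF r b env(1) m, unfolded env(2)]
  have l: "evaluates \<Gamma> (subst (env_sub n es d) (Lam b)) (Lam b') (Pi A B)"
    using evaluates_Lam[OF A b(1)] by simp
  have "evaluates \<Gamma> (subst (env_sub n es d) (Lam b)) v (Pi A B) \<and> T = Pi A B"
  proof (cases "eta_contractum b'")
    case None
    then show ?thesis using x l by auto
  next
    case (Some f)
    with x have f: "r \<Gamma> n [] n None f = Some (v, Pi A B)" and T: "T = Pi A B"
      by (auto simp: at_type_Some)
    have "evaluates \<Gamma> f v (Pi A B)"
      using sound_infer[OF r f env_ok_id(1)[OF e]] env_ok_id(2)[OF e] by simp
    moreover have "b' = App (shift f) (Var 0)" using Some by (rule eta_contractum_Some)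
    ultimately show ?thesis using evaluates_eta_lam l T by blast
  qed
  then show ?thesis using b evaluatesD(1)[OF b(1)] by (simp add: value_shape_def)
qed

lemma lam0_sound:
  assumes r: "sound r" and e: "env_ok \<Gamma> n es d" and m: "expected \<Gamma> m"
  shows "delivers \<Gamma> n es d m (Lam b) (lam0 r \<Gamma> n es d m b)"
proof (intro allI impI)
  fix v T
  assume x: "lam0 r \<Gamma> n es d m b = Some (v, T)"
  show "evaluates \<Gamma> (subst (env_sub n es d) (Lam b)) v T \<and> (\<forall>T'. m = Some T' \<longrightarrow> T = T')"
  proof (cases m)
    case None
    with x obtain f f' A B where f: "r \<Gamma> n es d None f = Some (f', Pi A B)"
      and y: "lam1 r \<Gamma> n es d None b A = Some (v, T)"
      by (cases "innermost_fn b") (auto simp: lam0_def lam_guess2_def split: option.splits prod.splits tm.splits)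
    have "is_type \<Gamma> A" using is_type_PiD evaluatesD(4)[OF sound_infer[OF r f e]] by blast
    from lam1_sound[OF r e this _ y] None show ?thesis by (auto simp: expected_def)
  next
    case (Some S)
    with x obtain A B where S: "S = Pi A B" and y: "lam1 r \<Gamma> n es d (Some B) b A = Some (v, T)"
      by (auto simp: lam0_def split: tm.splits)
    have "is_type \<Gamma> (Pi A B)" using m Some S by (simp add: expected_def)
    then have A: "is_type \<Gamma> A" and "expected (A # \<Gamma>) (Some B)"
      using is_type_PiD by (auto simp: expected_def)
    from lam1_sound[OF r e this y] Some S show ?thesis by auto
  qed
qed

lemma app_val_sound:
  assumes r: "sound r" and e: "env_ok \<Gamma> n es d"
    and f: "evaluates \<Gamma> f f' (Pi A B)" and a: "evaluates \<Gamma> a a' A"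
    and T: "conv_type \<Gamma> (inst B a') T"
    and x: "app_val r \<Gamma> n a' A T m f' = Some (v, S)"
  shows "evaluates \<Gamma> (App f a) v T" "S = T" "\<forall>S. m = Some S \<longrightarrow> T = S"
proof -
  have "evaluates \<Gamma> (App f a) v T \<and> S = T \<and> (\<forall>S. m = Some S \<longrightarrow> T = S)"
  proof (cases "\<exists>b. f' = Lam b")
    case True
    then obtain b where b: "f' = Lam b" by blast
    with x have x: "r \<Gamma> n [(n, a', A)] n (Some T) b = Some (v, S)" "\<forall>T. m = Some T \<longrightarrow> S = T"
      by (auto simp: expect_res_Some)
    note env = env_ok_beta[OF e evaluatesD(5)[OF a]]
    note s = sound_check[OF r x(1) env(1) conv_typeD(1)[OF T], unfolded env(2)]
    from evaluates_app_beta[OF f[unfolded b] a T s(1)] s(2) x(2) show ?thesis by simp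
  next
    case False
    with x have *: "v = App f' a'" "S = T" "\<forall>S. m = Some S \<longrightarrow> T = S"
      by (cases f'; simp add: expect_Some)+
    then show ?thesis
      using evaluates_neutral[OF app_derivable[OF f a T] conv_typeD(1)[OF T]] by simp
  qed
  then show "evaluates \<Gamma> (App f a) v T" "S = T" "\<forall>S. m = Some S \<longrightarrow> T = S" by blast+
qed

lemma app_sound:
  assumes r: "sound r" and e: "env_ok \<Gamma> n es d" and m: "expected \<Gamma> m"
  shows "delivers \<Gamma> n es d m (App f a) (app0 h r \<Gamma> n es d m f a)"
proof (intro allI impI)
  fix v T
  let ?s = "subst (env_sub n es d)"
  assume x: "app0 h r \<Gamma> n es d m f a = Some (v, T)"
  show "evaluates \<Gamma> (?s (App f a)) v T \<and> (\<forall>T'. m = Some T' \<longrightarrow> T = T')"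
  proof (cases h)
    case False
    with x obtain f' A B a' A' T' where f: "r \<Gamma> n es d None f = Some (f', Pi A B)"
      and a: "r \<Gamma> n es d (Some A) a = Some (a', A')"
      and T: "inst_type r \<Gamma> n a' A' B = Some T'"
      and y: "app_val r \<Gamma> n a' A' T' m f' = Some (v, T)"
      by (auto simp: app1_def app2_def app3_def split: option.splits prod.splits tm.splits)
    note f = sound_infer[OF r f e]
    have "is_type \<Gamma> A" using is_type_PiD evaluatesD(4)[OF f] by blast
    note a = sound_check[OF r a e this]
    note T = inst_type_sound[OF r e evaluatesD(5)[OF a(1)] _ T[unfolded a(2)]]
    have "is_type (A # \<Gamma>) B" using is_type_PiD evaluatesD(4)[OF f] by blast
    note T = T[OF this]
    from app_val_sound[OF r e f a(1) T y[unfolded a(2)]] show ?thesis by simp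
  next
    case h: True
    show ?thesis
    proof (cases m)
      case None
      with x h obtain a' A0 A c f' B T' where a: "r \<Gamma> n es d None a = Some (a', A0)" and fc: "f = Lam c"
        and f: "lam1 r \<Gamma> n es d None c A0 = Some (f', Pi A B)"
        and T: "inst_type r \<Gamma> n a' A B = Some T'"
        and y: "app_val r \<Gamma> n a' A T' None f' = Some (v, T)"
        by (auto simp: redex_infer1_def redex_infer2_def app3_def split: option.splits prod.splits tm.splits)
      note a = sound_infer[OF r a e]
      have "evaluates \<Gamma> (?s f) f' (Pi A B) \<and> A0 = A"
        using lam1_sound[OF r e evaluatesD(4)[OF a] _ f] fc by (auto simp: expected_def)
      then have f: "evaluates \<Gamma> (?s f) f' (Pi A B)" and A: "A0 = A" by blast+
      have "is_type (A # \<Gamma>) B" using is_type_PiD evaluatesD(4)[OF f] by blast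
      note T = inst_type_sound[OF r e evaluatesD(5)[OF a[unfolded A]] this T]
      from app_val_sound[OF r e f a[unfolded A] T y] None show ?thesis by simp
    next
      case m': (Some S)
      with x h obtain a' A f' F where a: "r \<Gamma> n es d None a = Some (a', A)"
        and f: "r \<Gamma> n es d (Some (Pi A (lift (Suc 0) S))) f = Some (f', F)"
        and y: "app_val r \<Gamma> n a' A S (Some S) f' = Some (v, T)"
        by (auto simp: redex1_def redex2_def split: option.splits prod.splits)
    note a = sound_infer[OF r a e]
    have S: "is_type \<Gamma> S" using m m' by (simp add: expected_def)
    obtain i j where ij: "\<Gamma> \<turnstile> A : Univ i" "\<Gamma> \<turnstile> S : Univ j"
      using evaluatesD(4)[OF a] S by (auto simp: is_type_def)
    have "is_type (A # \<Gamma>) (shift S)"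
      using shift_derivable(1)[OF ij] by (auto simp: is_type_def)
    then have P: "is_type \<Gamma> (Pi A (lift (Suc 0) S))"
      using is_type_Pi[OF ij(1)] by (simp add: lift_1)
    note f = sound_check[OF r f e P, unfolded lift_1]
    have "conv_type \<Gamma> (inst (shift S) a') S"
      using conv_type_refl[OF S] by (simp add: inst_shift)
    from app_val_sound[OF r e f(1) a this y] m' show ?thesis by simp
    qed
  qed
qed

lemma pair1_sound:
  assumes r: "sound r" and e: "env_ok \<Gamma> n es d" and m: "expected \<Gamma> m"
  shows "delivers \<Gamma> n es d m (MkPair a b) (pair1 r \<Gamma> n es d m a b)"
proof (intro allI impI)
  fix v T
  let ?s = "subst (env_sub n es d)"
  assume "pair1 r \<Gamma> n es d m a b = Some (v, T)"
  then obtain A B a' A' T' b' B' where m': "m = Some (Sig A B)"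
    and a: "r \<Gamma> n es d (Some A) a = Some (a', A')"
    and T: "inst_type r \<Gamma> n a' A' B = Some T'"
    and b: "r \<Gamma> n es d (Some T') b = Some (b', B')"
    and x: "contract_pair r \<Gamma> n a' b' (Sig A' B) (Fst_arg a') = Some (v, T)"
    by (auto simp: pair1_def pair2_def pair3_def pair4_def split: option.splits prod.splits tm.splits)
  have S: "is_type \<Gamma> (Sig A B)" using m m' by (simp add: expected_def)
  then have "is_type \<Gamma> A" and B: "is_type (A # \<Gamma>) B" using is_type_SigD by blast+
  note a = sound_check[OF r a e this(1)]
  note T = inst_type_sound[OF r e evaluatesD(5)[OF a(1)] B T[unfolded a(2)]]
  note b = sound_check[OF r b e conv_typeD(1)[OF T]]
  note p = pair_derivable[OF S a(1) T b(1)]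
  have "evaluates \<Gamma> (?s (MkPair a b)) v (Sig A B) \<and> T = Sig A B"
  proof (cases "\<exists>p. a' = Fst p \<and> b' = Snd p")
    case True
    then obtain q where q: "a' = Fst q" "b' = Snd q" by blast
    with x a(2) have f: "r \<Gamma> n [] n None q = Some (v, Sig A B)" and T: "T = Sig A B"
      by (auto simp: at_type_Some)
    have "evaluates \<Gamma> q v (Sig A B)"
      using sound_infer[OF r f env_ok_id(1)[OF e]] env_ok_id(2)[OF e] by simp
    from evaluates_eta_pair[OF _ this] p q T show ?thesis by simp
  next
    case False
    then have "v = MkPair a' b'" "T = Sig A B"
      using x a(2) by (cases "Fst_arg a'"; cases "is_Snd_of (the (Fst_arg a')) b'";
        auto simp: Fst_arg_Some is_Snd_of_iff)+
    then show ?thesis using p by simp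
  qed
  then show "evaluates \<Gamma> (?s (MkPair a b)) v T \<and> (\<forall>T'. m = Some T' \<longrightarrow> T = T')"
    using m' by simp
qed

lemma fst1_sound:
  assumes r: "sound r" and e: "env_ok \<Gamma> n es d"
  shows "delivers \<Gamma> n es d m (Fst p) (fst1 r \<Gamma> n m (r \<Gamma> n es d None p))"
proof (intro allI impI)
  fix v T
  let ?s = "subst (env_sub n es d)"
  assume "fst1 r \<Gamma> n m (r \<Gamma> n es d None p) = Some (v, T)"
  then obtain p' A B where p: "r \<Gamma> n es d None p = Some (p', Sig A B)"
    and x: "fst_val r \<Gamma> n m A p' = Some (v, T)"
    by (auto simp: fst1_def split: option.splits prod.splits tm.splits)
  note p = sound_infer[OF r p e]
  note f = fst_derivable[OF p]
  show "evaluates \<Gamma> (?s (Fst p)) v T \<and> (\<forall>T'. m = Some T' \<longrightarrow> T = T')"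
  proof (cases "\<exists>a b. p' = MkPair a b")
    case True
    then obtain a b where p': "p' = MkPair a b" by blast
    with x have x: "revalue (plain a) r \<Gamma> n m a A = Some (v, T)" by simp
    have "\<Gamma> \<turnstile> a : A" using evaluatesD(6)[OF p] p' by (auto simp: value_shape_def)
    note a = revalue_sound[OF r e this f(4) x]
    from evaluates_cong[OF f(1) fst_pair_derivable(1)[OF p[unfolded p']] a(1)] a(2,3)
    show ?thesis by simp
  next
    case False
    with x have "v = Fst p'" "T = A" "\<forall>S. m = Some S \<longrightarrow> T = S"
      by (cases p'; simp add: expect_Some)+
    with evaluates_neutral[OF f] show ?thesis by simp
  qed
qed

lemma is_value_sound:
  assumes r: "sound r" and e: "env_ok \<Gamma> n es d" and v: "\<Gamma> \<turnstile> v : T" and T: "is_type \<Gamma> T"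
    and x: "is_value r \<Gamma> n v T"
  shows "value_of \<Gamma> v T"
proof (cases "plain v")
  case True
  then show ?thesis using v T value_plain by blast
next
  case False
  with x obtain S where "r \<Gamma> n [] n (Some T) v = Some (v, S)"
    by (auto simp: is_value_def is_result_def split: option.splits)
  from sound_check(1)[OF r this env_ok_id(1)[OF e] T] show ?thesis by (rule evaluatesD)
qed

lemma snd1_sound:
  assumes r: "sound r" and e: "env_ok \<Gamma> n es d"
  shows "delivers \<Gamma> n es d m (Snd p) (snd1 r \<Gamma> n m (r \<Gamma> n es d None p))"
proof (intro allI impI)
  fix v T
  let ?s = "subst (env_sub n es d)"
  assume "snd1 r \<Gamma> n m (r \<Gamma> n es d None p) = Some (v, T)"
  then obtain p' A B where p: "r \<Gamma> n es d None p = Some (p', Sig A B)"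
    and x: "snd_val r \<Gamma> n m A B p' = Some (v, T)"
    by (auto simp: snd1_def split: option.splits prod.splits tm.splits)
  note p = sound_infer[OF r p e]
  note f = fst_derivable[OF p]
  have B: "is_type (A # \<Gamma>) B" using is_type_SigD evaluatesD(4)[OF p] by blast
  show "evaluates \<Gamma> (?s (Snd p)) v T \<and> (\<forall>T'. m = Some T' \<longrightarrow> T = T')"
  proof (cases "\<exists>a b. p' = MkPair a b")
    case True
    then obtain a b where p': "p' = MkPair a b" by blast
    with x obtain S where va: "is_value r \<Gamma> n a A" and S: "inst_type r \<Gamma> n a A B = Some S"
      and x: "revalue (plain b) r \<Gamma> n m b S = Some (v, T)"
      by (auto simp: snd_pair_def split: option.splits if_splits)
    have ab: "\<Gamma> \<turnstile> a : A" "\<Gamma> \<turnstile> b : inst B a"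
      using evaluatesD(6)[OF p] p' by (auto simp: value_shape_def)
    note S = inst_type_sound[OF r e is_value_sound[OF r e ab(1) f(4) va] B S]
    note b = revalue_sound[OF r e conv_typeD(2)[OF S ab(2)] conv_typeD(1)[OF S] x]
    note s = snd_pair_derivable[OF p[unfolded p'] S]
    from evaluates_cong[OF s b(1)] b(2,3) show ?thesis by simp
  next
    case False
    with x obtain S where S: "inst_type r \<Gamma> n (Fst p') A B = Some S"
      and x: "v = Snd p'" "T = S" "\<forall>S. m = Some S \<longrightarrow> T = S"
      by (cases p'; auto simp add: expect_at_Some)+
    have "value_of \<Gamma> (Fst p') A" using value_neutral f(3,4) by simp
    note S = inst_type_sound[OF r e this B S]
    from evaluates_neutral[OF snd_derivable[OF p S] conv_typeD(1)[OF S]] x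
    show ?thesis by simp
  qed
qed

lemma eq1_sound:
  assumes r: "sound r" and e: "env_ok \<Gamma> n es d"
  shows "delivers \<Gamma> n es d m (Eq A a b) (eq1 r \<Gamma> n es d m a b (r \<Gamma> n es d None A))"
proof (intro allI impI)
  fix v T
  assume "eq1 r \<Gamma> n es d m a b (r \<Gamma> n es d None A) = Some (v, T)"
  then obtain A' i a' b' S S' where A: "r \<Gamma> n es d None A = Some (A', Univ i)"
    and a: "r \<Gamma> n es d (Some A') a = Some (a', S)" and b: "r \<Gamma> n es d (Some A') b = Some (b', S')"
    and v: "v = Eq A' a' b'" "T = Univ i" "\<forall>S. m = Some S \<longrightarrow> T = S"
    by (auto simp: eq1_def eq2_def expect_Some split: option.splits prod.splits tm.splits)
  note A = sound_infer[OF r A e]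
  then have "is_type \<Gamma> A'" by (auto simp: is_type_def dest: evaluatesD)
  note a = sound_check(1)[OF r a e this] and b = sound_check(1)[OF r b e this]
  show "evaluates \<Gamma> (subst (env_sub n es d) (Eq A a b)) v T \<and> (\<forall>T'. m = Some T' \<longrightarrow> T = T')"
    using evaluates_Eq[OF A a b] v by simp
qed

lemma refl_val_sound:
  assumes m: "expected \<Gamma> m"
  shows "delivers \<Gamma> n es d m Refl (refl_val m)"
  using m evaluates_Refl by (auto simp: refl_val_def expected_def split: option.splits tm.splits if_splits)

lemma J0_sound:
  assumes r: "sound r" and e: "env_ok \<Gamma> n es d"
  shows "delivers \<Gamma> n es d m (J C t p) (J0 r \<Gamma> n es d m C t p)"
proof (intro allI impI)
  fix v T
  let ?s = "subst (env_sub n es d)"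
  assume "J0 r \<Gamma> n es d m C t p = Some (v, T)"
  then obtain c p' A a b where C: "C = Lam (Lam c)"
    and p: "r \<Gamma> n es d None p = Some (p', Eq A a b)"
    and x: "J1 r \<Gamma> n es d m c t (Some (p', Eq A a b)) = Some (v, T)"
    by (auto simp: J0_def J1_def split: option.splits prod.splits tm.splits)
  define E where "E = Eq (shift A) (shift a) (Var 0)"
  from x obtain c' j Td t' S where vals: "is_value r \<Gamma> n a A" "is_value r \<Gamma> n b A"
    and c: "r (E # A # \<Gamma>) (Suc (Suc n)) ((Suc (Suc n), Var 0, lift (Suc 0) E) #
           (Suc n, Var 0, lift (Suc 0) A) # es) d None c = Some (c', Univ j)"
    and Td: "inst2_type r \<Gamma> n a A Refl (Eq A a a) c' = Some Td"
    and t: "r \<Gamma> n es d (Some Td) t = Some (t', S)"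
    and y: "J_val r \<Gamma> n m c' A b (Eq A a b) t' S p' = Some (v, T)"
    by (auto simp: J1_def J2_def J3_def J4_def E_def lift_1 split: option.splits prod.splits tm.splits if_splits)
  note p = sound_infer[OF r p e]
  have A: "is_type \<Gamma> A" and ab: "\<Gamma> \<turnstile> a : A" "\<Gamma> \<turnstile> b : A"
    using is_type_EqD[OF evaluatesD(4)[OF p]] by blast+
  note a = is_value_sound[OF r e ab(1) A vals(1)] and b = is_value_sound[OF r e ab(2) A vals(2)]
  note e1 = binder_env[OF e A]
  obtain i where i: "\<Gamma> \<turnstile> A : Univ i" using A by (auto simp: is_type_def)
  have "A # \<Gamma> \<turnstile> Var 0 : shift A"
    using ty_var'[OF env_okD(1)[OF e1(1)], of 0] by (simp add: ctx_type_0)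
  then have "A # \<Gamma> \<turnstile> E : Univ i"
    unfolding E_def using ty_eq shift_derivable(1)[OF i ab(1)] shift_derivable(1)[OF i i] by simp
  then have E: "is_type (A # \<Gamma>) E" by (auto simp: is_type_def)
  note e2 = binder_env[OF e1(1) E]
  note c = sound_infer[OF r c e2(1), unfolded e2(2) e1(2)]
  have ra: "is_type \<Gamma> (Eq A a a)" using ty_eq[OF i ab(1) ab(1)] by (auto simp: is_type_def)
  have "is_type \<Gamma> (subst (case_nat Refl (case_nat a Var)) c')"
    using beta2(2)[OF i ab(1) ab(1) evaluatesD(3)[OF c[unfolded E_def]] ty_refl[OF ab(1)]]
    by (auto simp: is_type_def)
  note Td = inst2_type_sound[OF r e a evaluatesD(5)[OF evaluates_Refl[OF ra]] this Td]
  note t = sound_check[OF r t e conv_typeD(1)[OF Td]]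
  note J = J_derivable[OF p c[unfolded E_def] Td t(1)]
  show "evaluates \<Gamma> (?s (J C t p)) v T \<and> (\<forall>T'. m = Some T' \<longrightarrow> T = T')"
  proof (cases "p' = Refl")
    case True
    with y t(2) have v: "v = t'" "T = Td" "\<forall>S. m = Some S \<longrightarrow> T = S" by (auto simp: expect_Some)
    have "b = a" using evaluatesD(6)[OF p] True by (auto simp: value_shape_def)
    then have T: "conv_type \<Gamma> (subst (case_nat p' (case_nat b Var)) c') Td" using Td True by simp
    have "evaluates \<Gamma> t' t' Td" using value_refl evaluatesD(5)[OF t(1)] by blast
    from evaluates_cong[OF J(1)[OF T] J(4)[OF T True] this] show ?thesis using v C by simp
  next
    case False
    with y obtain S' where S: "inst2_type r \<Gamma> n b A p' (Eq A a b) c' = Some S'"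
      and v: "v = J (Lam (Lam c')) t' p'" "T = S'" "\<forall>S. m = Some S \<longrightarrow> T = S"
      by (cases p'; auto simp: expect_at_Some)+
    have "is_type \<Gamma> (subst (case_nat p' (case_nat b Var)) c')"
      using beta2(2)[OF i ab(1) ab(2) evaluatesD(3)[OF c[unfolded E_def]] evaluatesD(3)[OF p]]
      by (auto simp: is_type_def)
    note T = inst2_type_sound[OF r e b evaluatesD(5)[OF p] this S]
    from evaluates_neutral[OF J(1-3)[OF T] conv_typeD(1)[OF T]] show ?thesis using v C by simp
  qed
qed

lemma step_sound:
  assumes r: "sound r"
  shows "sound (step r)"
  unfolding sound_def
proof (intro allI impI)
  fix \<Gamma> n es d m t v T
  assume x: "step r \<Gamma> n es d m t = Some (v, T)" and e: "env_ok \<Gamma> n es d" and m: "expected \<Gamma> m"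
  have "delivers \<Gamma> n es d m t (step r \<Gamma> n es d m t)"
  proof (cases t)
    case (Var k)
    then show ?thesis using eval_var_sound[OF e] by (simp only: step.simps)
  next
    case (Univ i)
    then show ?thesis using evaluates_Univ[OF env_okD(1)[OF e]] by (auto simp: expect_Some)
  next
    case (Pi A B)
    then show ?thesis using former1_sound[OF r e disjI1[OF HOL.refl]] by (simp only: step.simps)
  next
    case (Sig A B)
    then show ?thesis using former1_sound[OF r e disjI2[OF HOL.refl]] by (simp only: step.simps)
  next
    case (Lam b)
    then show ?thesis using lam0_sound[OF r e m] by (simp only: step.simps)
  next
    case (App f a)
    then show ?thesis using app_sound[OF r e m] by (simp only: step.simps)
  next
    case (MkPair a b)
    then show ?thesis using pair1_sound[OF r e m] by (simp only: step.simps)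
  next
    case (Fst p)
    then show ?thesis using fst1_sound[OF r e] by (simp only: step.simps)
  next
    case (Snd p)
    then show ?thesis using snd1_sound[OF r e] by (simp only: step.simps)
  next
    case (Eq A a b)
    then show ?thesis using eq1_sound[OF r e] by (simp only: step.simps)
  next
    case Refl
    then show ?thesis using refl_val_sound[OF m] by (simp only: step.simps)
  next
    case (J C c p)
    then show ?thesis using J0_sound[OF r e] by (simp only: step.simps)
  qed simp_all
  with x show "evaluates \<Gamma> (subst (env_sub n es d) t) v T \<and> (\<forall>T'. m = Some T' \<longrightarrow> T = T')"
    by blast
qed

text \<open>
  Soundness is preserved when the recursive calls are made to a sound evaluator, hence holds for every
  bound on the recursion.
\<close>

theorem nf_sound: "sound (nf k)"
proof (induction k)
  case 0
  then show ?case by (simp add: sound_def)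
next
  case (Suc k)
  have "nf (Suc k) = step (nf k)" by (intro ext) simp
  with step_sound[OF Suc] show ?case by (simp only:)
qed

section \<open>From evaluation to derivability\<close>

lemma derivable_closed:
  "\<Gamma> ctx \<Longrightarrow> True"
  "\<Gamma> \<turnstile> t : A \<Longrightarrow> closed_at (length \<Gamma>) t"
  "\<Gamma> \<turnstile> t \<equiv> u : A \<Longrightarrow> True"
  by (induction rule: wf_ctx_has_type_def_eq.inducts) auto

lemma is_type_closed: "is_type [] T \<Longrightarrow> closed_at 0 T"
  unfolding is_type_def using derivable_closed(2)[of "[]"] by fastforce

text \<open>Large enough for all computations below.\<close>

definition fuel :: nat where "fuel = 300"

lemma fuel_Suc: "\<exists>k. nf fuel \<Gamma> n es d m t = step (nf k) \<Gamma> n es d m t"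
  by (rule exI[of _ 299]) (simp add: fuel_def eval_nat_numeral)

definition has_nf :: "tm list \<Rightarrow> nat \<Rightarrow> entry list \<Rightarrow> nat \<Rightarrow> tm \<Rightarrow> tm \<Rightarrow> bool" where
  "has_nf \<Gamma> n es d T V \<longleftrightarrow> (\<exists>i. nf fuel \<Gamma> n es d None T = Some (V, Univ i))"

definition checks :: "tm list \<Rightarrow> nat \<Rightarrow> entry list \<Rightarrow> nat \<Rightarrow> tm \<Rightarrow> tm \<Rightarrow> tm \<Rightarrow> bool" where
  "checks \<Gamma> n es d t v V \<longleftrightarrow> nf fuel \<Gamma> n es d (Some V) t = Some (v, V)"

lemma has_nf_sound:
  assumes "has_nf \<Gamma> n es d T V" "env_ok \<Gamma> n es d"
  shows "\<exists>i. \<Gamma> \<turnstile> subst (env_sub n es d) T \<equiv> V : Univ i" "conv_type \<Gamma> (subst (env_sub n es d) T) V"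
    "is_type \<Gamma> V" "is_type \<Gamma> (subst (env_sub n es d) T)"
proof -
  obtain i where "nf fuel \<Gamma> n es d None T = Some (V, Univ i)" using assms(1) by (auto simp: has_nf_def)
  from sound_infer[OF nf_sound this assms(2)]
  have e: "evaluates \<Gamma> (subst (env_sub n es d) T) V (Univ i)" .
  show "\<exists>i. \<Gamma> \<turnstile> subst (env_sub n es d) T \<equiv> V : Univ i" "conv_type \<Gamma> (subst (env_sub n es d) T) V"
    "is_type \<Gamma> V" "is_type \<Gamma> (subst (env_sub n es d) T)"
    using evaluatesD[OF e] conv_typeI[OF e] unfolding is_type_def by blast+
qed

lemma checks_sound:
  assumes "checks \<Gamma> n es d t v V" "env_ok \<Gamma> n es d" "is_type \<Gamma> V"
  shows "evaluates \<Gamma> (subst (env_sub n es d) t) v V"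
  using sound_check(1)[OF nf_sound _ assms(2,3)] assms(1) unfolding checks_def by blast

fun canonical_source :: "tm \<Rightarrow> bool" where
  "canonical_source (Var k) = False"
| "canonical_source Refl = False"
| "canonical_source t = True"

text \<open>
  A definition is bound to its source rather than to its normal form: unfolding the source on demand
  is cheaper, and the shape condition for it follows from the fact that its evaluation succeeds.
\<close>

lemma checks_source_value:
  assumes c: "checks \<Gamma> n es d t v V" and e: "env_ok \<Gamma> n es d" and V: "is_type \<Gamma> V"
    and t: "canonical_source t"
  shows "value_of \<Gamma> (subst (env_sub n es d) t) V"
proof -
  let ?s = "subst (env_sub n es d)"
  obtain k where k: "step (nf k) \<Gamma> n es d (Some V) t = Some (v, V)"
    using c fuel_Suc unfolding checks_def by metis
  have ty: "\<Gamma> \<turnstile> ?s t : V" using checks_sound[OF c e V] by (rule evaluatesD)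
  have "value_shape \<Gamma> (?s t) V"
  proof (cases t)
    case (Lam b)
    with k obtain A B where S: "V = Pi A B" and y: "lam1 (nf k) \<Gamma> n es d (Some B) b A = Some (v, V)"
      by (auto simp: lam0_def split: tm.splits)
    have A: "is_type \<Gamma> A" and "expected (A # \<Gamma>) (Some B)"
      using is_type_PiD V S by (auto simp: expected_def)
    from lam1_sound[OF nf_sound e this y] Lam show ?thesis by auto
  next
    case (MkPair a b)
    with k obtain A B a' A' T' b' B' where S: "V = Sig A B"
      and a: "nf k \<Gamma> n es d (Some A) a = Some (a', A')"
      and T: "inst_type (nf k) \<Gamma> n a' A' B = Some T'"
      and b: "nf k \<Gamma> n es d (Some T') b = Some (b', B')"
      by (auto simp: pair1_def pair2_def pair3_def pair4_def split: option.splits prod.splits tm.splits)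
    have AB: "is_type \<Gamma> A" "is_type (A # \<Gamma>) B" using is_type_SigD V S by blast+
    note a = sound_check[OF nf_sound a e AB(1)]
    note T = inst_type_sound[OF nf_sound e evaluatesD(5)[OF a(1)] AB(2) T[unfolded a(2)]]
    note b = sound_check[OF nf_sound b e conv_typeD(1)[OF T]]
    have "\<Gamma> \<turnstile> ?s b : inst B (?s a)"
      using conv_typeD(3)[OF conv_type_inst[OF AB a(1)] conv_typeD(3)[OF T evaluatesD(1)[OF b(1)]]] .
    then show ?thesis using S MkPair evaluatesD(1)[OF a(1)] by (simp add: value_shape_def)
  qed (use t in \<open>simp_all add: value_shape_def\<close>)
  with ty V show ?thesis by (simp add: value_of_def)
qed

subsection \<open>Contexts of inhabited types\<close>

definition inhabited :: "tm \<Rightarrow> bool" where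
  "inhabited T \<longleftrightarrow> is_type [] T \<and> (\<exists>t. [] \<turnstile> t : T)"

text \<open>
  The types in such a context are closed, so that each may be replaced by an inhabitant independently
  of the others.
\<close>

definition all_inhabited :: "tm list \<Rightarrow> bool" where
  "all_inhabited \<Gamma> \<longleftrightarrow> (\<forall>T \<in> set \<Gamma>. inhabited T)"

lemma weaken_closed:
  assumes "[] \<turnstile> t : T" "closed_at 0 T" "\<Gamma> ctx"
  shows "\<Gamma> \<turnstile> t : T"
proof -
  have "ren_ok [] (\<lambda>k. k) \<Gamma>" using assms by (simp add: ren_ok_def)
  from ren_derivable(1)[OF assms(1) this] show ?thesis by (simp add: ren_id)
qed

lemma is_type_weaken: "is_type [] T \<Longrightarrow> \<Gamma> ctx \<Longrightarrow> is_type \<Gamma> T"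
  unfolding is_type_def using weaken_closed[of T "Univ _" \<Gamma>] by fastforce

lemma ctx_closed_types: "\<forall>T \<in> set \<Gamma>. is_type [] T \<Longrightarrow> \<Gamma> ctx"
proof (induction \<Gamma>)
  case Nil
  show ?case by (rule ctx_empty)
next
  case (Cons A \<Gamma>)
  then have "is_type \<Gamma> A" using is_type_weaken by simp
  then show ?case using ctx_extend by (auto simp: is_type_def)
qed

lemma env_ok_Nil: "\<forall>T \<in> set \<Gamma>. is_type [] T \<Longrightarrow> length \<Gamma> = n \<Longrightarrow> env_ok \<Gamma> n [] n"
  using ctx_closed_types by (simp add: env_ok_def)

lemma sub_ok_closed:
  assumes "\<forall>T \<in> set \<Gamma>. is_type [] T" "\<forall>k < length \<Gamma>. [] \<turnstile> s k : \<Gamma> ! k"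
  shows "sub_ok \<Gamma> s []"
proof -
  have "subst s (ctx_type \<Gamma> k) = \<Gamma> ! k" if "k < length \<Gamma>" for k
  proof -
    have "closed_at 0 (\<Gamma> ! k)" using that assms(1) is_type_closed by simp
    then show ?thesis by (simp add: ctx_type_def ren_closed subst_closed)
  qed
  then show ?thesis using assms by (auto simp: sub_ok_def intro: ctx_empty)
qed

lemma all_inhabited_Nil: "all_inhabited []" by (simp add: all_inhabited_def)
lemma all_inhabited_Cons: "inhabited T \<Longrightarrow> all_inhabited \<Gamma> \<Longrightarrow> all_inhabited (T # \<Gamma>)"
  by (simp add: all_inhabited_def)

definition provable :: "expr \<Rightarrow> bool" where
  "provable T \<longleftrightarrow> inhabited \<lbrakk>T\<rbrakk>"

definition type_nf :: "tm \<Rightarrow> tm option" where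
  "type_nf T = type_of_res (nf fuel [] 0 [] 0 None T)"

definition is_Some :: "result \<Rightarrow> bool" where
  "is_Some x \<longleftrightarrow> x \<noteq> None"

lemma is_Some_eval: "is_Some (Some x) = True"
  by (simp add: is_Some_def)

fun push :: "tm option \<Rightarrow> tm list option \<Rightarrow> tm list option" where
  "push (Some V) (Some \<Gamma>) = Some (V # \<Gamma>)"
| "push None x = None"
| "push (Some V) None = None"

fun push_types :: "tm list option \<Rightarrow> expr list \<Rightarrow> tm list option" where
  "push_types x [] = x"
| "push_types x (L # Ls) = push_types (push (type_nf \<lbrakk>L\<rbrakk>) x) Ls"

fun check_term :: "tm list option \<Rightarrow> tm option \<Rightarrow> expr \<Rightarrow> bool" where
  "check_term (Some \<Gamma>) (Some V) t =
     is_Some (nf fuel \<Gamma> (length \<Gamma>) [] (length \<Gamma>) (Some V) (t (length \<Gamma>)))"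
| "check_term None y t = False"
| "check_term (Some \<Gamma>) None t = False"

lemma env_ok_empty: "env_ok [] 0 [] 0"
  by (simp add: env_ok_Nil)

lemma type_nf_Some: "type_nf T = Some V \<Longrightarrow> has_nf [] 0 [] 0 T V"
  by (auto simp: type_nf_def has_nf_def type_of_res_Some)

lemma type_nf_sound:
  assumes "type_nf T = Some V"
  shows "\<exists>i. [] \<turnstile> T \<equiv> V : Univ i" "conv_type [] T V" "is_type [] T" "is_type [] V"
  using has_nf_sound[OF type_nf_Some[OF assms] env_ok_empty]
  unfolding env_ok_id(2)[OF env_ok_empty] by blast+

lemma inhabited_type_nf: "inhabited T \<Longrightarrow> type_nf T = Some V \<Longrightarrow> inhabited V"
  using type_nf_sound(4) conv_typeD(2)[OF type_nf_sound(2)] by (fastforce simp: inhabited_def)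

lemma check_term_sound:
  assumes inh: "all_inhabited \<Gamma>" and V: "is_type [] V"
    and c: "check_term (Some \<Gamma>) (Some V) t"
  shows "\<Gamma> \<turnstile> t (length \<Gamma>) : V" "inhabited V"
proof -
  let ?n = "length \<Gamma>"
  obtain v S where v: "nf fuel \<Gamma> ?n [] ?n (Some V) (t ?n) = Some (v, S)"
    using c by (auto simp: is_Some_def)
  have cl: "\<forall>T \<in> set \<Gamma>. is_type [] T" using inh by (simp add: all_inhabited_def inhabited_def)
  note e = env_ok_Nil[OF cl HOL.refl]
  have "is_type \<Gamma> V" using V is_type_weaken ctx_closed_types[OF cl] by blast
  from sound_check(1)[OF nf_sound v e this] show t: "\<Gamma> \<turnstile> t ?n : V"
    unfolding env_ok_id(2)[OF e] by (rule evaluatesD)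
  have "\<forall>k. \<exists>u. k < length \<Gamma> \<longrightarrow> [] \<turnstile> u : \<Gamma> ! k"
    using inh by (simp add: inhabited_def all_inhabited_def)
  then obtain s where "\<forall>k. k < length \<Gamma> \<longrightarrow> [] \<turnstile> s k : \<Gamma> ! k" by metis
  with cl have "sub_ok \<Gamma> s []" by (intro sub_ok_closed) auto
  from subst_derivable(1)[OF t this] have "[] \<turnstile> subst s (t ?n) : V"
    using subst_closed is_type_closed V by simp
  then show "inhabited V" using V by (auto simp: inhabited_def)
qed

lemma push_types_inhabited:
  "push_types x Ls = Some \<Gamma> \<Longrightarrow> list_all provable Ls \<Longrightarrow> (\<And>\<Gamma>. x = Some \<Gamma> \<Longrightarrow> all_inhabited \<Gamma>) \<Longrightarrow>
    all_inhabited \<Gamma>"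
proof (induction Ls arbitrary: x)
  case (Cons L Ls)
  have L: "inhabited \<lbrakk>L\<rbrakk>" using Cons.prems(2) by (simp add: provable_def)
  have "all_inhabited \<Delta>" if "push (type_nf \<lbrakk>L\<rbrakk>) x = Some \<Delta>" for \<Delta>
    using that Cons.prems(3) inhabited_type_nf[OF L] all_inhabited_Cons
    by (cases "type_nf \<lbrakk>L\<rbrakk>"; cases x) auto
  with Cons.IH[of "push (type_nf \<lbrakk>L\<rbrakk>) x"] Cons.prems(1,2) show ?case by simp
qed simp

lemma check_term_inhabited:
  assumes c: "check_term (push_types (Some []) Ls) y t" and L: "list_all provable Ls"
    and y: "\<And>V. y = Some V \<Longrightarrow> is_type [] V"
  shows "\<exists>V. y = Some V \<and> inhabited V"
proof -
  obtain \<Gamma> V where \<Gamma>: "push_types (Some []) Ls = Some \<Gamma>" and V: "y = Some V"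
    using c by (cases "push_types (Some []) Ls"; cases y) auto
  have "all_inhabited \<Gamma>"
    using push_types_inhabited[OF \<Gamma> L] all_inhabited_Nil by blast
  from check_term_sound(2)[OF this y[OF V]] c \<Gamma> V show ?thesis by simp
qed

text \<open>
  Evidence for the types \<open>Ls\<close> is represented by variables while \<open>t\<close> is checked; the context that they
  form is inhabited and is substituted away afterwards.  The order of \<open>Ls\<close> agrees with the numbering
  by \<open>lem\<close>.
\<close>

lemma provableI:
  assumes "check_term (push_types (Some []) Ls) (type_nf \<lbrakk>T\<rbrakk>) t" "list_all provable Ls"
  shows "provable T"
proof -
  obtain V where V: "type_nf \<lbrakk>T\<rbrakk> = Some V" "inhabited V"
    using check_term_inhabited[OF assms] type_nf_sound(4) by blast
  then show ?thesis
    using conv_typeD(3)[OF type_nf_sound(2)[OF V(1)]] type_nf_sound(3)[OF V(1)]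
    by (auto simp: provable_def inhabited_def)
qed

subsection \<open>Local definitions\<close>

fun bind_def2 :: "nat \<Rightarrow> tm \<Rightarrow> entry list \<Rightarrow> tm \<Rightarrow> bool \<Rightarrow> entry list option" where
  "bind_def2 n s es V False = None"
| "bind_def2 n s es V True = Some ((n, s, V) # es)"

fun bind_def1 :: "tm list \<Rightarrow> nat \<Rightarrow> tm \<Rightarrow> entry list \<Rightarrow> tm option \<Rightarrow> entry list option" where
  "bind_def1 \<Gamma> n s es None = None"
| "bind_def1 \<Gamma> n s es (Some V) =
     bind_def2 n s es V (canonical_source s \<and> is_Some (nf fuel \<Gamma> n [] n (Some V) s))"

fun bind_def :: "tm list \<Rightarrow> nat \<Rightarrow> expr \<Rightarrow> expr \<Rightarrow> nat \<Rightarrow> entry list option \<Rightarrow> entry list option" where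
  "bind_def \<Gamma> n s T m None = None"
| "bind_def \<Gamma> n s T m (Some es) =
     bind_def1 \<Gamma> n (s n) es (type_of_res (nf fuel \<Gamma> n es n None (T m)))"

text \<open>
  A list of definitions, each a term with its type; the type of a definition may refer to the earlier
  ones.  Definitions are placed in an environment over a fixed context, so that \<open>m\<close>, the depth at
  which types are read, grows while the context does not.
\<close>

fun bind_defs :: "tm list \<Rightarrow> nat \<Rightarrow> nat \<Rightarrow> entry list option \<Rightarrow> (expr \<times> expr) list \<Rightarrow> entry list option" where
  "bind_defs \<Gamma> n m x [] = x"
| "bind_defs \<Gamma> n m x (d # ds) = bind_defs \<Gamma> n (Suc m) (bind_def \<Gamma> n (fst d) (snd d) m x) ds"

lemma bind_def_sound:
  assumes b: "bind_def \<Gamma> n s T m (Some es) = Some es'" and es: "env_ok \<Gamma> n es n"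
  shows "\<exists>V. es' = (n, s n, V) # es" "env_ok \<Gamma> n es' n"
proof -
  from b obtain V where x: "type_of_res (nf fuel \<Gamma> n es n None (T m)) = Some V"
    and y: "bind_def1 \<Gamma> n (s n) es (Some V) = Some es'"
    by (cases "type_of_res (nf fuel \<Gamma> n es n None (T m))") auto
  then have c: "canonical_source (s n)" and z: "is_Some (nf fuel \<Gamma> n [] n (Some V) (s n))"
    and es': "es' = (n, s n, V) # es"
    by (cases "canonical_source (s n) \<and> is_Some (nf fuel \<Gamma> n [] n (Some V) (s n))"; simp)+
  show "\<exists>V. es' = (n, s n, V) # es" using es' by blast
  have V: "is_type \<Gamma> V"
    using has_nf_sound(3)[OF _ es] x unfolding has_nf_def type_of_res_Some by blast
  have e: "env_ok \<Gamma> n [] n" using env_ok_id(1)[OF es] .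
  obtain v S where v: "nf fuel \<Gamma> n [] n (Some V) (s n) = Some (v, S)"
    using z by (auto simp: is_Some_def)
  from sound_check(2)[OF nf_sound v e V] v have "checks \<Gamma> n [] n (s n) v V"
    by (simp add: checks_def)
  from checks_source_value[OF this e V c] have "value_of \<Gamma> (s n) V"
    by (simp only: env_ok_id(2)[OF e])
  then show "env_ok \<Gamma> n es' n" using es es' by (simp add: env_ok_def)
qed

lemma bind_defs_sound:
  "bind_defs \<Gamma> n m x ds = Some es' \<Longrightarrow> (\<And>es. x = Some es \<Longrightarrow> env_ok \<Gamma> n es n) \<Longrightarrow> env_ok \<Gamma> n es' n"
proof (induction ds arbitrary: m x)
  case (Cons d ds)
  have "env_ok \<Gamma> n es n" if "bind_def \<Gamma> n (fst d) (snd d) m x = Some es" for es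
    using that Cons.prems(2) bind_def_sound(2) by (cases x) auto
  with Cons.IH[of "Suc m" "bind_def \<Gamma> n (fst d) (snd d) m x"] Cons.prems(1) show ?case by simp
qed simp

fun type_in :: "tm list \<Rightarrow> nat \<Rightarrow> nat \<Rightarrow> expr \<Rightarrow> entry list option \<Rightarrow> tm option" where
  "type_in \<Gamma> n m T None = None"
| "type_in \<Gamma> n m T (Some es) = type_of_res (nf fuel \<Gamma> n es n None (T m))"

text \<open>The variable bound at depth \<open>j\<close>.\<close>

definition lem :: "nat \<Rightarrow> expr" where
  "lem j = (\<lambda>m. Var (m - Suc j))"

lemma lem_at: "lem j n = Var (n - Suc j)"
  by (simp add: lem_def)

lemmas evals = push.simps push_types.simps check_term.simps list.size bind_defs.simps
  bind_def.simps bind_def1.simps bind_def2.simps fst_conv snd_conv type_in.simps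
  canonical_source.simps type_nf_def is_Some_eval fuel_def eval_nat_numeral BitM.simps One_nat_def
  nf_eval closed_tm_def ht_defs expr_at lem_at Let_def

text \<open>
  The axioms have these types by rule; evaluating the type only shows that it is well formed.
\<close>

lemma provable_funext:
  assumes "type_nf \<lbrakk>funext_type i j\<rbrakk> = Some V" shows "provable (funext_type i j)"
  using type_nf_sound(3)[OF assms] ty_funext[OF ctx_empty] by (auto simp: provable_def inhabited_def)

lemma provable_ua:
  assumes "type_nf \<lbrakk>univalence_type i\<rbrakk> = Some V" shows "provable (univalence_type i)"
  using type_nf_sound(3)[OF assms] ty_ua[OF ctx_empty] by (auto simp: provable_def inhabited_def)

section \<open>Raising universe levels\<close>

primrec raise :: "nat \<Rightarrow> tm \<Rightarrow> tm" where
  "raise l (Var k) = Var k"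
| "raise l (Univ i) = Univ (i + l)"
| "raise l (Pi A B) = Pi (raise l A) (raise l B)"
| "raise l (Lam b) = Lam (raise l b)"
| "raise l (App f a) = App (raise l f) (raise l a)"
| "raise l (Sig A B) = Sig (raise l A) (raise l B)"
| "raise l (MkPair a b) = MkPair (raise l a) (raise l b)"
| "raise l (Fst p) = Fst (raise l p)"
| "raise l (Snd p) = Snd (raise l p)"
| "raise l (Eq A a b) = Eq (raise l A) (raise l a) (raise l b)"
| "raise l Refl = Refl"
| "raise l (J C d p) = J (raise l C) (raise l d) (raise l p)"
| "raise l (FunExt i j) = FunExt (i + l) (j + l)"
| "raise l (UA i) = UA (i + l)"

lemma raise_ren: "raise l (ren r t) = ren r (raise l t)"
  by (induction t arbitrary: r) simp_all

lemma raise_up_sub: "(\<lambda>k. raise l (up_sub s k)) = up_sub (\<lambda>k. raise l (s k))"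
  by (auto simp: raise_ren split: nat.splits)

lemma raise_subst: "raise l (subst s t) = subst (\<lambda>k. raise l (s k)) (raise l t)"
  by (induction t arbitrary: s) (simp_all add: raise_up_sub)

lemma raise_inst: "raise l (inst B a) = inst (raise l B) (raise l a)"
proof -
  have "(\<lambda>k. raise l (case_nat a Var k)) = case_nat (raise l a) Var"
    by (auto split: nat.splits)
  then show ?thesis by (simp add: raise_subst)
qed

lemma raise_funext_type: "raise l \<lbrakk>funext_type i j\<rbrakk> = \<lbrakk>funext_type (i + l) (j + l)\<rbrakk>"
  by (simp only: funext_type_def closed_tm_def ht_defs expr_at raise.simps)

lemma raise_univalence_type: "raise l \<lbrakk>univalence_type i\<rbrakk> = \<lbrakk>univalence_type (i + l)\<rbrakk>"
  by (simp only: univalence_type_def closed_tm_def ht_defs expr_at raise.simps)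

lemma max_add: "max (i + l) (j + l) = max i j + (l::nat)"
  by simp

text \<open>
  The rules mention levels only through successor and maximum, both of which commute with adding a
  constant, and the axioms are available at all levels.
\<close>

lemma raise_derivable:
  "\<Gamma> ctx \<Longrightarrow> map (raise l) \<Gamma> ctx"
  "\<Gamma> \<turnstile> t : A \<Longrightarrow> map (raise l) \<Gamma> \<turnstile> raise l t : raise l A"
  "\<Gamma> \<turnstile> t \<equiv> u : A \<Longrightarrow> map (raise l) \<Gamma> \<turnstile> raise l t \<equiv> raise l u : raise l A"
proof (induction rule: wf_ctx_has_type_def_eq.inducts)
  case (ty_var \<Gamma> k)
  then show ?case using wf_ctx_has_type_def_eq.ty_var[of "map (raise l) \<Gamma>" k] by (simp add: raise_ren)
next
  case (ty_funext \<Gamma> i j)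
  then show ?case by (simp only: raise_funext_type raise.simps wf_ctx_has_type_def_eq.ty_funext)
next
  case (ty_ua \<Gamma> i)
  then show ?case by (simp only: raise_univalence_type raise.simps wf_ctx_has_type_def_eq.ty_ua)
next
  case (ty_univ \<Gamma> i)
  then show ?case using wf_ctx_has_type_def_eq.ty_univ[of "map (raise l) \<Gamma>" "i + l"] by simp
next
  case (ty_pi \<Gamma> A i B j)
  then show ?case using wf_ctx_has_type_def_eq.ty_pi[of "map (raise l) \<Gamma>" "raise l A" "i + l" "raise l B" "j + l"]
    by (simp add: max_add)
next
  case (ty_sig \<Gamma> A i B j)
  then show ?case using wf_ctx_has_type_def_eq.ty_sig[of "map (raise l) \<Gamma>" "raise l A" "i + l" "raise l B" "j + l"]
    by (simp add: max_add)
next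
  case (cong_pi \<Gamma> A i A' B B' j)
  then show ?case using wf_ctx_has_type_def_eq.cong_pi[of "map (raise l) \<Gamma>" "raise l A" "i + l" "raise l A'" "raise l B" "raise l B'" "j + l"]
    by (simp add: max_add)
next
  case (cong_sig \<Gamma> A i A' B B' j)
  then show ?case using wf_ctx_has_type_def_eq.cong_sig[of "map (raise l) \<Gamma>" "raise l A" "i + l" "raise l A'" "raise l B" "raise l B'" "j + l"]
    by (simp add: max_add)
next
  case ctx_empty
  show ?case by (simp add: wf_ctx_has_type_def_eq.ctx_empty)
next
  case (ty_J \<Gamma> a A b C i d p)
  from wf_ctx_has_type_def_eq.ty_J[OF ty_J.IH(1,2) _ _ ty_J.IH(5)[simplified], of "raise l C" "i + l" "raise l d"] ty_J.IH(3,4)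
  show ?case by (simp add: raise_ren)
next
  case (beta_J \<Gamma> a A C i d)
  from wf_ctx_has_type_def_eq.beta_J[OF beta_J.IH(1), of "raise l C" "i + l" "raise l d"] beta_J.IH(2,3)
  show ?case by (simp add: raise_ren)
next
  case (cong_J \<Gamma> a A b C C' i d d' p p')
  from wf_ctx_has_type_def_eq.cong_J[OF cong_J.IH(1,2) _ _ cong_J.IH(5)[simplified], of "raise l C" "raise l C'" "i + l" "raise l d" "raise l d'"] cong_J.IH(3,4)
  show ?case by (simp add: raise_ren)
next
  case (eta_fun \<Gamma> f A B)
  from wf_ctx_has_type_def_eq.eta_fun[OF eta_fun.IH[simplified]] show ?case by (simp add: raise_ren)
qed (simp_all only: raise.simps list.map raise_inst wf_ctx_has_type_def_eq.ctx_extend,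
    (rule wf_ctx_has_type_def_eq.intros; assumption)+)

section \<open>Telescopes of definitions and hypotheses\<close>

lemma sub_ok_Cons:
  assumes "sub_ok \<Gamma> s \<Delta>" "\<Delta> \<turnstile> a : subst s A"
  shows "sub_ok (A # \<Gamma>) (case_nat a s) \<Delta>"
  unfolding sub_ok_def
proof (intro conjI allI impI)
  show "\<Delta> ctx" using assms(1) by (simp add: sub_ok_def)
  fix k assume "k < length (A # \<Gamma>)"
  then show "\<Delta> \<turnstile> case_nat a s k : subst (case_nat a s) (ctx_type (A # \<Gamma>) k)"
    using assms by (cases k) (simp_all add: ctx_type_0 ctx_type_Suc subst_ren sub_ok_def)
qed

fun extend :: "(nat \<Rightarrow> tm) \<Rightarrow> tm list \<Rightarrow> nat \<Rightarrow> tm" where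
  "extend s [] = s"
| "extend s (p # ps) = extend (case_nat p s) ps"

text \<open>
  The context formed by a telescope of types, each written at the depth at which it is placed.
\<close>

fun tele :: "nat \<Rightarrow> tm list \<Rightarrow> expr list \<Rightarrow> tm list" where
  "tele n \<Gamma> [] = \<Gamma>"
| "tele n \<Gamma> (T # Ts) = tele (Suc n) (T n # \<Gamma>) Ts"

lemma bind_def_typed:
  assumes b: "bind_def \<Gamma> n s T m (Some es) = Some es'" and es: "env_ok \<Gamma> n es n"
  shows "\<Gamma> \<turnstile> s n : subst (env_sub n es n) (T m)" "env_sub n es' n = case_nat (s n) (env_sub n es n)"
proof -
  from b obtain V where x: "type_of_res (nf fuel \<Gamma> n es n None (T m)) = Some V"
    and y: "bind_def1 \<Gamma> n (s n) es (Some V) = Some es'"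
    by (cases "type_of_res (nf fuel \<Gamma> n es n None (T m))") auto
  then have es': "es' = (n, s n, V) # es"
    by (cases "canonical_source (s n) \<and> is_Some (nf fuel \<Gamma> n [] n (Some V) (s n))"; simp)
  have "has_nf \<Gamma> n es n (T m) V" using x by (auto simp: has_nf_def type_of_res_Some)
  note c = has_nf_sound(2)[OF this es]
  have "\<Gamma> \<turnstile> s n : V" using bind_def_sound(2)[OF b es] es' by (simp add: env_ok_def value_of_def)
  then show "\<Gamma> \<turnstile> s n : subst (env_sub n es n) (T m)" using conv_typeD(3)[OF c] by blast
  show "env_sub n es' n = case_nat (s n) (env_sub n es n)"
  proof
    fix k show "env_sub n es' n k = case_nat (s n) (env_sub n es n) k"
      unfolding es' by (cases k) simp_all
  qed
qed

lemma bind_defs_None: "bind_defs \<Gamma> n m None ds = None"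
  by (induction ds arbitrary: m) simp_all

text \<open>
  Definitions as seen from outside the evaluator: their sources can be substituted for the variables
  of the telescope of their types.
\<close>

lemma bind_defs_sub_ok:
  "bind_defs \<Gamma> n m (Some es) ds = Some es' \<Longrightarrow> env_ok \<Gamma> n es n \<Longrightarrow> sub_ok \<Delta> (env_sub n es n) \<Gamma> \<Longrightarrow>
    sub_ok (tele m \<Delta> (map snd ds)) (env_sub n es' n) \<Gamma> \<and>
    env_sub n es' n = extend (env_sub n es n) (map (\<lambda>d. fst d n) ds)"
proof (induction ds arbitrary: m es \<Delta>)
  case (Cons d ds)
  obtain es1 where es1: "bind_def \<Gamma> n (fst d) (snd d) m (Some es) = Some es1"
    using Cons.prems(1) bind_defs_None by (cases "bind_def \<Gamma> n (fst d) (snd d) m (Some es)") auto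
  note t = bind_def_typed[OF es1 Cons.prems(2)]
  have "sub_ok (snd d m # \<Delta>) (env_sub n es1 n) \<Gamma>"
    unfolding t(2) using sub_ok_Cons[OF Cons.prems(3) t(1)] .
  note IH = Cons.IH[OF _ bind_def_sound(2)[OF es1 Cons.prems(2)] this, of "Suc m"]
  have ds: "bind_defs \<Gamma> n (Suc m) (Some es1) ds = Some es'"
    using Cons.prems(1) unfolding bind_defs.simps es1 .
  show ?case
    using conjunct1[OF IH[OF ds]] conjunct2[OF IH[OF ds]]
    by (simp only: list.map tele.simps extend.simps t(2) simp_thms)
qed simp

text \<open>
  A context of further hypotheses, all of which are written over the same base context; \<open>i\<close> of them
  have been added already.
\<close>

fun hyps :: "nat \<Rightarrow> tm list \<Rightarrow> tm list \<Rightarrow> tm list" where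
  "hyps i \<Gamma> [] = \<Gamma>"
| "hyps i \<Gamma> (P # Ps) = hyps (Suc i) (lift i P # \<Gamma>) Ps"

lemma hyps_sub_ok:
  "sub_ok \<Gamma> s' \<Delta> \<Longrightarrow> list_all2 (\<lambda>p P. \<Delta> \<turnstile> p : subst s P) ps Ps \<Longrightarrow> (\<And>k. s' (i + k) = s k) \<Longrightarrow>
    sub_ok (hyps i \<Gamma> Ps) (extend s' ps) \<Delta>"
proof (induction Ps arbitrary: i \<Gamma> s' ps)
  case (Cons P Ps)
  from Cons.prems(2) obtain q qs where ps: "ps = q # qs" and q: "\<Delta> \<turnstile> q : subst s P"
    and qs: "list_all2 (\<lambda>p P. \<Delta> \<turnstile> p : subst s P) qs Ps"
    by (cases ps) auto
  have "subst s' (lift i P) = subst s P"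
    using Cons.prems(3) by (simp add: lift_eq_ren subst_ren)
  with q have "sub_ok (lift i P # \<Gamma>) (case_nat q s') \<Delta>"
    using sub_ok_Cons[OF Cons.prems(1)] by simp
  from Cons.IH[OF this qs, of "Suc i"] Cons.prems(3) show ?case by (simp add: ps)
qed simp

lemma raise_lift: "raise l (lift i P) = lift i (raise l P)"
  by (simp add: lift_eq_ren raise_ren)

lemma map_raise_hyps: "map (raise l) (hyps i \<Gamma> Ps) = hyps i (map (raise l) \<Gamma>) (map (raise l) Ps)"
  by (induction Ps arbitrary: i \<Gamma>) (simp_all add: raise_lift)

lemma raise_sub_ok:
  assumes "sub_ok \<Gamma> s []"
  shows "sub_ok (map (raise l) \<Gamma>) (\<lambda>k. raise l (s k)) []"
proof -
  have "[] \<turnstile> raise l (s k) : subst (\<lambda>k. raise l (s k)) (ctx_type (map (raise l) \<Gamma>) k)" if "k < length \<Gamma>" for k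
  proof -
    have "[] \<turnstile> s k : subst s (ctx_type \<Gamma> k)" using assms that by (simp add: sub_ok_def)
    from raise_derivable(2)[OF this, of l] show ?thesis
      using that by (simp add: raise_subst ctx_type_def raise_ren)
  qed
  then show ?thesis by (simp add: sub_ok_def ctx_empty)
qed

lemma raise_extend: "(\<lambda>k. raise l (extend s ps k)) = extend (\<lambda>k. raise l (s k)) (map (raise l) ps)"
proof (induction ps arbitrary: s)
  case (Cons p ps)
  have "(\<lambda>k. raise l (case_nat p s k)) = case_nat (raise l p) (\<lambda>k. raise l (s k))"
    by (auto split: nat.splits)
  with Cons show ?case by simp
qed simp

lemma type_in_sound:
  assumes "type_in \<Gamma> n m T (Some es) = Some V" "env_ok \<Gamma> n es n"
  shows "conv_type \<Gamma> (subst (env_sub n es n) (T m)) V" "is_type \<Gamma> (subst (env_sub n es n) (T m))" "is_type \<Gamma> V"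
proof -
  have "has_nf \<Gamma> n es n (T m) V" using assms(1) by (auto simp: has_nf_def type_of_res_Some)
  from has_nf_sound(2-4)[OF this assms(2)]
  show "conv_type \<Gamma> (subst (env_sub n es n) (T m)) V" "is_type \<Gamma> (subst (env_sub n es n) (T m))" "is_type \<Gamma> V"
    by blast+
qed

text \<open>
  A type that is stated in terms of defined constants is inhabited after the definitions have been
  substituted.
\<close>

lemma inhabited_in:
  assumes c: "check_term (push_types (Some []) Ls) (type_in [] 0 m P (bind_defs [] 0 0 (Some []) ds)) t"
    and L: "list_all provable Ls"
  shows "inhabited (subst (extend Var (map (\<lambda>d. fst d 0) ds)) (P m))"
proof -
  obtain es where es: "bind_defs [] 0 0 (Some []) ds = Some es"
    using c by (cases "bind_defs [] 0 0 (Some []) ds"; cases "push_types (Some []) Ls") auto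
  have e: "env_ok [] 0 es 0" using bind_defs_sound[OF es] env_ok_empty by simp
  have "env_sub 0 [] 0 = Var" by auto
  then have s: "env_sub 0 es 0 = extend Var (map (\<lambda>d. fst d 0) ds)"
    using bind_defs_sub_ok[OF es env_ok_empty, of "[]"] by (simp add: sub_ok_def ctx_empty)
  have "is_type [] V" if "type_in [] 0 m P (Some es) = Some V" for V
    using type_in_sound(3)[OF that e] .
  then obtain V where V: "type_in [] 0 m P (Some es) = Some V" "inhabited V"
    using check_term_inhabited[OF c L] unfolding es by blast
  show ?thesis
    unfolding s[symmetric]
    using V(2) conv_typeD(3)[OF type_in_sound(1)[OF V(1) e]] type_in_sound(2)[OF V(1) e]
    by (auto simp: inhabited_def)
qed

lemma sub_ok_defs:
  assumes es: "bind_defs [] 0 0 (Some []) ds = Some es"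
  shows "sub_ok (tele 0 [] (map snd ds)) (extend Var (map (\<lambda>d. fst d 0) ds)) []"
proof -
  have s: "env_sub 0 [] 0 = Var" by auto
  have "sub_ok [] (env_sub 0 [] 0) []" by (simp add: sub_ok_def ctx_empty)
  note x = bind_defs_sub_ok[OF es env_ok_empty this, unfolded s]
  show ?thesis using conjunct1[OF x] unfolding conjunct2[OF x] .
qed

fun eval_in :: "tm list \<Rightarrow> nat \<Rightarrow> tm \<Rightarrow> entry list option \<Rightarrow> result" where
  "eval_in \<Gamma> n t None = None"
| "eval_in \<Gamma> n t (Some es) = nf fuel \<Gamma> n es n None t"

section \<open>Fibres as a functor from maps to families\<close>

lemma funext: "provable (funext_type 0 0)"
  by (rule provable_funext) (simp only: evals funext_type_def)

lemma funext1: "provable (funext_type 0 1)"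
  by (rule provable_funext) (simp only: evals funext_type_def)

lemma ua: "provable (univalence_type 0)"
  by (rule provable_ua) (simp only: evals univalence_type_def)

lemmas arrows = dom_def cod_def fn_def
text \<open>Components of a proof that a function is an equivalence.\<close>

definition sec where "sec e = pr1 (pr1 e)"
definition sec_eq where "sec_eq e = pr2 (pr1 e)"
definition ret where "ret e = pr1 (pr2 e)"
definition ret_eq where "ret_eq e = pr2 (pr2 e)"

lemmas eqv = sec_def sec_eq_def ret_def ret_eq_def

text \<open>The path component of a composite of squares in \<open>Map\<close>.\<close>

definition paste :: "expr \<Rightarrow> expr \<Rightarrow> expr \<Rightarrow> expr \<Rightarrow> expr \<Rightarrow> expr \<Rightarrow> expr \<Rightarrow> expr \<Rightarrow> expr \<Rightarrow> expr" where
  "paste A F h m u g n \<alpha> \<beta> = concat (A \<rightarrow> F) ((h \<odot> m) \<odot> u)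
     (ap (A \<rightarrow> F) (\<^bold>\<lambda>k. k \<odot> u) (h \<odot> m) \<beta>) (ap (A \<rightarrow> F) (\<^bold>\<lambda>k. n \<odot> k) (g \<odot> u) \<alpha>)"

definition Map_arrow :: "expr \<Rightarrow> expr \<Rightarrow> expr" where
  "Map_arrow f g = (\<Sigma>(u : dom f \<rightarrow> dom g). \<Sigma>(v : cod f \<rightarrow> cod g).
     eq (dom f \<rightarrow> cod g) (fn g \<odot> u) (v \<odot> fn f))"

definition htpy :: "expr \<Rightarrow> expr \<Rightarrow> expr \<Rightarrow> expr \<Rightarrow> expr" where
  "htpy Y h a \<alpha> = path_ind (\<^bold>\<lambda>k _. eq Y (h \<cdot> a) (k \<cdot> a)) refl \<alpha>"

text \<open>
  From a square \<open>\<alpha> : g \<circ> u = v \<circ> f\<close> and \<open>p : f a = b\<close>, the path from \<open>g (u a)\<close> to \<open>v b\<close>; it is defined by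
  induction on \<open>p\<close>, so that at \<open>refl\<close> it is the homotopy given by \<open>\<alpha>\<close>.
\<close>

definition square :: "expr \<Rightarrow> expr \<Rightarrow> expr \<Rightarrow> expr \<Rightarrow> expr \<Rightarrow> expr \<Rightarrow> expr \<Rightarrow> expr" where
  "square Y g u v a \<alpha> p = path_ind (\<^bold>\<lambda>b _. eq Y (g \<cdot> (u \<cdot> a)) (v \<cdot> b)) (htpy Y (g \<odot> u) a \<alpha>) p"

definition fibre :: "expr \<Rightarrow> expr \<Rightarrow> expr" where
  "fibre x b = fib (dom x) (cod x) (fn x) b"

text \<open>The action of the functor on the square \<open>(u, v, \<alpha>)\<close>.\<close>

definition fib_map :: "expr \<Rightarrow> expr \<Rightarrow> expr \<Rightarrow> expr \<Rightarrow> expr \<Rightarrow> expr" where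
  "fib_map x y u v \<alpha> = \<langle>v, \<^bold>\<lambda>b w. \<langle>u \<cdot> pr1 w, square (cod y) (fn y) u v (pr1 w) \<alpha> (pr2 w)\<rangle>\<rangle>"

definition Fam_arrow :: "expr \<Rightarrow> expr \<Rightarrow> expr" where
  "Fam_arrow x y = (\<Sigma>(m : cod x \<rightarrow> cod y). \<Pi>(b : cod x). fibre x b \<rightarrow> fibre y (m \<cdot> b))"

definition Fam_eq_type :: expr where
  "Fam_eq_type = (\<Pi>(X : \<U> 0). \<Pi>(P : X \<rightarrow> \<U> 0). \<Pi>(Y : \<U> 0). \<Pi>(Q : Y \<rightarrow> \<U> 0). \<Pi>(m : X \<rightarrow> Y).
     \<Pi>(\<mu> : \<Pi>(x : X). P \<cdot> x \<rightarrow> Q \<cdot> (m \<cdot> x)). \<Pi>(\<nu> : \<Pi>(x : X). P \<cdot> x \<rightarrow> Q \<cdot> (m \<cdot> x)).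
     (\<Pi>(x : X). \<Pi>(w : P \<cdot> x). eq (Q \<cdot> (m \<cdot> x)) (\<mu> \<cdot> x \<cdot> w) (\<nu> \<cdot> x \<cdot> w)) \<rightarrow>
       eq (\<Sigma>(m : X \<rightarrow> Y). \<Pi>(x : X). P \<cdot> x \<rightarrow> Q \<cdot> (m \<cdot> x)) \<langle>m, \<mu>\<rangle> \<langle>m, \<nu>\<rangle>)"

definition Fam_eq_proof :: "expr \<Rightarrow> expr" where
  "Fam_eq_proof fe = (\<^bold>\<lambda>X P Y Q m \<mu> \<nu> H.
     path_ind (\<^bold>\<lambda>\<kappa> _. eq (\<Sigma>(m : X \<rightarrow> Y). \<Pi>(x : X). P \<cdot> x \<rightarrow> Q \<cdot> (m \<cdot> x)) \<langle>m, \<mu>\<rangle> \<langle>m, \<kappa>\<rangle>) refl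
      (sec (fe \<cdot> X \<cdot> (\<^bold>\<lambda>x. P \<cdot> x \<rightarrow> Q \<cdot> (m \<cdot> x)) \<cdot> \<mu> \<cdot> \<nu>) \<cdot>
        (\<^bold>\<lambda>x. sec (fe \<cdot> (P \<cdot> x) \<cdot> (\<^bold>\<lambda>_. Q \<cdot> (m \<cdot> x)) \<cdot> (\<mu> \<cdot> x) \<cdot> (\<nu> \<cdot> x)) \<cdot> (H \<cdot> x))))"

text \<open>
  Two arrows of families over the same function on indices agree if they agree pointwise, by two uses
  of function extensionality.
\<close>

lemma Fam_eq: "provable Fam_eq_type"
  by (rule provableI[where Ls = "[funext_type 0 0]" and t = "Fam_eq_proof (lem 0)"])
    (simp only: evals Fam_eq_type_def Fam_eq_proof_def funext_type_def eqv,
     simp only: list.pred_inject funext simp_thms)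

subsection \<open>Preservation of identities\<close>

definition fib_map_id :: "expr \<Rightarrow> expr" where
  "fib_map_id x = \<langle>identity, \<^bold>\<lambda>b w. \<langle>pr1 w, path_ind (\<^bold>\<lambda>b _. eq (cod x) (fn x \<cdot> pr1 w) b) refl (pr2 w)\<rangle>\<rangle>"

definition id_law_type :: expr where
  "id_law_type = (\<Pi>(x : Map_ob 0). eq (Fam_arrow x x) (fib_map_id x) \<langle>identity, \<^bold>\<lambda>b. identity\<rangle>)"

definition id_law_proof :: "expr \<Rightarrow> expr" where
  "id_law_proof fam_eq = (\<^bold>\<lambda>x. fam_eq \<cdot> cod x \<cdot> (\<^bold>\<lambda>b. fibre x b) \<cdot> cod x \<cdot> (\<^bold>\<lambda>b. fibre x b) \<cdot> identity \<cdot>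
     (\<^bold>\<lambda>b w. \<langle>pr1 w, path_ind (\<^bold>\<lambda>b _. eq (cod x) (fn x \<cdot> pr1 w) b) refl (pr2 w)\<rangle>) \<cdot> (\<^bold>\<lambda>b w. w) \<cdot>
     (\<^bold>\<lambda>b w. path_ind (\<^bold>\<lambda>b p. eq (fibre x b) \<langle>pr1 w, path_ind (\<^bold>\<lambda>b _. eq (cod x) (fn x \<cdot> pr1 w) b) refl p\<rangle> \<langle>pr1 w, p\<rangle>) refl (pr2 w)))"

lemmas fibs = fibre_def fib_map_def Fam_arrow_def Map_arrow_def htpy_def square_def fib_map_id_def Map_ob_def arrows

text \<open>
  On the identity square the path component of the functor is \<open>refl\<close> concatenated with \<open>p\<close>, written as
  an induction on \<open>p\<close>; another induction on \<open>p\<close> identifies it with \<open>p\<close>.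
\<close>

lemma id_law: "provable id_law_type"
  by (rule provableI[where Ls = "[Fam_eq_type]" and t = "id_law_proof (lem 0)"])
    (simp only: evals Fam_eq_type_def id_law_type_def id_law_proof_def fibs,
     simp only: list.pred_inject Fam_eq simp_thms)

subsection \<open>Preservation of composition\<close>

definition square_paste_type :: expr where
  "square_paste_type = (\<Pi>(A : \<U> 0). \<Pi>(B : \<U> 0). \<Pi>(C : \<U> 0). \<Pi>(D : \<U> 0). \<Pi>(E : \<U> 0). \<Pi>(F : \<U> 0).
     \<Pi>(f : A \<rightarrow> B). \<Pi>(g : C \<rightarrow> D). \<Pi>(h : E \<rightarrow> F).
     \<Pi>(u : A \<rightarrow> C). \<Pi>(v : B \<rightarrow> D). \<Pi>(m : C \<rightarrow> E). \<Pi>(n : D \<rightarrow> F).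
     \<Pi>(\<alpha> : eq (A \<rightarrow> D) (g \<odot> u) (v \<odot> f)). \<Pi>(\<beta> : eq (C \<rightarrow> F) (h \<odot> m) (n \<odot> g)).
     \<Pi>(a : A). \<Pi>(b : B). \<Pi>(p : eq B (f \<cdot> a) b).
       eq (eq F (h \<cdot> (m \<cdot> (u \<cdot> a))) (n \<cdot> (v \<cdot> b)))
         (square F h (m \<odot> u) (n \<odot> v) a (paste A F h m u g n \<alpha> \<beta>) p)
         (square F h m n (u \<cdot> a) \<beta> (square D g u v a \<alpha> p)))"

definition square_paste_proof :: expr where
  "square_paste_proof = (\<^bold>\<lambda>A B C D E F f g h u v m n \<alpha> \<beta> a b p.
     path_ind (\<^bold>\<lambda>b' p'. eq (eq F (h \<cdot> (m \<cdot> (u \<cdot> a))) (n \<cdot> (v \<cdot> b')))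
         (square F h (m \<odot> u) (n \<odot> v) a (paste A F h m u g n \<alpha> \<beta>) p')
         (square F h m n (u \<cdot> a) \<beta> (square D g u v a \<alpha> p')))
      (path_ind (\<^bold>\<lambda>V \<alpha>'. eq (eq F (h \<cdot> (m \<cdot> (u \<cdot> a))) (n \<cdot> (V \<cdot> a)))
         (htpy F (h \<odot> (m \<odot> u)) a (paste A F h m u g n \<alpha>' \<beta>))
         (square F h m n (u \<cdot> a) \<beta> (htpy D (g \<odot> u) a \<alpha>')))
       (path_ind (\<^bold>\<lambda>V \<beta>'. eq (eq F (h \<cdot> (m \<cdot> (u \<cdot> a))) (V \<cdot> (u \<cdot> a)))
          (htpy F (h \<odot> (m \<odot> u)) a (ap (A \<rightarrow> F) (\<^bold>\<lambda>k. k \<odot> u) (h \<odot> m) \<beta>'))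
          (htpy F (h \<odot> m) (u \<cdot> a) \<beta>'))
        refl \<beta>) \<alpha>) p)"

text \<open>
  The square action turns pasting into composition.  After induction on \<open>p\<close>, \<open>\<alpha>\<close> and \<open>\<beta>\<close>, in this
  order, both sides are \<open>refl\<close>.  The order matters: only at \<open>b = f a\<close> is \<open>v b\<close> a value of the endpoint
  \<open>v \<circ> f\<close> of \<open>\<alpha>\<close>, and only after this has been replaced by \<open>g \<circ> u\<close> does the endpoint \<open>n \<circ> g\<close> of \<open>\<beta>\<close>
  appear.
\<close>

lemma square_paste: "provable square_paste_type"
  by (rule provableI[where Ls = "[]" and t = square_paste_proof])
    (simp only: evals square_paste_type_def square_paste_proof_def htpy_def square_def paste_def,
     simp only: list.pred_inject simp_thms)

definition comp_rhs :: "expr \<Rightarrow> expr \<Rightarrow> expr \<Rightarrow> expr \<Rightarrow> expr \<Rightarrow> expr" where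
  "comp_rhs x y z s t = (\<^bold>\<lambda>b w. \<langle>pr1 t \<cdot> (pr1 s \<cdot> pr1 w),
      square (cod z) (fn z) (pr1 t) (pr1 (pr2 t)) (pr1 s \<cdot> pr1 w) (pr2 (pr2 t))
       (square (cod y) (fn y) (pr1 s) (pr1 (pr2 s)) (pr1 w) (pr2 (pr2 s)) (pr2 w))\<rangle>)"

definition fib_map_eq_type :: expr where
  "fib_map_eq_type = (\<Pi>(x : Map_ob 0). \<Pi>(y : Map_ob 0). \<Pi>(u : dom x \<rightarrow> dom y). \<Pi>(v : cod x \<rightarrow> cod y).
     \<Pi>(\<alpha> : eq (dom x \<rightarrow> cod y) (fn y \<odot> u) (v \<odot> fn x)).
     \<Pi>(q : \<Pi>(b : cod x). \<Pi>(w : fibre x b). eq (cod y) (fn y \<cdot> (u \<cdot> pr1 w)) (v \<cdot> b)).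
     (\<Pi>(b : cod x). \<Pi>(w : fibre x b).
        eq (eq (cod y) (fn y \<cdot> (u \<cdot> pr1 w)) (v \<cdot> b))
          (square (cod y) (fn y) u v (pr1 w) \<alpha> (pr2 w)) (q \<cdot> b \<cdot> w)) \<rightarrow>
     eq (Fam_arrow x y) (fib_map x y u v \<alpha>) \<langle>v, \<^bold>\<lambda>b w. \<langle>u \<cdot> pr1 w, q \<cdot> b \<cdot> w\<rangle>\<rangle>)"

definition fib_map_eq_proof :: "expr \<Rightarrow> expr" where
  "fib_map_eq_proof fam_eq = (\<^bold>\<lambda>x y u v \<alpha> q H. fam_eq \<cdot> cod x \<cdot> (\<^bold>\<lambda>b. fibre x b) \<cdot> cod y \<cdot> (\<^bold>\<lambda>b. fibre y b) \<cdot> v \<cdot>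
     (\<^bold>\<lambda>b w. \<langle>u \<cdot> pr1 w, square (cod y) (fn y) u v (pr1 w) \<alpha> (pr2 w)\<rangle>) \<cdot>
     (\<^bold>\<lambda>b w. \<langle>u \<cdot> pr1 w, q \<cdot> b \<cdot> w\<rangle>) \<cdot>
     (\<^bold>\<lambda>b w. path_ind (\<^bold>\<lambda>r _. eq (fibre y (v \<cdot> b))
         \<langle>u \<cdot> pr1 w, square (cod y) (fn y) u v (pr1 w) \<alpha> (pr2 w)\<rangle> \<langle>u \<cdot> pr1 w, r\<rangle>) refl (H \<cdot> b \<cdot> w)))"

text \<open>
  To identify the image of a square it suffices to identify the path component in each fibre.
\<close>

lemma fib_map_eq: "provable fib_map_eq_type"
  by (rule provableI[where Ls = "[Fam_eq_type]" and t = "fib_map_eq_proof (lem 0)"])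
    (simp only: evals Fam_eq_type_def fib_map_eq_type_def fib_map_eq_proof_def fibs,
     simp only: list.pred_inject Fam_eq simp_thms)

definition comp_law_type :: expr where
  "comp_law_type = (\<Pi>(x : Map_ob 0). \<Pi>(y : Map_ob 0). \<Pi>(z : Map_ob 0).
     \<Pi>(s : Map_arrow x y). \<Pi>(t : Map_arrow y z).
     eq (Fam_arrow x z)
       (fib_map x z (pr1 t \<odot> pr1 s) (pr1 (pr2 t) \<odot> pr1 (pr2 s))
         (paste (dom x) (cod z) (fn z) (pr1 t) (pr1 s) (fn y) (pr1 (pr2 t)) (pr2 (pr2 s)) (pr2 (pr2 t))))
       \<langle>pr1 (pr2 t) \<odot> pr1 (pr2 s), comp_rhs x y z s t\<rangle>)"

definition comp_law_proof :: "expr \<Rightarrow> expr \<Rightarrow> expr" where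
  "comp_law_proof fme sp = (\<^bold>\<lambda>x y z s t. fme \<cdot> x \<cdot> z \<cdot> (pr1 t \<odot> pr1 s) \<cdot> (pr1 (pr2 t) \<odot> pr1 (pr2 s)) \<cdot>
     paste (dom x) (cod z) (fn z) (pr1 t) (pr1 s) (fn y) (pr1 (pr2 t)) (pr2 (pr2 s)) (pr2 (pr2 t)) \<cdot>
     (\<^bold>\<lambda>b w. square (cod z) (fn z) (pr1 t) (pr1 (pr2 t)) (pr1 s \<cdot> pr1 w) (pr2 (pr2 t))
       (square (cod y) (fn y) (pr1 s) (pr1 (pr2 s)) (pr1 w) (pr2 (pr2 s)) (pr2 w))) \<cdot>
     (\<^bold>\<lambda>b w. sp \<cdot> dom x \<cdot> cod x \<cdot> dom y \<cdot> cod y \<cdot> dom z \<cdot> cod z \<cdot> fn x \<cdot> fn y \<cdot> fn z \<cdot> pr1 s \<cdot> pr1 (pr2 s) \<cdot>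
         pr1 t \<cdot> pr1 (pr2 t) \<cdot> pr2 (pr2 s) \<cdot> pr2 (pr2 t) \<cdot> pr1 w \<cdot> b \<cdot> pr2 w))"

lemma comp_law: "provable comp_law_type"
  by (rule provableI[where Ls = "[fib_map_eq_type, square_paste_type]" and t = "comp_law_proof (lem 0) (lem 1)"])
    (simp only: evals fib_map_eq_type_def square_paste_type_def comp_law_type_def comp_law_proof_def fibs paste_def comp_rhs_def,
     simp only: list.pred_inject fib_map_eq square_paste simp_thms)

subsection \<open>Equivalence on arrows\<close>

definition fib_map_fn :: "expr \<Rightarrow> expr \<Rightarrow> expr" where
  "fib_map_fn x y = (\<^bold>\<lambda>s. fib_map x y (pr1 s) (pr1 (pr2 s)) (pr2 (pr2 s)))"

text \<open>
  The value of a map of fibres at the canonical point over \<open>f a\<close>.  Its first component, as a function of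
  \<open>a\<close>, is the map on domains that is recovered from an arrow of families.
\<close>

definition at_refl :: "expr \<Rightarrow> expr \<Rightarrow> expr \<Rightarrow> expr" where
  "at_refl x \<mu> a = \<mu> \<cdot> (fn x \<cdot> a) \<cdot> \<langle>a, refl\<rangle>"

definition lifted :: "expr \<Rightarrow> expr \<Rightarrow> expr" where
  "lifted x \<mu> = (\<^bold>\<lambda>a. pr1 (at_refl x \<mu> a))"

text \<open>
  Function extensionality for the homotopies that occur here is repackaged as a section and a
  retraction of the map from paths to homotopies.  As variables of the right types they are opaque,
  which keeps the normal forms in the proof of the equivalence small.
\<close>

definition funext_map :: "expr \<Rightarrow> expr \<Rightarrow> expr" where
  "funext_map x y = (\<Pi>(u : dom x \<rightarrow> dom y). \<Pi>(v : cod x \<rightarrow> cod y).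
     (\<Pi>(a : dom x). eq (cod y) (fn y \<cdot> (u \<cdot> a)) (v \<cdot> (fn x \<cdot> a))) \<rightarrow> eq (dom x \<rightarrow> cod y) (fn y \<odot> u) (v \<odot> fn x))"

definition funext_sec :: "expr \<Rightarrow> expr \<Rightarrow> expr \<Rightarrow> expr" where
  "funext_sec x y s = (\<Pi>(u : dom x \<rightarrow> dom y). \<Pi>(v : cod x \<rightarrow> cod y).
     \<Pi>(H : \<Pi>(a : dom x). eq (cod y) (fn y \<cdot> (u \<cdot> a)) (v \<cdot> (fn x \<cdot> a))).
       eq (\<Pi>(a : dom x). eq (cod y) (fn y \<cdot> (u \<cdot> a)) (v \<cdot> (fn x \<cdot> a)))
         (\<^bold>\<lambda>a. htpy (cod y) (fn y \<odot> u) a (s \<cdot> u \<cdot> v \<cdot> H)) H)"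

definition funext_ret :: "expr \<Rightarrow> expr \<Rightarrow> expr \<Rightarrow> expr" where
  "funext_ret x y r = (\<Pi>(u : dom x \<rightarrow> dom y). \<Pi>(v : cod x \<rightarrow> cod y).
     \<Pi>(\<alpha> : eq (dom x \<rightarrow> cod y) (fn y \<odot> u) (v \<odot> fn x)).
       eq (eq (dom x \<rightarrow> cod y) (fn y \<odot> u) (v \<odot> fn x)) (r \<cdot> u \<cdot> v \<cdot> (\<^bold>\<lambda>a. htpy (cod y) (fn y \<odot> u) a \<alpha>)) \<alpha>)"

definition funexts_type :: expr where
  "funexts_type = (\<Pi>(x : Map_ob 0). \<Pi>(y : Map_ob 0).
     (\<Sigma>(s : funext_map x y). funext_sec x y s) \<otimes> (\<Sigma>(r : funext_map x y). funext_ret x y r))"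

definition fe_at :: "expr \<Rightarrow> expr \<Rightarrow> expr \<Rightarrow> expr \<Rightarrow> expr \<Rightarrow> expr" where
  "fe_at fe x y u v = fe \<cdot> dom x \<cdot> (\<^bold>\<lambda>_. cod y) \<cdot> (fn y \<odot> u) \<cdot> (v \<odot> fn x)"

definition funexts_proof :: "expr \<Rightarrow> expr" where
  "funexts_proof fe = (\<^bold>\<lambda>x y. \<langle>
     \<langle>\<^bold>\<lambda>u v. sec (fe_at fe x y u v), \<^bold>\<lambda>u v. sec_eq (fe_at fe x y u v)\<rangle>,
     \<langle>\<^bold>\<lambda>u v. ret (fe_at fe x y u v), \<^bold>\<lambda>u v. ret_eq (fe_at fe x y u v)\<rangle>\<rangle>)"

lemmas unfibs = fib_map_fn_def at_refl_def lifted_def fe_at_def funext_map_def funext_sec_def funext_ret_def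
  funexts_type_def funexts_proof_def

lemma funexts: "provable funexts_type"
  by (rule provableI[where Ls = "[funext_type 0 0]" and t = "funexts_proof (lem 0)"])
    (simp only: evals fibs unfibs eqv funext_type_def,
     simp only: list.pred_inject funext simp_thms)

definition arrow_sec_type :: expr where
  "arrow_sec_type = (\<Pi>(x : Map_ob 0). \<Pi>(y : Map_ob 0). \<Pi>(v : cod x \<rightarrow> cod y).
     \<Pi>(\<mu> : \<Pi>(b : cod x). fibre x b \<rightarrow> fibre y (v \<cdot> b)).
     \<Pi>(\<alpha> : eq (dom x \<rightarrow> cod y) (fn y \<odot> lifted x \<mu>) (v \<odot> fn x)).
     eq (\<Pi>(a : dom x). eq (cod y) (fn y \<cdot> pr1 (at_refl x \<mu> a)) (v \<cdot> (fn x \<cdot> a)))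
        (\<^bold>\<lambda>a. htpy (cod y) (fn y \<odot> lifted x \<mu>) a \<alpha>) (\<^bold>\<lambda>a. pr2 (at_refl x \<mu> a)) \<rightarrow>
     (\<Pi>(b : cod x). \<Pi>(w : fibre x b). eq (fibre y (v \<cdot> b))
       \<langle>pr1 (at_refl x \<mu> (pr1 w)), square (cod y) (fn y) (lifted x \<mu>) v (pr1 w) \<alpha> (pr2 w)\<rangle> (\<mu> \<cdot> b \<cdot> w)))"

definition arrow_sec_proof :: expr where
  "arrow_sec_proof = (\<^bold>\<lambda>x y v \<mu> \<alpha> K b w.
     path_ind (\<^bold>\<lambda>b p. eq (fibre y (v \<cdot> b))
       \<langle>pr1 (at_refl x \<mu> (pr1 w)), square (cod y) (fn y) (lifted x \<mu>) v (pr1 w) \<alpha> p\<rangle>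
       (\<mu> \<cdot> b \<cdot> \<langle>pr1 w, p\<rangle>))
      (path_ind (\<^bold>\<lambda>k _. eq (fibre y (v \<cdot> (fn x \<cdot> pr1 w)))
         \<langle>pr1 (at_refl x \<mu> (pr1 w)), htpy (cod y) (fn y \<odot> lifted x \<mu>) (pr1 w) \<alpha>\<rangle>
         \<langle>pr1 (at_refl x \<mu> (pr1 w)), k \<cdot> pr1 w\<rangle>)
        refl K) (pr2 w))"

text \<open>
  Recovering a square from a map of fibres and applying the functor gives the map back.  Induction on
  the path in the fibre leaves the point \<open>(a, refl)\<close>; there, induction on the homotopy \<open>K\<close> between
  the two path components applies.
\<close>

lemma arrow_sec: "provable arrow_sec_type"
  by (rule provableI[where Ls = "[]" and t = "arrow_sec_proof"])
    (simp only: evals fibs unfibs eqv arrow_sec_type_def arrow_sec_proof_def,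
     simp only: list.pred_inject simp_thms)

definition unfib :: "expr \<Rightarrow> expr \<Rightarrow> expr \<Rightarrow> expr" where
  "unfib x s \<phi> = \<langle>lifted x (pr2 \<phi>), \<langle>pr1 \<phi>, s \<cdot> lifted x (pr2 \<phi>) \<cdot> pr1 \<phi> \<cdot> (\<^bold>\<lambda>a. pr2 (at_refl x (pr2 \<phi>) a))\<rangle>\<rangle>"

definition arrow_equiv_gen_type :: expr where
  "arrow_equiv_gen_type = (\<Pi>(x : Map_ob 0). \<Pi>(y : Map_ob 0). \<Pi>(s : funext_map x y). \<Pi>(K : funext_sec x y s).
     \<Pi>(r : funext_map x y). \<Pi>(R : funext_ret x y r).
     is_equiv (Map_arrow x y) (Fam_arrow x y) (fib_map_fn x y))"

definition arrow_equiv_gen_proof :: "expr \<Rightarrow> expr \<Rightarrow> expr" where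
  "arrow_equiv_gen_proof fam_eq asec = (\<^bold>\<lambda>x y s K r R.
     \<langle>\<langle>\<^bold>\<lambda>\<phi>. unfib x s \<phi>,
       \<^bold>\<lambda>\<phi>. fam_eq \<cdot> cod x \<cdot> (\<^bold>\<lambda>b. fibre x b) \<cdot> cod y \<cdot> (\<^bold>\<lambda>b. fibre y b) \<cdot> pr1 \<phi> \<cdot>
         (\<^bold>\<lambda>b w. \<langle>pr1 (at_refl x (pr2 \<phi>) (pr1 w)), square (cod y) (fn y) (lifted x (pr2 \<phi>)) (pr1 \<phi>) (pr1 w)
          (s \<cdot> lifted x (pr2 \<phi>) \<cdot> pr1 \<phi> \<cdot> (\<^bold>\<lambda>a. pr2 (at_refl x (pr2 \<phi>) a))) (pr2 w)\<rangle>) \<cdot>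
         pr2 \<phi> \<cdot> (asec \<cdot> x \<cdot> y \<cdot> pr1 \<phi> \<cdot> pr2 \<phi> \<cdot>
           (s \<cdot> lifted x (pr2 \<phi>) \<cdot> pr1 \<phi> \<cdot> (\<^bold>\<lambda>a. pr2 (at_refl x (pr2 \<phi>) a))) \<cdot>
           (K \<cdot> lifted x (pr2 \<phi>) \<cdot> pr1 \<phi> \<cdot> (\<^bold>\<lambda>a. pr2 (at_refl x (pr2 \<phi>) a))))\<rangle>,
      \<langle>\<^bold>\<lambda>\<phi>. unfib x r \<phi>,
       \<^bold>\<lambda>s. path_ind (\<^bold>\<lambda>q _. eq (Map_arrow x y)
           \<langle>pr1 s, \<langle>pr1 (pr2 s), r \<cdot> pr1 s \<cdot> pr1 (pr2 s) \<cdot>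
             (\<^bold>\<lambda>a. htpy (cod y) (fn y \<odot> pr1 s) a (pr2 (pr2 s)))\<rangle>\<rangle>
           \<langle>pr1 s, \<langle>pr1 (pr2 s), q\<rangle>\<rangle>) refl
         (R \<cdot> pr1 s \<cdot> pr1 (pr2 s) \<cdot> pr2 (pr2 s))\<rangle>\<rangle>)"

text \<open>The two inverses use the section and the retraction respectively.\<close>

lemma arrow_equiv_gen: "provable arrow_equiv_gen_type"
  by (rule provableI[where Ls = "[Fam_eq_type, arrow_sec_type]" and
      t = "arrow_equiv_gen_proof (lem 0) (lem 1)"])
    (simp only: evals fibs unfibs Fam_eq_type_def arrow_sec_type_def arrow_equiv_gen_type_def arrow_equiv_gen_proof_def unfib_def,
     simp only: list.pred_inject Fam_eq arrow_sec simp_thms)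

definition arrow_equiv_type :: expr where
  "arrow_equiv_type = (\<Pi>(x : Map_ob 0). \<Pi>(y : Map_ob 0).
     is_equiv (Map_arrow x y) (Fam_arrow x y) (fib_map_fn x y))"

definition arrow_equiv_proof :: "expr \<Rightarrow> expr \<Rightarrow> expr" where
  "arrow_equiv_proof fes gen = (\<^bold>\<lambda>x y. gen \<cdot> x \<cdot> y \<cdot> sec (fes \<cdot> x \<cdot> y) \<cdot> sec_eq (fes \<cdot> x \<cdot> y) \<cdot>
     ret (fes \<cdot> x \<cdot> y) \<cdot> ret_eq (fes \<cdot> x \<cdot> y))"

lemma arrow_equiv: "provable arrow_equiv_type"
  by (rule provableI[where Ls = "[funexts_type, arrow_equiv_gen_type]" and
      t = "arrow_equiv_proof (lem 0) (lem 1)"])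
    (simp only: evals fibs unfibs eqv arrow_equiv_gen_type_def arrow_equiv_type_def arrow_equiv_proof_def,
     simp only: list.pred_inject funexts arrow_equiv_gen simp_thms)

subsection \<open>Equivalence on objects\<close>

definition total :: "expr \<Rightarrow> expr" where
  "total X = (\<Sigma>(x : pr1 X). pr2 X \<cdot> x)"

definition total_fib_equiv_type :: expr where
  "total_fib_equiv_type = (\<Pi>(X : Fam_ob 0). \<Pi>(b : pr1 X).
     equiv (fib (total X) (pr1 X) (\<^bold>\<lambda>w. pr1 w) b) (pr2 X \<cdot> b))"

definition total_fib_equiv_proof :: expr where
  "total_fib_equiv_proof = (\<^bold>\<lambda>X b.
     \<langle>\<^bold>\<lambda>z. path_ind (\<^bold>\<lambda>b' _. pr2 X \<cdot> b') (pr2 (pr1 z)) (pr2 z),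
      \<langle>\<langle>\<^bold>\<lambda>c. \<langle>\<langle>b, c\<rangle>, refl\<rangle>, \<^bold>\<lambda>c. refl\<rangle>,
       \<langle>\<^bold>\<lambda>c. \<langle>\<langle>b, c\<rangle>, refl\<rangle>,
        \<^bold>\<lambda>z. path_ind (\<^bold>\<lambda>b' p. eq (fib (total X) (pr1 X) (\<^bold>\<lambda>w. pr1 w) b')
            \<langle>\<langle>b', path_ind (\<^bold>\<lambda>b'' _. pr2 X \<cdot> b'') (pr2 (pr1 z)) p\<rangle>, refl\<rangle> \<langle>pr1 z, p\<rangle>) refl (pr2 z)\<rangle>\<rangle>\<rangle>)"

text \<open>
  The fibre of the projection over \<open>b\<close> is \<open>P b\<close>: transport along the path in the fibre.
\<close>

lemma total_fib_equiv: "provable total_fib_equiv_type"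
  by (rule provableI[where Ls = "[]" and t = total_fib_equiv_proof])
    (simp only: evals total_def total_fib_equiv_type_def total_fib_equiv_proof_def Fam_ob_def,
     simp only: list.pred_inject simp_thms)

definition fib_total_equiv_type :: expr where
  "fib_total_equiv_type = (\<Pi>(x : Map_ob 0).
     is_equiv (dom x) (\<Sigma>(b : cod x). fibre x b) (\<^bold>\<lambda>a. \<langle>fn x \<cdot> a, \<langle>a, refl\<rangle>\<rangle>))"

definition fib_total_equiv_proof :: expr where
  "fib_total_equiv_proof = (\<^bold>\<lambda>x.
     \<langle>\<langle>\<^bold>\<lambda>w. pr1 (pr2 w),
       \<^bold>\<lambda>w. path_ind (\<^bold>\<lambda>b p. eq (\<Sigma>(b : cod x). fibre x b)
          \<langle>fn x \<cdot> pr1 (pr2 w), \<langle>pr1 (pr2 w), refl\<rangle>\<rangle> \<langle>b, \<langle>pr1 (pr2 w), p\<rangle>\<rangle>) refl (pr2 (pr2 w))\<rangle>,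
      \<langle>\<^bold>\<lambda>w. pr1 (pr2 w), \<^bold>\<lambda>a. refl\<rangle>\<rangle>)"

text \<open>
  The domain of a map is the total space of its fibres, by contractibility of singletons.
\<close>

lemma fib_total_equiv: "provable fib_total_equiv_type"
  by (rule provableI[where Ls = "[]" and t = fib_total_equiv_proof])
    (simp only: evals fibre_def Map_ob_def arrows fib_total_equiv_type_def fib_total_equiv_proof_def,
     simp only: list.pred_inject simp_thms)

definition equiv_ind_goal :: "expr \<Rightarrow> expr \<Rightarrow> expr \<Rightarrow> expr" where
  "equiv_ind_goal A A' f = (\<Pi>(B : \<U> 0). \<Pi>(h : A' \<rightarrow> B).
     eq (Map_ob 0) \<langle>A', \<langle>B, h\<rangle>\<rangle> \<langle>A, \<langle>B, \<^bold>\<lambda>a. h \<cdot> (f \<cdot> a)\<rangle>\<rangle>)"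

definition equiv_ind_type :: expr where
  "equiv_ind_type = (\<Pi>(A : \<U> 0). \<Pi>(A' : \<U> 0). \<Pi>(e : equiv A A'). equiv_ind_goal A A' (pr1 e))"

definition equiv_ind_proof :: "expr \<Rightarrow> expr" where
  "equiv_ind_proof ua = (\<^bold>\<lambda>A A' e.
     path_ind (\<^bold>\<lambda>e _. equiv_ind_goal A A' (pr1 e))
       (path_ind (\<^bold>\<lambda>A' p. equiv_ind_goal A A' (pr1 (id_to_equiv A \<cdot> p))) (\<^bold>\<lambda>B h. refl)
          (sec (ua \<cdot> A \<cdot> A') \<cdot> e))
       (sec_eq (ua \<cdot> A \<cdot> A') \<cdot> e))"

text \<open>
  Equivalence induction for a goal about maps out of a type.  By univalence the equivalence comes
  from a path of types, and for the reflexivity path the goal is \<open>refl\<close>.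
\<close>

lemma equiv_ind: "provable equiv_ind_type"
  by (rule provableI[where Ls = "[univalence_type 0]" and t = "equiv_ind_proof (lem 0)"])
    (simp only: evals univalence_type_def equiv_ind_type_def equiv_ind_proof_def equiv_ind_goal_def eqv Map_ob_def,
     simp only: list.pred_inject ua simp_thms)

definition chi_equiv_type :: expr where
  "chi_equiv_type = is_equiv (Map_ob 0) (Fam_ob 0) \<chi>"

definition inverse_obj :: expr where
  "inverse_obj = (\<^bold>\<lambda>X. \<langle>total X, \<langle>pr1 X, \<^bold>\<lambda>w. pr1 w\<rangle>\<rangle>)"

definition chi_equiv_proof :: "expr \<Rightarrow> expr \<Rightarrow> expr \<Rightarrow> expr \<Rightarrow> expr \<Rightarrow> expr" where
  "chi_equiv_proof fe1 ua tf ft ei =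
    \<langle>\<langle>inverse_obj, \<^bold>\<lambda>X. path_ind (\<^bold>\<lambda>\<psi> _. eq (Fam_ob 0)
        \<langle>pr1 X, \<^bold>\<lambda>b. fib (total X) (pr1 X) (\<^bold>\<lambda>w. pr1 w) b\<rangle> \<langle>pr1 X, \<psi>\<rangle>) refl
      (sec (fe1 \<cdot> pr1 X \<cdot> (\<^bold>\<lambda>_. \<U> 0) \<cdot> (\<^bold>\<lambda>b. fib (total X) (pr1 X) (\<^bold>\<lambda>w. pr1 w) b) \<cdot> pr2 X) \<cdot>
       (\<^bold>\<lambda>b. sec (ua \<cdot> fib (total X) (pr1 X) (\<^bold>\<lambda>w. pr1 w) b \<cdot> (pr2 X \<cdot> b)) \<cdot> (tf \<cdot> X \<cdot> b)))\<rangle>,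
     \<langle>inverse_obj, \<^bold>\<lambda>x. ei \<cdot> dom x \<cdot> (\<Sigma>(b : cod x). fibre x b) \<cdot> \<langle>\<^bold>\<lambda>a. \<langle>fn x \<cdot> a, \<langle>a, refl\<rangle>\<rangle>, ft \<cdot> x\<rangle> \<cdot> cod x \<cdot> (\<^bold>\<lambda>w. pr1 w)\<rangle>\<rangle>"

text \<open>
  For families, extensionality and univalence give an identification of \<open>\<lambda>b. fib pr1 b\<close> with the family.
  For maps, \<open>equiv_ind\<close> is applied to the equivalence of the domain with the total space of the fibres;
  composed with the projection it is the original map.
\<close>

lemma chi_equiv: "provable chi_equiv_type"
  by (rule provableI[where Ls = "[funext_type 0 1, univalence_type 0, total_fib_equiv_type, fib_total_equiv_type, equiv_ind_type]" and
      t = "chi_equiv_proof (lem 0) (lem 1) (lem 2) (lem 3) (lem 4)"])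
    (simp only: evals funext_type_def univalence_type_def total_fib_equiv_type_def fib_total_equiv_type_def equiv_ind_type_def equiv_ind_goal_def eqv Map_ob_def Fam_ob_def chi_equiv_type_def chi_equiv_proof_def inverse_obj_def total_def fibre_def arrows \<chi>_def,
     simp only: list.pred_inject funext1 ua total_fib_equiv fib_total_equiv equiv_ind simp_thms)

subsection \<open>The category laws\<close>

definition paste_assoc_type :: expr where
  "paste_assoc_type = (\<Pi>(A : \<U> 0). \<Pi>(B : \<U> 0). \<Pi>(C : \<U> 0). \<Pi>(D : \<U> 0).
     \<Pi>(E : \<U> 0). \<Pi>(F : \<U> 0). \<Pi>(G : \<U> 0). \<Pi>(H : \<U> 0).
     \<Pi>(f : A \<rightarrow> B). \<Pi>(g : C \<rightarrow> D). \<Pi>(h : E \<rightarrow> F). \<Pi>(k : G \<rightarrow> H).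
     \<Pi>(u : A \<rightarrow> C). \<Pi>(v : B \<rightarrow> D). \<Pi>(m : C \<rightarrow> E). \<Pi>(n : D \<rightarrow> F). \<Pi>(r : E \<rightarrow> G). \<Pi>(s : F \<rightarrow> H).
     \<Pi>(\<alpha> : eq (A \<rightarrow> D) (g \<odot> u) (v \<odot> f)). \<Pi>(\<beta> : eq (C \<rightarrow> F) (h \<odot> m) (n \<odot> g)).
     \<Pi>(\<gamma> : eq (E \<rightarrow> H) (k \<odot> r) (s \<odot> h)).
       eq (eq (A \<rightarrow> H) (k \<odot> (r \<odot> (m \<odot> u))) ((s \<odot> (n \<odot> v)) \<odot> f))
         (paste A H k r (m \<odot> u) h s (paste A F h m u g n \<alpha> \<beta>) \<gamma>)
         (paste A H k (r \<odot> m) u g (s \<odot> n) \<alpha> (paste C H k r m h s \<beta> \<gamma>)))"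

definition paste_assoc_proof :: expr where
  "paste_assoc_proof = (\<^bold>\<lambda>A B C D E F G H f g h k u v m n r s \<alpha> \<beta> \<gamma>.
     path_ind (\<^bold>\<lambda>V \<alpha>'. eq (eq (A \<rightarrow> H) (k \<odot> (r \<odot> (m \<odot> u))) ((s \<odot> n) \<odot> V))
         (paste A H k r (m \<odot> u) h s (paste A F h m u g n \<alpha>' \<beta>) \<gamma>)
         (paste A H k (r \<odot> m) u g (s \<odot> n) \<alpha>' (paste C H k r m h s \<beta> \<gamma>)))
      (path_ind (\<^bold>\<lambda>V \<beta>'. eq (eq (A \<rightarrow> H) (k \<odot> (r \<odot> (m \<odot> u))) (s \<odot> (V \<odot> u)))
         (paste A H k r (m \<odot> u) h s (ap (A \<rightarrow> F) (\<^bold>\<lambda>q. q \<odot> u) (h \<odot> m) \<beta>') \<gamma>)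
         (ap (A \<rightarrow> H) (\<^bold>\<lambda>q. q \<odot> u) (k \<odot> (r \<odot> m)) (paste C H k r m h s \<beta>' \<gamma>)))
       (path_ind (\<^bold>\<lambda>V \<gamma>'. eq (eq (A \<rightarrow> H) (k \<odot> (r \<odot> (m \<odot> u))) (V \<odot> (m \<odot> u)))
         (ap (A \<rightarrow> H) (\<^bold>\<lambda>q. q \<odot> (m \<odot> u)) (k \<odot> r) \<gamma>')
         (ap (A \<rightarrow> H) (\<^bold>\<lambda>q. q \<odot> u) (k \<odot> (r \<odot> m)) (ap (C \<rightarrow> H) (\<^bold>\<lambda>q. q \<odot> m) (k \<odot> r) \<gamma>')))
        refl \<gamma>) \<beta>) \<alpha>)"

text \<open>
  Associativity of composition in \<open>Map\<close> holds judgementally on the functions, so only the paths have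
  to be compared; after induction on the three of them both sides are \<open>refl\<close>.
\<close>

lemma paste_assoc: "provable paste_assoc_type"
  by (rule provableI[where Ls = "[]" and t = paste_assoc_proof])
    (simp only: evals paste_assoc_type_def paste_assoc_proof_def paste_def,
     simp only: list.pred_inject simp_thms)

definition unit_left_type :: expr where
  "unit_left_type = (\<Pi>(A : \<U> 0). \<Pi>(B : \<U> 0). \<Pi>(X : \<U> 0). \<Pi>(Y : \<U> 0).
     \<Pi>(f : A \<rightarrow> B). \<Pi>(g : X \<rightarrow> Y). \<Pi>(m : A \<rightarrow> X). \<Pi>(n : B \<rightarrow> Y).
     \<Pi>(\<beta> : eq (A \<rightarrow> Y) (g \<odot> m) (n \<odot> f)).
       eq (eq (A \<rightarrow> Y) (g \<odot> m) (n \<odot> f)) (ap (A \<rightarrow> Y) (\<^bold>\<lambda>q. q) (g \<odot> m) \<beta>) \<beta>)"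

definition unit_left_proof :: expr where
  "unit_left_proof = (\<^bold>\<lambda>A B X Y f g m n \<beta>.
     path_ind (\<^bold>\<lambda>V \<beta>'. eq (eq (A \<rightarrow> Y) (g \<odot> m) V) (ap (A \<rightarrow> Y) (\<^bold>\<lambda>q. q) (g \<odot> m) \<beta>') \<beta>') refl \<beta>)"

text \<open>
  On functions the unit laws are judgemental too.  Composition with an identity maps a path by the
  identity function, and on one side also concatenates it with \<open>refl\<close>.
\<close>

lemma unit_left: "provable unit_left_type"
  by (rule provableI[where Ls = "[]" and t = unit_left_proof])
    (simp only: evals unit_left_type_def unit_left_proof_def,
     simp only: list.pred_inject simp_thms)

definition unit_right_type :: expr where
  "unit_right_type = (\<Pi>(A : \<U> 0). \<Pi>(B : \<U> 0). \<Pi>(X : \<U> 0). \<Pi>(Y : \<U> 0).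
     \<Pi>(f : A \<rightarrow> B). \<Pi>(g : X \<rightarrow> Y). \<Pi>(m : A \<rightarrow> X). \<Pi>(n : B \<rightarrow> Y).
     \<Pi>(\<alpha> : eq (A \<rightarrow> Y) (g \<odot> m) (n \<odot> f)).
       eq (eq (A \<rightarrow> Y) (g \<odot> m) (n \<odot> f))
         (concat (A \<rightarrow> Y) (g \<odot> m) refl (ap (A \<rightarrow> Y) (\<^bold>\<lambda>q. q) (g \<odot> m) \<alpha>)) \<alpha>)"

definition unit_right_proof :: expr where
  "unit_right_proof = (\<^bold>\<lambda>A B X Y f g m n \<alpha>.
     path_ind (\<^bold>\<lambda>V \<alpha>'. eq (eq (A \<rightarrow> Y) (g \<odot> m) V)
        (concat (A \<rightarrow> Y) (g \<odot> m) refl (ap (A \<rightarrow> Y) (\<^bold>\<lambda>q. q) (g \<odot> m) \<alpha>')) \<alpha>') refl \<alpha>)"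

lemma unit_right: "provable unit_right_type"
  by (rule provableI[where Ls = "[]" and t = unit_right_proof])
    (simp only: evals unit_right_type_def unit_right_proof_def,
     simp only: list.pred_inject simp_thms)

text \<open>An identification of paths yields one of squares with the same functions.\<close>

definition square_eq :: "expr \<Rightarrow> expr \<Rightarrow> expr \<Rightarrow> expr \<Rightarrow> expr \<Rightarrow> expr" where
  "square_eq T u v p q = path_ind (\<^bold>\<lambda>p' _. eq T \<langle>u, \<langle>v, p\<rangle>\<rangle> \<langle>u, \<langle>v, p'\<rangle>\<rangle>) refl q"

definition Map_laws_proof :: "expr \<Rightarrow> expr \<Rightarrow> expr \<Rightarrow> expr" where
  "Map_laws_proof as ul ur =
    \<langle>\<^bold>\<lambda>w x y z s t r.
      square_eq (Map_arrow w z) (pr1 r \<odot> (pr1 t \<odot> pr1 s)) (pr1 (pr2 r) \<odot> (pr1 (pr2 t) \<odot> pr1 (pr2 s)))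
       (paste (dom w) (cod z) (fn z) (pr1 r) (pr1 t \<odot> pr1 s) (fn y) (pr1 (pr2 r))
         (paste (dom w) (cod y) (fn y) (pr1 t) (pr1 s) (fn x) (pr1 (pr2 t)) (pr2 (pr2 s)) (pr2 (pr2 t)))
         (pr2 (pr2 r)))
       (as \<cdot> dom w \<cdot> cod w \<cdot> dom x \<cdot> cod x \<cdot> dom y \<cdot> cod y \<cdot> dom z \<cdot> cod z \<cdot> fn w \<cdot> fn x \<cdot> fn y \<cdot> fn z \<cdot>
         pr1 s \<cdot> pr1 (pr2 s) \<cdot> pr1 t \<cdot> pr1 (pr2 t) \<cdot> pr1 r \<cdot> pr1 (pr2 r) \<cdot>
         pr2 (pr2 s) \<cdot> pr2 (pr2 t) \<cdot> pr2 (pr2 r)),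
     \<langle>\<^bold>\<lambda>x y s. square_eq (Map_arrow x y) (pr1 s) (pr1 (pr2 s))
        (ap (dom x \<rightarrow> cod y) (\<^bold>\<lambda>q. q) (fn y \<odot> pr1 s) (pr2 (pr2 s)))
        (ul \<cdot> dom x \<cdot> cod x \<cdot> dom y \<cdot> cod y \<cdot> fn x \<cdot> fn y \<cdot> pr1 s \<cdot> pr1 (pr2 s) \<cdot> pr2 (pr2 s)),
      \<^bold>\<lambda>x y s. square_eq (Map_arrow x y) (pr1 s) (pr1 (pr2 s))
        (concat (dom x \<rightarrow> cod y) (fn y \<odot> pr1 s) refl (ap (dom x \<rightarrow> cod y) (\<^bold>\<lambda>q. q) (fn y \<odot> pr1 s) (pr2 (pr2 s))))
        (ur \<cdot> dom x \<cdot> cod x \<cdot> dom y \<cdot> cod y \<cdot> fn x \<cdot> fn y \<cdot> pr1 s \<cdot> pr1 (pr2 s) \<cdot> pr2 (pr2 s))\<rangle>\<rangle>"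

text \<open>
  In \<open>Fam\<close> both sides of each law are equal judgementally, by eta for functions and pairs.
\<close>

definition Fam_laws_proof :: expr where
  "Fam_laws_proof = \<langle>\<^bold>\<lambda>w x y z s t r. refl, \<langle>\<^bold>\<lambda>x y s. refl, \<^bold>\<lambda>x y s. refl\<rangle>\<rangle>"

section \<open>The isomorphism of wild categories\<close>

text \<open>
  The types of objects, arrows, identities and composition, for a wild category whose data occupy the
  depths \<open>n\<close>, \<open>n + 1\<close>, \<open>n + 2\<close> and \<open>n + 3\<close>.
\<close>

definition wildcat_data_types :: "nat \<Rightarrow> expr list" where
  "wildcat_data_types n = (let Ob = lem n; Hom = lem (Suc n) in
     [\<U> 1, Ob \<rightarrow> Ob \<rightarrow> \<U> 0, \<Pi>(x : Ob). Hom \<cdot> x \<cdot> x,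
      \<Pi>(x : Ob). \<Pi>(y : Ob). \<Pi>(z : Ob). Hom \<cdot> x \<cdot> y \<rightarrow> Hom \<cdot> y \<cdot> z \<rightarrow> Hom \<cdot> x \<cdot> z])"

text \<open>
  Two wild categories without their laws, at depths \<open>0\<close> to \<open>3\<close> and \<open>4\<close> to \<open>7\<close>, and the action of a
  functor on objects (\<open>8\<close>) and on arrows (\<open>9\<close>).
\<close>

definition iso_data_types :: "expr list" where
  "iso_data_types = wildcat_data_types 0 @ wildcat_data_types 4 @ [lem 0 \<rightarrow> lem 4,
     \<Pi>(x : lem 0). \<Pi>(y : lem 0). lem 1 \<cdot> x \<cdot> y \<rightarrow> lem 5 \<cdot> (lem 8 \<cdot> x) \<cdot> (lem 8 \<cdot> y)]"

definition iso_data :: "expr list" where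
  "iso_data = [Map_ob 0, Map_hom, Map_id, Map_cmp, Fam_ob 0, Fam_hom, Fam_id, Fam_cmp, \<chi>,
     \<^bold>\<lambda>x y. fib_map_fn x y]"

text \<open>
  What remains to be known about such data: the laws of both categories, functoriality, and being an
  equivalence on objects and on arrows.
\<close>

definition iso_law_types :: "expr list" where
  "iso_law_types =
    [wildcat_laws (lem 0) (lem 1) (lem 2) (lem 3), wildcat_laws (lem 4) (lem 5) (lem 6) (lem 7),
     \<Pi>(x : lem 0). eq (lem 5 \<cdot> (lem 8 \<cdot> x) \<cdot> (lem 8 \<cdot> x)) (lem 9 \<cdot> x \<cdot> x \<cdot> (lem 2 \<cdot> x)) (lem 6 \<cdot> (lem 8 \<cdot> x)),
     \<Pi>(x : lem 0). \<Pi>(y : lem 0). \<Pi>(z : lem 0). \<Pi>(f : lem 1 \<cdot> x \<cdot> y). \<Pi>(g : lem 1 \<cdot> y \<cdot> z).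
       eq (lem 5 \<cdot> (lem 8 \<cdot> x) \<cdot> (lem 8 \<cdot> z)) (lem 9 \<cdot> x \<cdot> z \<cdot> (lem 3 \<cdot> x \<cdot> y \<cdot> z \<cdot> f \<cdot> g))
         (lem 7 \<cdot> (lem 8 \<cdot> x) \<cdot> (lem 8 \<cdot> y) \<cdot> (lem 8 \<cdot> z) \<cdot> (lem 9 \<cdot> x \<cdot> y \<cdot> f) \<cdot> (lem 9 \<cdot> y \<cdot> z \<cdot> g)),
     is_equiv (lem 0) (lem 4) (lem 8),
     \<Pi>(x : lem 0). \<Pi>(y : lem 0).
       is_equiv (lem 1 \<cdot> x \<cdot> y) (lem 5 \<cdot> (lem 8 \<cdot> x) \<cdot> (lem 8 \<cdot> y)) (lem 9 \<cdot> x \<cdot> y)]"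

definition iso_defs :: "(expr \<times> expr) list" where
  "iso_defs = zip iso_data iso_data_types"

lemmas iso_evals = evals iso_defs_def iso_data_def iso_data_types_def iso_law_types_def wildcat_data_types_def
  wildcat_laws_def append.simps zip_Cons_Cons zip.simps(1) add_0 add_Suc nth_Cons_0 nth_Cons_Suc
  Map_hom_def Map_id_def Map_cmp_def Fam_ob_def Fam_hom_def Fam_id_def Fam_cmp_def \<chi>_def fibs unfibs

text \<open>
  Each of the six properties holds for the maps, families and fibres at hand.  A result that was proved
  about explicit terms becomes a statement about the defined constants simply because both have the
  same normal form.
\<close>

lemma Fam_laws_inhabited: "inhabited (subst (extend Var (map (\<lambda>d. fst d 0) iso_defs)) ((iso_law_types ! 1) 10))"
  by (rule inhabited_in[where Ls = "[]" and t = Fam_laws_proof])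
    (simp only: iso_evals Fam_laws_proof_def,
     simp only: list.pred_inject simp_thms)

lemma chi_id_inhabited: "inhabited (subst (extend Var (map (\<lambda>d. fst d 0) iso_defs)) ((iso_law_types ! 2) 10))"
  by (rule inhabited_in[where Ls = "[id_law_type]" and t = "lem 0"])
    (simp only: iso_evals id_law_type_def,
     simp only: list.pred_inject id_law simp_thms)

lemma chi_comp_inhabited: "inhabited (subst (extend Var (map (\<lambda>d. fst d 0) iso_defs)) ((iso_law_types ! 3) 10))"
  by (rule inhabited_in[where Ls = "[comp_law_type]" and t = "lem 0"])
    (simp only: iso_evals comp_law_type_def comp_rhs_def paste_def,
     simp only: list.pred_inject comp_law simp_thms)

lemma chi_equiv_inhabited: "inhabited (subst (extend Var (map (\<lambda>d. fst d 0) iso_defs)) ((iso_law_types ! 4) 10))"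
  by (rule inhabited_in[where Ls = "[chi_equiv_type]" and t = "lem 0"])
    (simp only: iso_evals chi_equiv_type_def,
     simp only: list.pred_inject chi_equiv simp_thms)

lemma chi_arrows_inhabited: "inhabited (subst (extend Var (map (\<lambda>d. fst d 0) iso_defs)) ((iso_law_types ! 5) 10))"
  by (rule inhabited_in[where Ls = "[arrow_equiv_type]" and t = "lem 0"])
    (simp only: iso_evals arrow_equiv_type_def,
     simp only: list.pred_inject arrow_equiv simp_thms)

lemma Map_laws_inhabited: "inhabited (subst (extend Var (map (\<lambda>d. fst d 0) iso_defs)) ((iso_law_types ! 0) 10))"
  by (rule inhabited_in[where Ls = "[paste_assoc_type, unit_left_type, unit_right_type]" and
     t = "Map_laws_proof (lem 0) (lem 1) (lem 2)"])
    (simp only: iso_evals Map_laws_proof_def square_eq_def paste_def paste_assoc_type_def unit_left_type_def unit_right_type_def,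
     simp only: list.pred_inject paste_assoc unit_left unit_right simp_thms)

fun checks_ctx :: "tm list \<Rightarrow> bool" where
  "checks_ctx [] = True"
| "checks_ctx (T # \<Gamma>) =
     (type_of_res (nf fuel \<Gamma> (length \<Gamma>) [] (length \<Gamma>) None T) \<noteq> None \<and> checks_ctx \<Gamma>)"

lemma checks_ctx_sound: "checks_ctx \<Gamma> \<Longrightarrow> \<Gamma> ctx"
proof (induction \<Gamma>)
  case Nil
  show ?case by (rule ctx_empty)
next
  case (Cons T \<Gamma>)
  then have e: "env_ok \<Gamma> (length \<Gamma>) [] (length \<Gamma>)" by (simp add: env_ok_def)
  from Cons.prems obtain V where "has_nf \<Gamma> (length \<Gamma>) [] (length \<Gamma>) T V"
    by (auto simp: has_nf_def type_of_res_Some)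
  from has_nf_sound(4)[OF this e] show ?case
    unfolding env_ok_id(2)[OF e] by (auto simp: is_type_def intro: ctx_extend)
qed

definition wild_record :: "expr \<Rightarrow> expr \<Rightarrow> expr \<Rightarrow> expr \<Rightarrow> expr \<Rightarrow> expr" where
  "wild_record Ob Hom ide cp laws = \<langle>Ob, \<langle>Hom, \<langle>ide, \<langle>cp, laws\<rangle>\<rangle>\<rangle>\<rangle>"

text \<open>
  The two wild categories and the isomorphism, as tuples of variables of the generic context.
\<close>

definition iso_records :: "(expr \<times> expr) list" where
  "iso_records =
    [(wild_record (lem 0) (lem 1) (lem 2) (lem 3) (lem 10), wildcat 1 0),
     (wild_record (lem 4) (lem 5) (lem 6) (lem 7) (lem 11), wildcat 1 0),
     (\<langle>\<langle>lem 8, \<langle>lem 9, \<langle>lem 12, lem 13\<rangle>\<rangle>\<rangle>, \<langle>lem 14, lem 15\<rangle>\<rangle>, naive_iso (lem 16) (lem 17))]"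

text \<open>
  The data of \<open>iso_data_types\<close> followed by hypotheses for the six properties, at depths \<open>10\<close> to \<open>15\<close>.
\<close>

definition iso_context :: "tm list" where
  "iso_context = hyps 0 (tele 0 [] iso_data_types) (map (\<lambda>P. P 10) iso_law_types)"

lemmas iso_context_evals = evals iso_context_def iso_data_types_def iso_law_types_def wildcat_data_types_def
  wildcat_laws_def append.simps add_0 add_Suc add_Suc_right add_0_right hyps.simps tele.simps list.map

lemma iso_context_ctx: "iso_context ctx"
  by (rule checks_ctx_sound)
    (simp only: iso_context_evals checks_ctx.simps option.distinct simp_thms)

lemma iso_context_length: "length iso_context = 16"
  by (simp only: iso_context_evals)

text \<open>
  Besides checking the three tuples, this computes the action of the isomorphism on objects, which is
  the variable at depth \<open>8\<close>, with index \<open>7\<close> in a context of length \<open>16\<close>.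
\<close>

lemma iso_records_check:
  "eval_in iso_context 16 (Fst (Fst (Var 0))) (bind_defs iso_context 16 16 (Some []) iso_records) =
     Some (Var 7, Pi (Var 15) (Var 12))"
  by (simp only: iso_context_evals eval_in.simps iso_records_def wild_record_def wildcat_def
    naive_iso_def wildfunctor_def obj_def hom_def ident_def cmp_def on_objects_def on_arrows_def)

lemma iso_data_at: "map (\<lambda>d. fst d 0) iso_defs =
  [\<lbrakk>Map_ob 0\<rbrakk>, \<lbrakk>Map_hom\<rbrakk>, \<lbrakk>Map_id\<rbrakk>, \<lbrakk>Map_cmp\<rbrakk>, \<lbrakk>Fam_ob 0\<rbrakk>, \<lbrakk>Fam_hom\<rbrakk>, \<lbrakk>Fam_id\<rbrakk>, \<lbrakk>Fam_cmp\<rbrakk>, \<lbrakk>\<chi>\<rbrakk>,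
   \<lbrakk>\<^bold>\<lambda>x y. fib_map_fn x y\<rbrakk>]"
  by (simp add: iso_defs_def iso_data_def iso_data_types_def wildcat_data_types_def closed_tm_def Let_def)

lemmas raise_evals = closed_tm_def expr_at raise.simps add_0 add_Suc One_nat_def Let_def
  wildcat_laws_def compose_def identity_def concat_def ap_def fib_def is_equiv_def

text \<open>
  The constructions of \<open>Map\<close> and \<open>Fam\<close> mention the level only in the type of objects.
\<close>

lemma raise_Map_laws: "raise l \<lbrakk>Map_laws 0\<rbrakk> = \<lbrakk>Map_laws l\<rbrakk>"
  by (simp only: raise_evals Map_laws_def Map_ob_def Map_hom_def Map_id_def Map_cmp_def arrows)

lemma raise_Fam_laws: "raise l \<lbrakk>Fam_laws 0\<rbrakk> = \<lbrakk>Fam_laws l\<rbrakk>"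
  by (simp only: raise_evals Fam_laws_def Fam_ob_def Fam_hom_def Fam_id_def Fam_cmp_def)

lemma raise_data:
  "raise l \<lbrakk>Map_ob 0\<rbrakk> = \<lbrakk>Map_ob l\<rbrakk>" "raise l \<lbrakk>Map_hom\<rbrakk> = \<lbrakk>Map_hom\<rbrakk>" "raise l \<lbrakk>Map_id\<rbrakk> = \<lbrakk>Map_id\<rbrakk>"
  "raise l \<lbrakk>Map_cmp\<rbrakk> = \<lbrakk>Map_cmp\<rbrakk>" "raise l \<lbrakk>Fam_ob 0\<rbrakk> = \<lbrakk>Fam_ob l\<rbrakk>" "raise l \<lbrakk>Fam_hom\<rbrakk> = \<lbrakk>Fam_hom\<rbrakk>"
  "raise l \<lbrakk>Fam_id\<rbrakk> = \<lbrakk>Fam_id\<rbrakk>" "raise l \<lbrakk>Fam_cmp\<rbrakk> = \<lbrakk>Fam_cmp\<rbrakk>" "raise l \<lbrakk>\<chi>\<rbrakk> = \<lbrakk>\<chi>\<rbrakk>"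
  by (simp_all only: raise_evals Map_ob_def Map_hom_def Map_id_def Map_cmp_def arrows
     Fam_ob_def Fam_hom_def Fam_id_def Fam_cmp_def \<chi>_def)

lemma raise_wildcat: "raise l \<lbrakk>wildcat 1 0\<rbrakk> = \<lbrakk>wildcat (Suc l) l\<rbrakk>"
  by (simp only: raise_evals wildcat_def)

lemma naive_iso_subst:
  assumes "shift c = c" "shift d = d"
  shows "subst (case_nat d (case_nat c Var)) (naive_iso (lem 16) (lem 17) 18) = \<lbrakk>naive_iso (const_expr c) (const_expr d)\<rbrakk>"
  by (simp only: naive_iso_def wildfunctor_def obj_def hom_def ident_def cmp_def on_objects_def on_arrows_def is_equiv_def
    closed_tm_def expr_at lem_at eval_nat_numeral BitM.simps One_nat_def diff_Suc_Suc diff_zero subst.simps assms ren.simps nat.case)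

lemma naive_iso_raise: "raise l (naive_iso (lem 16) (lem 17) 18) = naive_iso (lem 16) (lem 17) 18"
  by (simp only: naive_iso_def wildfunctor_def obj_def hom_def ident_def cmp_def on_objects_def on_arrows_def is_equiv_def
    expr_at lem_at raise.simps)

text \<open>
  Built from closed parts, so the depth at which it is placed makes no difference.
\<close>

lemma const_Map_cat: "Map_cat l (const_expr a) = const_expr \<lbrakk>Map_cat l (const_expr a)\<rbrakk>"
  by (rule ext) (simp add: expr_at closed_tm_def Map_cat_def Map_ob_def Map_hom_def Map_id_def Map_cmp_def arrows
    identity_def compose_def concat_def ap_def Let_def)

lemma const_Fam_cat: "Fam_cat l (const_expr a) = const_expr \<lbrakk>Fam_cat l (const_expr a)\<rbrakk>"
  by (rule ext) (simp add: expr_at closed_tm_def Fam_cat_def Fam_ob_def Fam_hom_def Fam_id_def Fam_cmp_def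
    identity_def compose_def Let_def)

lemma law_types_subst:
  "subst (extend Var (map (\<lambda>d. fst d 0) iso_defs)) ((iso_law_types ! 0) 10) = \<lbrakk>Map_laws 0\<rbrakk>"
  "subst (extend Var (map (\<lambda>d. fst d 0) iso_defs)) ((iso_law_types ! 1) 10) = \<lbrakk>Fam_laws 0\<rbrakk>"
   apply (simp_all only: iso_data_at iso_law_types_def nth_Cons_0 nth_Cons_Suc One_nat_def)
   apply (simp_all only: Map_laws_def Fam_laws_def wildcat_laws_def extend.simps closed_tm_def expr_at lem_at eval_nat_numeral BitM.simps
     One_nat_def diff_Suc_Suc diff_zero subst.simps ren.simps nat.case Map_ob_def Map_hom_def Map_id_def Map_cmp_def arrows
     Fam_ob_def Fam_hom_def Fam_id_def Fam_cmp_def Let_def compose_def identity_def concat_def ap_def)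
  done

lemma closed_wildcat: "closed_at 0 \<lbrakk>wildcat i j\<rbrakk>"
  by (simp only: wildcat_def wildcat_laws_def closed_at_eval)

text \<open>The two categories are its only free variables.\<close>

lemma closed_naive_iso: "closed_at 2 (naive_iso (lem 16) (lem 17) 18)"
  by (simp add: naive_iso_def wildfunctor_def obj_def hom_def ident_def cmp_def on_objects_def on_arrows_def is_equiv_def
    expr_at lem_at)

lemma wildcat_at: "wildcat i j n = \<lbrakk>wildcat i j\<rbrakk>"
  by (simp add: wildcat_def wildcat_laws_def closed_tm_def expr_at)

lemma subst_wildcat: "subst s \<lbrakk>wildcat i j\<rbrakk> = \<lbrakk>wildcat i j\<rbrakk>" "ren r \<lbrakk>wildcat i j\<rbrakk> = \<lbrakk>wildcat i j\<rbrakk>"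
  using closed_wildcat by (simp_all add: subst_closed ren_closed)

abbreviation "iso_src k \<equiv> fst (iso_records ! k) 16"

text \<open>
  The isomorphism for arbitrary data.  It is given by its components; all the content is in the
  hypotheses of the context.
\<close>

lemma generic_iso:
  "iso_context \<turnstile> iso_src 0 : \<lbrakk>wildcat 1 0\<rbrakk>"
  "iso_context \<turnstile> iso_src 1 : \<lbrakk>wildcat 1 0\<rbrakk>"
  "iso_context \<turnstile> iso_src 2 : subst (case_nat (iso_src 1) (case_nat (iso_src 0) Var)) (naive_iso (lem 16) (lem 17) 18)"
  "iso_context \<turnstile> Fst (Fst (iso_src 2)) \<equiv> Var 7 : Pi (Var 15) (Var 12)"
proof -
  let ?G = iso_context
  let ?s = "case_nat (iso_src 2) (case_nat (iso_src 1) (case_nat (iso_src 0) Var))"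
  have e: "env_ok ?G 16 [] 16" by (simp add: env_ok_def iso_context_ctx iso_context_length)
  obtain es where es: "bind_defs ?G 16 16 (Some []) iso_records = Some es"
    using iso_records_check by (cases "bind_defs ?G 16 16 (Some []) iso_records") auto
  have v: "env_sub 16 [] 16 = Var" by auto
  have id: "sub_ok ?G (env_sub 16 [] 16) ?G"
    using ty_var[OF iso_context_ctx] iso_context_ctx
    unfolding sub_ok_def v subst_Var ctx_type_def by blast
  note x = bind_defs_sub_ok[OF es e id]
  have s: "env_sub 16 es 16 = ?s"
    unfolding conjunct2[OF x] v by (simp add: iso_records_def)
  have ok: "sub_ok (naive_iso (lem 16) (lem 17) 18 # \<lbrakk>wildcat 1 0\<rbrakk> # \<lbrakk>wildcat 1 0\<rbrakk> # ?G) ?s ?G"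
    using conjunct1[OF x] unfolding s
    by (simp add: iso_records_def wildcat_at)
  show "iso_context \<turnstile> iso_src 0 : \<lbrakk>wildcat 1 0\<rbrakk>"
    using sub_okD(2)[OF ok, of 2] by (simp add: ctx_type_def subst_wildcat numeral_2_eq_2)
  show "iso_context \<turnstile> iso_src 1 : \<lbrakk>wildcat 1 0\<rbrakk>"
    using sub_okD(2)[OF ok, of 1] by (simp add: ctx_type_def subst_wildcat)
  show "iso_context \<turnstile> iso_src 2 : subst (case_nat (iso_src 1) (case_nat (iso_src 0) Var)) (naive_iso (lem 16) (lem 17) 18)"
    using sub_okD(2)[OF ok, of 0] by (simp add: ctx_type_0 subst_ren)
  have "env_ok ?G 16 es 16" using bind_defs_sound[OF es] e by simp
  moreover have "nf fuel ?G 16 es 16 None (Fst (Fst (Var 0))) = Some (Var 7, Pi (Var 15) (Var 12))"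
    using iso_records_check unfolding es eval_in.simps .
  ultimately have "evaluates ?G (subst (env_sub 16 es 16) (Fst (Fst (Var 0)))) (Var 7) (Pi (Var 15) (Var 12))"
    using sound_infer[OF nf_sound] by blast
  from evaluatesD(2)[OF this] show "iso_context \<turnstile> Fst (Fst (iso_src 2)) \<equiv> Var 7 : Pi (Var 15) (Var 12)"
    unfolding s by simp
qed

lemma iso_defs_bound: "\<exists>es. bind_defs [] 0 0 (Some []) iso_defs = Some es"
  by (simp only: iso_evals option.inject simp_thms)

text \<open>
  The generic context is inhabited by the concrete data at level \<open>l\<close>.  The laws of the categories are the
  given \<open>a\<close> and \<open>b\<close>; the other four properties are raised from level \<open>0\<close>.
\<close>

lemma sub_ok_iso:
  assumes a: "[] \<turnstile> a : \<lbrakk>Map_laws l\<rbrakk>" and b: "[] \<turnstile> b : \<lbrakk>Fam_laws l\<rbrakk>"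
  shows "\<exists>p q r t. sub_ok (map (raise l) iso_context) (extend Var
    [\<lbrakk>Map_ob l\<rbrakk>, \<lbrakk>Map_hom\<rbrakk>, \<lbrakk>Map_id\<rbrakk>, \<lbrakk>Map_cmp\<rbrakk>, \<lbrakk>Fam_ob l\<rbrakk>, \<lbrakk>Fam_hom\<rbrakk>, \<lbrakk>Fam_id\<rbrakk>, \<lbrakk>Fam_cmp\<rbrakk>, \<lbrakk>\<chi>\<rbrakk>,
      raise l \<lbrakk>\<^bold>\<lambda>x y. fib_map_fn x y\<rbrakk>, a, b, p, q, r, t]) []"
proof -
  let ?data = "map (\<lambda>d. fst d 0) iso_defs" and ?P = "\<lambda>k. (iso_law_types ! k) 10"
  let ?s = "\<lambda>k. raise l (extend Var ?data k)"
  obtain es where es: "bind_defs [] 0 0 (Some []) iso_defs = Some es"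
    using iso_defs_bound by blast
  have "map snd iso_defs = iso_data_types"
    by (simp add: iso_defs_def iso_data_def iso_data_types_def wildcat_data_types_def Let_def)
  note ok = raise_sub_ok[OF sub_ok_defs[OF es, unfolded this], of l]
  \<comment> \<open>whatever holds of the data at level \<open>0\<close> is carried over to level \<open>l\<close>\<close>
  have raised: "\<exists>p. [] \<turnstile> p : subst ?s (raise l P)" if "inhabited (subst (extend Var ?data) P)" for P
    using that raise_derivable(2)[of "[]" _ "subst (extend Var ?data) P" l]
    by (auto simp: inhabited_def raise_subst)
  obtain p q r t where p: "[] \<turnstile> p : subst ?s (raise l (?P 2))" "[] \<turnstile> q : subst ?s (raise l (?P 3))"
    "[] \<turnstile> r : subst ?s (raise l (?P 4))" "[] \<turnstile> t : subst ?s (raise l (?P 5))"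
    using raised chi_id_inhabited chi_comp_inhabited chi_equiv_inhabited chi_arrows_inhabited by meson
  have "[] \<turnstile> a : subst ?s (raise l (?P 0))" "[] \<turnstile> b : subst ?s (raise l (?P 1))"
    using a b unfolding raise_subst[symmetric] law_types_subst raise_Map_laws raise_Fam_laws by blast+
  with p have "list_all2 (\<lambda>p P. [] \<turnstile> p : subst ?s P) [a, b, p, q, r, t] (map (\<lambda>k. raise l (?P k)) [0, 1, 2, 3, 4, 5])"
    by (simp only: list.map list_all2_Cons list_all2_Nil simp_thms)
  moreover have "map (\<lambda>k. raise l (?P k)) [0, 1, 2, 3, 4, 5] = map (raise l) (map (\<lambda>P. P 10) iso_law_types)"
    by (simp add: iso_law_types_def)
  ultimately have "list_all2 (\<lambda>p P. [] \<turnstile> p : subst ?s P) [a, b, p, q, r, t] (map (raise l) (map (\<lambda>P. P 10) iso_law_types))"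
    by (simp only:)
  from hyps_sub_ok[OF ok this, of 0]
  have "sub_ok (map (raise l) iso_context) (extend ?s [a, b, p, q, r, t]) []"
    unfolding iso_context_def map_raise_hyps by simp
  then show ?thesis
    unfolding raise_extend iso_data_at
    by (auto simp: raise_data[unfolded One_nat_def] raise.simps)
qed

lemma raise_iso_src: "raise l (iso_src 0) = iso_src 0" "raise l (iso_src 1) = iso_src 1"
  by (simp_all add: iso_records_def wild_record_def expr_at lem_at)

lemma wild_category_isomorphism:
  assumes a: "[] \<turnstile> a : \<lbrakk>Map_laws l\<rbrakk>" and b: "[] \<turnstile> b : \<lbrakk>Fam_laws l\<rbrakk>"
  shows "[] \<turnstile> \<lbrakk>Map_cat l (const_expr a)\<rbrakk> : \<lbrakk>wildcat (Suc l) l\<rbrakk>"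
    "[] \<turnstile> \<lbrakk>Fam_cat l (const_expr b)\<rbrakk> : \<lbrakk>wildcat (Suc l) l\<rbrakk>"
    "\<exists>\<Phi>. [] \<turnstile> \<Phi> : \<lbrakk>naive_iso (Map_cat l (const_expr a)) (Fam_cat l (const_expr b))\<rbrakk> \<and>
        [] \<turnstile> \<lbrakk>on_objects (pr1 (const_expr \<Phi>))\<rbrakk> \<equiv> \<lbrakk>\<chi>\<rbrakk> : \<lbrakk>Map_ob l \<rightarrow> Fam_ob l\<rbrakk>"
proof -
  let ?c = "\<lbrakk>Map_cat l (const_expr a)\<rbrakk>" and ?d = "\<lbrakk>Fam_cat l (const_expr b)\<rbrakk>"
  obtain p q r t where ok: "sub_ok (map (raise l) iso_context) (extend Var
    [\<lbrakk>Map_ob l\<rbrakk>, \<lbrakk>Map_hom\<rbrakk>, \<lbrakk>Map_id\<rbrakk>, \<lbrakk>Map_cmp\<rbrakk>, \<lbrakk>Fam_ob l\<rbrakk>, \<lbrakk>Fam_hom\<rbrakk>, \<lbrakk>Fam_id\<rbrakk>, \<lbrakk>Fam_cmp\<rbrakk>, \<lbrakk>\<chi>\<rbrakk>,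
      raise l \<lbrakk>\<^bold>\<lambda>x y. fib_map_fn x y\<rbrakk>, a, b, p, q, r, t]) []" (is "sub_ok _ ?s _")
    using sub_ok_iso[OF a b] by blast
  note typed = subst_derivable(1)[OF raise_derivable(2) ok] and equal = subst_derivable(2)[OF raise_derivable(3) ok]
  have c: "subst ?s (iso_src 0) = ?c"
    by (simp add: iso_records_def wild_record_def expr_at lem_at closed_tm_def Map_cat_def eval_nat_numeral)
  have d: "subst ?s (iso_src 1) = ?d"
    by (simp add: iso_records_def wild_record_def expr_at lem_at closed_tm_def Fam_cat_def eval_nat_numeral)
  show C: "[] \<turnstile> ?c : \<lbrakk>wildcat (Suc l) l\<rbrakk>"
    using typed[OF generic_iso(1)] unfolding raise_iso_src c raise_wildcat subst_wildcat .
  show D: "[] \<turnstile> ?d : \<lbrakk>wildcat (Suc l) l\<rbrakk>"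
    using typed[OF generic_iso(2)] unfolding raise_iso_src d raise_wildcat subst_wildcat .
  let ?\<Phi> = "subst ?s (raise l (iso_src 2))"
  have "shift ?c = ?c" "shift ?d = ?d"
    using derivable_closed(2)[OF C] derivable_closed(2)[OF D] by (simp_all add: ren_closed)
  note iso = naive_iso_subst[OF this]
  \<comment> \<open>\<open>naive_iso\<close> is closed up to the two categories, so only their images under the substitution matter\<close>
  have "subst ?s (raise l (subst (case_nat (iso_src 1) (case_nat (iso_src 0) Var)) (naive_iso (lem 16) (lem 17) 18))) =
    subst (\<lambda>k. subst ?s (raise l (case_nat (iso_src 1) (case_nat (iso_src 0) Var) k))) (naive_iso (lem 16) (lem 17) 18)"
    unfolding raise_subst subst_subst naive_iso_raise ..
  also have "\<dots> = subst (case_nat ?d (case_nat ?c Var)) (naive_iso (lem 16) (lem 17) 18)"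
    by (rule subst_cong_closed_at[OF closed_naive_iso])
      (auto simp: raise_iso_src c d simp del: extend.simps One_nat_def dest!: less_2_cases)
  also have "\<dots> = \<lbrakk>naive_iso (Map_cat l (const_expr a)) (Fam_cat l (const_expr b))\<rbrakk>"
    unfolding iso using const_Map_cat[of l a] const_Fam_cat[of l b] by simp
  finally have "[] \<turnstile> ?\<Phi> : \<lbrakk>naive_iso (Map_cat l (const_expr a)) (Fam_cat l (const_expr b))\<rbrakk>"
    using typed[OF generic_iso(3)] by (simp only:)
  moreover have "\<lbrakk>Map_ob l \<rightarrow> Fam_ob l\<rbrakk> = subst ?s (Pi (Var 15) (Var 12))"
    by (simp add: closed_tm_def expr_at Map_ob_def Fam_ob_def eval_nat_numeral)
  then have "[] \<turnstile> Fst (Fst ?\<Phi>) \<equiv> \<lbrakk>\<chi>\<rbrakk> : \<lbrakk>Map_ob l \<rightarrow> Fam_ob l\<rbrakk>"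
    using equal[OF generic_iso(4)] by (simp add: eval_nat_numeral)
  ultimately show "\<exists>\<Phi>. [] \<turnstile> \<Phi> : \<lbrakk>naive_iso (Map_cat l (const_expr a)) (Fam_cat l (const_expr b))\<rbrakk> \<and>
        [] \<turnstile> \<lbrakk>on_objects (pr1 (const_expr \<Phi>))\<rbrakk> \<equiv> \<lbrakk>\<chi>\<rbrakk> : \<lbrakk>Map_ob l \<rightarrow> Fam_ob l\<rbrakk>"
    by (auto simp: on_objects_def closed_tm_def expr_at intro!: exI[of _ ?\<Phi>])
qed

lemma laws_inhabited: "\<exists>a. [] \<turnstile> a : \<lbrakk>Map_laws l\<rbrakk>" "\<exists>b. [] \<turnstile> b : \<lbrakk>Fam_laws l\<rbrakk>"
  using Map_laws_inhabited Fam_laws_inhabited raise_derivable(2)[of "[]" _ "\<lbrakk>Map_laws 0\<rbrakk>" l]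
   raise_derivable(2)[of "[]" _ "\<lbrakk>Fam_laws 0\<rbrakk>" l]
  unfolding law_types_subst inhabited_def raise_Map_laws raise_Fam_laws by auto

theorem proposition3p3:
  fixes l :: nat
  shows "(\<exists>a. [] \<turnstile> a : \<lbrakk>Map_laws l\<rbrakk>) \<and>
    (\<exists>b. [] \<turnstile> b : \<lbrakk>Fam_laws l\<rbrakk>) \<and>
    (\<forall>a b. [] \<turnstile> a : \<lbrakk>Map_laws l\<rbrakk> \<longrightarrow> [] \<turnstile> b : \<lbrakk>Fam_laws l\<rbrakk> \<longrightarrow>
      [] \<turnstile> \<lbrakk>Map_cat l (const_expr a)\<rbrakk> : \<lbrakk>wildcat (Suc l) l\<rbrakk> \<and>
      [] \<turnstile> \<lbrakk>Fam_cat l (const_expr b)\<rbrakk> : \<lbrakk>wildcat (Suc l) l\<rbrakk> \<and>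
      (\<exists>\<Phi>. [] \<turnstile> \<Phi> : \<lbrakk>naive_iso (Map_cat l (const_expr a)) (Fam_cat l (const_expr b))\<rbrakk> \<and>
        [] \<turnstile> \<lbrakk>on_objects (pr1 (const_expr \<Phi>))\<rbrakk> \<equiv> \<lbrakk>\<chi>\<rbrakk> : \<lbrakk>Map_ob l \<rightarrow> Fam_ob l\<rbrakk>))"
  using laws_inhabited wild_category_isomorphism by simp

end
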